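(* Let $s\in(0,1/2]$, $T>0$ and $v^0\in\dot H^s$. Then the system $$\partial_t v_k=\tfrac12 ik\sum_{k_1+k_2=k}e^{3ikk_1k_2t}v_{k_1}v_{k_2},\qquad k\in\mathbb{Z}_0,\qquad v(0)=v^0,$$ has a solution $v$ on $[0,T]$ (in the sense described in the context) which is the unique solution on $[0,T]$, belongs to $C([0,T];\dot H^s)$, and depends Lipschitz continuously on the initial data: for every $R>0$ there is $C=C(s,T,R)$ such that if $v^0,w^0\in\dot H^s$ with $\|v^0\|_{\dot H^s},\|w^0\|_{\dot H^s}\le R$ and $v,w$ are the corresponding solutions, then $\sup_{t\in[0,T]}\|v(t)-w(t)\|_{\dot H^s}\le C\|v^0-w^0\|_{\dot H^s}$.
   Context: Write $\mathbb{Z}_0=\mathbb{Z}\setminus\{0\}$. For $s\in\mathbb{R}$, $\dot H^s$ denotes the Hilbert space of sequences $v=(v_k)_{k\in\mathbb{Z}_0}$ of complex numbers with $v_{-k}=\overline{v_k}$ and $\|v\|_{\dot H^s}^2=\sum_{k\in\mathbb{Z}_0}|k|^{2s}|v_k|^2<\infty$. The system above is the periodic KdV equation $\partial_tu=u\partial_xu+\partial_x^3u$ written for $v_k(t)=e^{ik^3t}u_k(t)$, $u_k$ the Fourier coefficients of $u$; sums are over $k_1,k_2\in\mathbb{Z}_0$. A function $v$ is a solution on $[0,T]$ with $v(0)=v^0$ if $v\in L_\infty([0,T];\dot H^0)$ and for every $k\in\mathbb{Z}_0$ and $t\in[0,T]$, $$v_k(t)-v^0_k=\tfrac12 ik\int_0^t\sum_{k_1+k_2=k}e^{3ikk_1k_2\tau}v_{k_1}(\tau)v_{k_2}(\tau)\,d\tau.$$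 *)

theory Defs
  imports "HOL-Analysis.Analysis"
begin

text \<open>Sequences indexed by the nonzero integers are represented as functions
  int \<Rightarrow> complex whose value at 0 is normalised to 0.\<close>

definition Hdot :: "real \<Rightarrow> (int \<Rightarrow> complex) set" where
  "Hdot s = {v. v 0 = 0 \<and> (\<forall>k. v (-k) = cnj (v k)) \<and>
     ((\<lambda>k. real_of_int (abs k) powr (2 * s) * (cmod (v k))^2) summable_on (UNIV - {0}))}"

definition hs_norm :: "real \<Rightarrow> (int \<Rightarrow> complex) \<Rightarrow> real" where
  "hs_norm s v = sqrt (\<Sum>\<^sub>\<infinity>k\<in>UNIV - {0}. real_of_int (abs k) powr (2 * s) * (cmod (v k))^2)"

definition kdv_rhs :: "(real \<Rightarrow> int \<Rightarrow> complex) \<Rightarrow> int \<Rightarrow> real \<Rightarrow> complex" where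
  "kdv_rhs v k \<tau> = (\<Sum>\<^sub>\<infinity>k1\<in>{k1. k1 \<noteq> 0 \<and> k - k1 \<noteq> 0}.
      exp (\<i> * of_real (3 * real_of_int (k * k1 * (k - k1)) * \<tau>)) * v \<tau> k1 * v \<tau> (k - k1))"

definition kdv_solution :: "real \<Rightarrow> (int \<Rightarrow> complex) \<Rightarrow> (real \<Rightarrow> int \<Rightarrow> complex) \<Rightarrow> bool" where
  "kdv_solution T v0 v \<longleftrightarrow>
     (\<forall>t\<in>{0..T}. v t \<in> Hdot 0) \<and>
     (\<exists>M. AE t in lborel. t \<in> {0..T} \<longrightarrow> hs_norm 0 (v t) \<le> M) \<and>
     (\<forall>k t. k \<noteq> 0 \<longrightarrow> t \<in> {0..T} \<longrightarrow>
        set_integrable lborel {0..t} (kdv_rhs v k) \<and>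
        v t k - v0 k = (1/2) * \<i> * of_int k * (LINT \<tau>:{0..t}|lborel. kdv_rhs v k \<tau>))"

end

theory Submission
  imports Defs "HOL-Library.Nat_Bijection" "HOL-Complex_Analysis.Great_Picard"
begin

text \<open>
  Integrating by parts in time twice, against the phases \<open>3kk\<^sub>1k\<^sub>2\<close> and
  \<open>3(k\<^sub>1+k\<^sub>2)(k\<^sub>2+k\<^sub>3)(k\<^sub>3+k\<^sub>1)\<close>, turns the equation into one whose boundary terms gain a factor
  \<open>1/\<bar>k\<bar>\<close> and whose remaining terms (a resonant cubic one and a quartic one) are bounded on \<open>\<ell>\<^sup>2\<close>.
  Since \<open>\<bar>k\<bar>\<^sup>s\<close> is subadditive for \<open>0 \<le> s \<le> 1\<close>, all these bounds are tame in \<open>H\<^sup>s\<close>. For the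
  difference of two solutions the boundary terms at frequencies \<open>\<bar>k\<bar> > N\<close> are absorbed by taking \<open>N\<close>
  large, the frequencies \<open>\<bar>k\<bar> \<le> N\<close> are estimated from the equation itself, and Gronwall's inequality
  yields at once uniqueness in \<open>L\<^sub>\<infinity>H\<^sup>0\<close>, a priori bounds in \<open>H\<^sup>s\<close> that depend only on the \<open>H\<^sup>0\<close> bound,
  and the Lipschitz estimate. Solutions are limits of Galerkin truncations: these conserve the \<open>H\<^sup>0\<close>
  norm, obey the same a priori bounds, and boundedness in \<open>H\<^sup>s\<close> with \<open>s > 0\<close> makes the limit strong in
  \<open>H\<^sup>0\<close>. Continuity in \<open>H\<^sup>s\<close> follows by uniform approximation with solutions bounded in \<open>H\<^sup>1\<close>.
\<close>


section \<open>Sums over the integers\<close>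

text \<open>The factor k of the equation is recovered exactly by the first integration by parts,
  whose phase is 3 k k1 k2. But the differentiated mode brings back a factor k2, and the cubic sum
  that results, with only 1/k1 in front, need not be square summable for v merely in l2. This forces
  the second integration by parts off the resonant set. Its quartic remainder contains yet another
  derivative, which has to be paid out of the four reciprocals 1/k1, 1/(k1+k2), 1/(k2+k3),
  1/(k3+k1). Three are left, and three suffice: the convolution hidden in the remainder is bounded,
  and the other two factors are in l2. No symmetrised or exact normal form equation is written down.
  Differences of products are majorised by absolute values term by term, and the phases survive only
  through their denominators. For this reason sums are \<open>ennreal\<close> valued and norms are
  kept squared: exchanging sums and meeting divergent series then cost no side conditions.\<close>

abbreviation csum :: "('a \<Rightarrow> ennreal) \<Rightarrow> ennreal"  (binder "\<Sum>\<^sup>+" 10)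
  where "csum f \<equiv> nn_integral (count_space UNIV) f"

definition sqsum :: "(int \<Rightarrow> ennreal) \<Rightarrow> ennreal"
  where "sqsum f = (\<Sum>\<^sup>+k. (f k)\<^sup>2)"

definition recip :: "int \<Rightarrow> ennreal"
  where "recip n = ennreal (1 / \<bar>real_of_int n\<bar>)"

text \<open>Its value is 2 zeta(2) = \<pi>^2/3; only its finiteness matters.\<close>

definition recip_sqsum :: ennreal
  where "recip_sqsum = sqsum recip"

lemma csum_add: "(\<Sum>\<^sup>+x. f x + g x) = csum f + csum g"
  by (simp add: nn_integral_add)

lemma csum_cmult: "(\<Sum>\<^sup>+x. c * f x) = c * csum f"
  by (simp add: nn_integral_cmult)

lemma csum_mono: "(\<And>x. f x \<le> g x) \<Longrightarrow> csum f \<le> csum g"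
  by (intro nn_integral_mono) auto

lemma csum_swap:
  fixes f :: "'a::countable \<Rightarrow> 'b \<Rightarrow> ennreal"
  shows "(\<Sum>\<^sup>+x. \<Sum>\<^sup>+y. f x y) = (\<Sum>\<^sup>+y. \<Sum>\<^sup>+x. f x y)"
  by (rule nn_integral_count_space_nn_integral[symmetric]) auto

lemma csum_pair: "(\<Sum>\<^sup>+x. \<Sum>\<^sup>+y. f x y) = csum (\<lambda>(x, y). f x y)"
  using nn_integral_fst_count_space[of "\<lambda>(x, y). f x y"] by simp

text \<open>An upper bound needs only an injective change of variables, so substitutions in
  frequency sums never have to be inverted.\<close>

lemma csum_inj_le:
  assumes "inj g"
  shows "(\<Sum>\<^sup>+x. f (g x)) \<le> csum f"
proof -
  have "(\<Sum>\<^sup>+x. f (g x)) = nn_integral (count_space (range g)) f"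
    using assms by (intro nn_integral_bij_count_space) (simp add: inj_on_imp_bij_betw)
  also have "\<dots> = (\<Sum>\<^sup>+x. f x * indicator (range g) x)"
    by (simp add: nn_integral_count_space_indicator)
  also have "\<dots> \<le> csum f"
    by (intro csum_mono) (auto simp: indicator_def)
  finally show ?thesis .
qed

lemma csum_bij:
  assumes "bij g"
  shows "(\<Sum>\<^sup>+x. f (g x)) = csum f"
  using assms by (rule nn_integral_bij_count_space)

lemma csum_reflect: "(\<Sum>\<^sup>+x. f (k - x)) = csum f" for k :: int
  by (rule csum_bij) (auto intro!: o_bij[of "\<lambda>x. k - x"])

lemma csum_upper: "f x \<le> csum f"
proof -
  have "f x = (\<Sum>\<^sup>+y. f y * indicator {x} y)"
    by (subst nn_integral_indicator_finite) (auto simp: one_ennreal_def[symmetric])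
  also have "\<dots> \<le> csum f"
    by (intro csum_mono) (auto simp: indicator_def)
  finally show ?thesis .
qed

lemma csum_Cauchy_Schwarz: "(\<Sum>\<^sup>+x. f x * g x)\<^sup>2 \<le> (\<Sum>\<^sup>+x. (f x)\<^sup>2) * (\<Sum>\<^sup>+x. (g x)\<^sup>2)"
  by (rule Cauchy_Schwarz_nn_integral) auto

lemma csum_single_int:
  fixes F :: "int \<Rightarrow> ennreal"
  assumes "\<And>x. x \<noteq> a \<Longrightarrow> F x = 0"
  shows "csum F = F a"
proof -
  have "csum F = (\<Sum>\<^sup>+y. F y * indicator {a} y)"
    by (intro nn_integral_cong) (use assms in \<open>auto simp: indicator_def\<close>)
  also have "\<dots> = F a"
    by (subst nn_integral_indicator_finite) (auto simp: one_ennreal_def[symmetric])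
  finally show ?thesis .
qed

lemma sqsum_mono: "(\<And>k. f k \<le> g k) \<Longrightarrow> sqsum f \<le> sqsum g"
  unfolding sqsum_def by (intro csum_mono power_mono) auto

lemma sqsum_cmult: "sqsum (\<lambda>k. c * f k) = c\<^sup>2 * sqsum f"
  unfolding sqsum_def by (simp add: power_mult_distrib csum_cmult)

lemma sqsum_upper: "(f k)\<^sup>2 \<le> sqsum f"
  unfolding sqsum_def by (rule csum_upper)

lemma ennreal_sum2_sq: "(a + b)\<^sup>2 \<le> 2 * (a\<^sup>2 + b\<^sup>2)" for a b :: ennreal
proof (cases "a = top \<or> b = top")
  case True
  then show ?thesis by (auto simp: ennreal_top_eq_mult_iff power2_eq_square ennreal_mult_top)
next
  case False
  then obtain x y where xy: "a = ennreal x" "b = ennreal y" "x \<ge> 0" "y \<ge> 0"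
    by (metis ennreal_cases)
  have "(x + y)\<^sup>2 \<le> 2 * (x\<^sup>2 + y\<^sup>2)"
    using sum_squares_bound[of x y] by (simp add: power2_sum)
  then have "ennreal ((x + y)\<^sup>2) \<le> ennreal (2 * (x\<^sup>2 + y\<^sup>2))"
    by (rule ennreal_leI)
  also have "ennreal (2 * (x\<^sup>2 + y\<^sup>2)) = 2 * (a\<^sup>2 + b\<^sup>2)"
    unfolding xy(1,2) using xy(3,4) by (simp only: ennreal_power ennreal_mult[OF zero_le_numeral] ennreal_numeral ennreal_plus[symmetric] zero_le_power2 add_nonneg_nonneg)
  also have "ennreal ((x + y)\<^sup>2) = (a + b)\<^sup>2"
    unfolding xy(1,2) using xy(3,4) by (simp add: ennreal_power flip: ennreal_plus)
  finally show ?thesis .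
qed

text \<open>Grouping as \<open>(a + b) + c\<close> and using the two-term bound twice gives 4 in
  place of the sharp constant 3.\<close>

lemma ennreal_sum3_sq: "(a + b + c)\<^sup>2 \<le> 4 * (a\<^sup>2 + b\<^sup>2 + c\<^sup>2)" for a b c :: ennreal
proof -
  have "(a + b + c)\<^sup>2 \<le> 2 * ((a + b)\<^sup>2 + c\<^sup>2)"
    by (rule ennreal_sum2_sq)
  also have "\<dots> \<le> 2 * (2 * (a\<^sup>2 + b\<^sup>2) + 2 * c\<^sup>2)"
    by (intro mult_left_mono add_mono ennreal_sum2_sq) (auto simp: mult_2)
  finally show ?thesis by (simp add: algebra_simps)
qed

lemma sqsum_add2: "sqsum (\<lambda>k. f k + g k) \<le> 2 * (sqsum f + sqsum g)"
proof -
  have "sqsum (\<lambda>k. f k + g k) \<le> (\<Sum>\<^sup>+k. 2 * ((f k)\<^sup>2 + (g k)\<^sup>2))"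
    unfolding sqsum_def by (intro csum_mono ennreal_sum2_sq)
  then show ?thesis by (simp add: csum_cmult csum_add sqsum_def)
qed

lemma sqsum_add3: "sqsum (\<lambda>k. f k + g k + h k) \<le> 4 * (sqsum f + sqsum g + sqsum h)"
proof -
  have "sqsum (\<lambda>k. f k + g k + h k) \<le> (\<Sum>\<^sup>+k. 4 * ((f k)\<^sup>2 + (g k)\<^sup>2 + (h k)\<^sup>2))"
    unfolding sqsum_def by (intro csum_mono ennreal_sum3_sq)
  then show ?thesis by (simp add: csum_cmult csum_add sqsum_def)
qed

text \<open>Young's inequality from l2 and l2 to the sup norm. The nonlinearity of a square summable
  sequence is controlled in the sup norm only, which is why the trilinear estimates allow one factor
  to be merely bounded.\<close>

lemma convolution_Cauchy_Schwarz: "(\<Sum>\<^sup>+x. f x * g (k - x))\<^sup>2 \<le> sqsum f * sqsum g" for k :: int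
  using csum_Cauchy_Schwarz[of f "\<lambda>x. g (k - x)"] csum_reflect[of "\<lambda>x. (g x)\<^sup>2" k]
  by (simp add: sqsum_def)

section \<open>Reciprocals of integers and partial fractions\<close>

lemma recip_0 [simp]: "recip 0 = 0"
  by (simp add: recip_def)

lemma recip_le_1: "recip n \<le> 1"
proof (cases "n = 0")
  case False
  then have "1 \<le> \<bar>real_of_int n\<bar>" by (simp flip: of_int_abs)
  then have "1 / \<bar>real_of_int n\<bar> \<le> 1" by simp
  then show ?thesis unfolding recip_def by (metis ennreal_1 ennreal_leI)
qed auto

lemma abs_mult_recip: "ennreal \<bar>real_of_int n\<bar> * recip n = (if n = 0 then 0 else 1)"
  by (auto simp: recip_def simp flip: ennreal_mult)

text \<open>The partial fraction 1/(ab) = (1/k)(1/a + 1/b) in absolute values. It extracts the gain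
  1/|k| of the boundary terms.\<close>

lemma recip_mult_split:
  assumes "a + b = k" "k \<noteq> 0"
  shows "recip a * recip b \<le> recip k * (recip a + recip b)"
proof (cases "a = 0 \<or> b = 0")
  case False
  let ?a = "\<bar>real_of_int a\<bar>" and ?b = "\<bar>real_of_int b\<bar>" and ?k = "\<bar>real_of_int k\<bar>"
  have pos: "?a > 0" "?b > 0" "?k > 0" using False assms by auto
  have "?k \<le> ?a + ?b" using assms(1) by auto
  then have "1 / ?a * (1 / ?b) \<le> 1 / ?k * (1 / ?a + 1 / ?b)"
    using pos by (simp add: field_simps)
  then have "ennreal (1 / ?a * (1 / ?b)) \<le> ennreal (1 / ?k * (1 / ?a + 1 / ?b))"
    by (rule ennreal_leI)
  then show ?thesis
    using pos by (simp add: recip_def ennreal_mult[symmetric] flip: ennreal_plus)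
qed auto

text \<open>The same partial fraction used to pay for a derivative: at the frequency a - b it costs
  one of the two reciprocals and spares the other.\<close>

lemma abs_recip_mult_split:
  assumes "m = a - b"
  shows "ennreal \<bar>real_of_int m\<bar> * (recip a * recip b) \<le> recip a + recip b"
proof (cases "a = 0 \<or> b = 0")
  case False
  let ?a = "\<bar>real_of_int a\<bar>" and ?b = "\<bar>real_of_int b\<bar>" and ?k = "\<bar>real_of_int m\<bar>"
  have pos: "?a > 0" "?b > 0" using False assms by auto
  have "?k \<le> ?a + ?b" using assms(1) by auto
  then have "?k * (1 / ?a * (1 / ?b)) \<le> 1 / ?a + 1 / ?b"
    using pos by (simp add: field_simps)
  then have "ennreal (?k * (1 / ?a * (1 / ?b))) \<le> ennreal (1 / ?a + 1 / ?b)"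
    by (rule ennreal_leI)
  then show ?thesis
    using pos by (simp add: recip_def ennreal_mult[symmetric] flip: ennreal_plus)
qed auto

lemma recip_sqsum_finite: "recip_sqsum < top"
proof -
  have *: "(recip (int_decode n))\<^sup>2 \<le> ennreal (4 * inverse (real n ^ 2))" for n
  proof (cases "n = 0")
    case False
    let ?a = "\<bar>real_of_int (int_decode n)\<bar>"
    \<comment> \<open>\<open>int_decode\<close> runs through 0, -1, 1, -2, 2, ..., so its n-th value
      has modulus at least n/2.\<close>
    have "real n \<le> 2 * ?a"
      unfolding int_decode_def sum_decode_def by (auto elim!: evenE oddE)
    moreover have "real n > 0" using False by simp
    ultimately have "1 / ?a \<le> 2 / real n" by (simp add: field_simps)
    then have "(1 / ?a)\<^sup>2 \<le> (2 / real n)\<^sup>2" by (intro power_mono) auto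
    also have "\<dots> = 4 * inverse (real n ^ 2)" by (simp add: power_divide field_simps)
    finally have "ennreal ((1 / ?a)\<^sup>2) \<le> ennreal (4 * inverse (real n ^ 2))" by (rule ennreal_leI)
    then show ?thesis by (simp add: recip_def ennreal_power)
  qed (simp add: int_decode_def sum_decode_def)
  have sm: "summable (\<lambda>n. 4 * inverse (real n ^ 2))"
    by (intro summable_mult inverse_power_summable) auto
  have "recip_sqsum = (\<Sum>\<^sup>+n. (recip (int_decode n))\<^sup>2)"
    unfolding recip_sqsum_def sqsum_def by (rule csum_bij[symmetric]) (rule bij_int_decode)
  also have "\<dots> \<le> (\<Sum>\<^sup>+n. ennreal (4 * inverse (real n ^ 2)))"
    by (intro csum_mono *)
  also have "\<dots> = ennreal (\<Sum>n. 4 * inverse (real n ^ 2))"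
    by (subst nn_integral_count_space_nat) (intro suminf_ennreal2 sm, simp)
  finally show ?thesis by (simp add: order_le_less_trans)
qed

text \<open>Cauchy-Schwarz in x isolates the reciprocal, whose squares sum to at most
  \<open>recip_sqsum\<close> uniformly in k by injectivity. The remaining double sum factorises
  after a translation in k. In use, \<open>p k x\<close> is x or k - x.\<close>

lemma recip_bilinear:
  fixes p :: "int \<Rightarrow> int \<Rightarrow> int"
  assumes "\<And>k. inj (p k)"
  shows "sqsum (\<lambda>k. \<Sum>\<^sup>+x. recip (p k x) * (f x * h (k - x))) \<le> recip_sqsum * (sqsum f * sqsum h)"
proof -
  have *: "(\<Sum>\<^sup>+x. recip (p k x) * (f x * h (k - x)))\<^sup>2
      \<le> recip_sqsum * (\<Sum>\<^sup>+x. (f x)\<^sup>2 * (h (k - x))\<^sup>2)" for k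
  proof -
    have "(\<Sum>\<^sup>+x. recip (p k x) * (f x * h (k - x)))\<^sup>2
      \<le> (\<Sum>\<^sup>+x. (recip (p k x))\<^sup>2) * (\<Sum>\<^sup>+x. (f x * h (k - x))\<^sup>2)"
      by (rule csum_Cauchy_Schwarz)
    also have "\<dots> \<le> recip_sqsum * (\<Sum>\<^sup>+x. (f x * h (k - x))\<^sup>2)"
      unfolding recip_sqsum_def sqsum_def
      by (intro mult_right_mono csum_inj_le[of "p k" "\<lambda>x. (recip x)\<^sup>2"] assms) auto
    finally show ?thesis by (simp add: power_mult_distrib)
  qed
  have shift: "(\<Sum>\<^sup>+k. (h (k - x))\<^sup>2) = sqsum h" for x
    unfolding sqsum_def by (rule csum_bij[of "\<lambda>k. k - x" "\<lambda>k. (h k)\<^sup>2"])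
      (auto intro!: o_bij[of "\<lambda>k. k + x"])
  have "sqsum (\<lambda>k. \<Sum>\<^sup>+x. recip (p k x) * (f x * h (k - x)))
      \<le> (\<Sum>\<^sup>+k. recip_sqsum * (\<Sum>\<^sup>+x. (f x)\<^sup>2 * (h (k - x))\<^sup>2))"
    unfolding sqsum_def[of "\<lambda>k. \<Sum>\<^sup>+x. recip (p k x) * (f x * h (k - x))"] by (intro csum_mono *)
  also have "\<dots> = recip_sqsum * (\<Sum>\<^sup>+x. (f x)\<^sup>2 * (\<Sum>\<^sup>+k. (h (k - x))\<^sup>2))"
    by (simp add: csum_cmult csum_swap[of "\<lambda>k x. (f x)\<^sup>2 * (h (k - x))\<^sup>2"])
  also have "\<dots> = recip_sqsum * (sqsum f * sqsum h)"
    by (simp add: shift nn_integral_multc sqsum_def[of f])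
  finally show ?thesis .
qed

text \<open>Of the three reciprocals, one (\<open>p\<close>) stays with the two square summable factors and two
  (\<open>q\<close>, \<open>r\<close>) make up the other Cauchy--Schwarz factor; no fractional powers are needed.\<close>

lemma recip_trilinear:
  fixes p q r a b :: "int \<Rightarrow> int \<Rightarrow> int \<Rightarrow> int"
  assumes inj_pab: "inj (\<lambda>(k, x, y). (p k x y, a k x y, b k x y))"
    and inj_qr: "\<And>k. inj (\<lambda>(x, y). (q k x y, r k x y))"
    and g: "\<And>k x y. (g k x y)\<^sup>2 \<le> c"
  shows "sqsum (\<lambda>k. \<Sum>\<^sup>+x. \<Sum>\<^sup>+y. recip (p k x y) * recip (q k x y) * recip (r k x y)
      * (g k x y * f (a k x y) * h (b k x y))) \<le> recip_sqsum ^ 3 * (c * (sqsum f * sqsum h))"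
proof -
  define S where "S = recip_sqsum"
  have qr: "csum (\<lambda>(x, y). (recip (q k x y) * recip (r k x y))\<^sup>2) \<le> S\<^sup>2" for k
  proof -
    have "csum (\<lambda>(x, y). (recip (q k x y) * recip (r k x y))\<^sup>2)
        = (\<Sum>\<^sup>+z. (\<lambda>(u, v). (recip u * recip v)\<^sup>2) ((\<lambda>(x, y). (q k x y, r k x y)) z))"
      by (intro nn_integral_cong) auto
    also have "\<dots> \<le> csum (\<lambda>(u, v). (recip u * recip v)\<^sup>2)"
      by (rule csum_inj_le[OF inj_qr])
    also have "\<dots> = S\<^sup>2"
      by (subst csum_pair[symmetric])
        (simp add: power_mult_distrib csum_cmult nn_integral_multc S_def recip_sqsum_def sqsum_def power2_eq_square[of "csum _"])
    finally show ?thesis .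
  qed
  have "(\<Sum>\<^sup>+x. \<Sum>\<^sup>+y. recip (p k x y) * recip (q k x y) * recip (r k x y)
      * (g k x y * f (a k x y) * h (b k x y)))\<^sup>2
      \<le> S\<^sup>2 * csum (\<lambda>(x, y). c * ((recip (p k x y))\<^sup>2 * (f (a k x y))\<^sup>2 * (h (b k x y))\<^sup>2))" for k
  proof -
    have "(\<Sum>\<^sup>+x. \<Sum>\<^sup>+y. recip (p k x y) * recip (q k x y) * recip (r k x y)
        * (g k x y * f (a k x y) * h (b k x y)))
      = (\<Sum>\<^sup>+z. (case z of (x, y) \<Rightarrow> recip (q k x y) * recip (r k x y)) *
          (case z of (x, y) \<Rightarrow> recip (p k x y) * (g k x y * f (a k x y) * h (b k x y))))"
      by (subst csum_pair) (auto intro!: nn_integral_cong simp: mult_ac)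
    then have "(\<Sum>\<^sup>+x. \<Sum>\<^sup>+y. recip (p k x y) * recip (q k x y) * recip (r k x y)
        * (g k x y * f (a k x y) * h (b k x y)))\<^sup>2 \<le>
       (\<Sum>\<^sup>+z. (case z of (x, y) \<Rightarrow> recip (q k x y) * recip (r k x y))\<^sup>2) *
       (\<Sum>\<^sup>+z. (case z of (x, y) \<Rightarrow> recip (p k x y) * (g k x y * f (a k x y) * h (b k x y)))\<^sup>2)"
      by (simp only: csum_Cauchy_Schwarz)
    also have "\<dots> \<le> S\<^sup>2 * csum (\<lambda>(x, y). c * ((recip (p k x y))\<^sup>2 * (f (a k x y))\<^sup>2 * (h (b k x y))\<^sup>2))"
    proof (intro mult_mono)
      show "(\<Sum>\<^sup>+z. (case z of (x, y) \<Rightarrow> recip (q k x y) * recip (r k x y))\<^sup>2) \<le> S\<^sup>2"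
        using qr[of k] by (simp add: case_prod_unfold)
      show "(\<Sum>\<^sup>+z. (case z of (x, y) \<Rightarrow> recip (p k x y) * (g k x y * f (a k x y) * h (b k x y)))\<^sup>2)
        \<le> csum (\<lambda>(x, y). c * ((recip (p k x y))\<^sup>2 * (f (a k x y))\<^sup>2 * (h (b k x y))\<^sup>2))"
      proof (intro csum_mono)
        fix z :: "int \<times> int"
        obtain x y where z: "z = (x, y)" by force
        have "(recip (p k x y) * (g k x y * f (a k x y) * h (b k x y)))\<^sup>2
          = (g k x y)\<^sup>2 * ((recip (p k x y))\<^sup>2 * (f (a k x y))\<^sup>2 * (h (b k x y))\<^sup>2)"
          by (simp add: power_mult_distrib mult_ac)
        also have "\<dots> \<le> c * ((recip (p k x y))\<^sup>2 * (f (a k x y))\<^sup>2 * (h (b k x y))\<^sup>2)"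
          by (intro mult_right_mono g) auto
        finally show "(case z of (x, y) \<Rightarrow> recip (p k x y) * (g k x y * f (a k x y) * h (b k x y)))\<^sup>2
          \<le> (case z of (x, y) \<Rightarrow> c * ((recip (p k x y))\<^sup>2 * (f (a k x y))\<^sup>2 * (h (b k x y))\<^sup>2))"
          by (simp add: z)
      qed
    qed auto
    finally show ?thesis .
  qed
  then have "sqsum (\<lambda>k. \<Sum>\<^sup>+x. \<Sum>\<^sup>+y. recip (p k x y) * recip (q k x y) * recip (r k x y)
      * (g k x y * f (a k x y) * h (b k x y)))
    \<le> (\<Sum>\<^sup>+k. S\<^sup>2 * csum (\<lambda>(x, y). c * ((recip (p k x y))\<^sup>2 * (f (a k x y))\<^sup>2 * (h (b k x y))\<^sup>2)))"
    unfolding sqsum_def by (intro csum_mono)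
  also have "\<dots> = S\<^sup>2 * (c * (\<Sum>\<^sup>+k. \<Sum>\<^sup>+z. (recip (p k (fst z) (snd z)))\<^sup>2 * (f (a k (fst z) (snd z)))\<^sup>2 * (h (b k (fst z) (snd z)))\<^sup>2))"
    by (simp add: csum_cmult case_prod_unfold)
  also have "(\<Sum>\<^sup>+k. \<Sum>\<^sup>+z. (recip (p k (fst z) (snd z)))\<^sup>2 * (f (a k (fst z) (snd z)))\<^sup>2 * (h (b k (fst z) (snd z)))\<^sup>2)
    = (\<Sum>\<^sup>+z. (\<lambda>(u, v, w). (recip u)\<^sup>2 * (f v)\<^sup>2 * (h w)\<^sup>2) ((\<lambda>(k, x, y). (p k x y, a k x y, b k x y)) z))"
    by (subst csum_pair) (auto intro!: nn_integral_cong)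
  \<comment> \<open>At this point k is summed as well. The three frequencies p, a, b determine (k,
    x, y), so the sum is dominated by one over three independent variables, which
    factorises.\<close>
  also have "\<dots> \<le> csum (\<lambda>(u, v, w). (recip u)\<^sup>2 * (f v)\<^sup>2 * (h w)\<^sup>2)"
    by (rule csum_inj_le[OF inj_pab])
  also have "\<dots> = (\<Sum>\<^sup>+u. \<Sum>\<^sup>+v. \<Sum>\<^sup>+w. (recip u)\<^sup>2 * (f v)\<^sup>2 * (h w)\<^sup>2)"
    by (subst csum_pair, subst csum_pair) (auto intro!: nn_integral_cong)
  also have "\<dots> = S * (sqsum f * sqsum h)"
    by (simp add: csum_cmult nn_integral_multc S_def recip_sqsum_def sqsum_def mult_ac)
  finally have "sqsum (\<lambda>k. \<Sum>\<^sup>+x. \<Sum>\<^sup>+y. recip (p k x y) * recip (q k x y) * recip (r k x y)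
      * (g k x y * f (a k x y) * h (b k x y))) \<le> S\<^sup>2 * (c * (S * (sqsum f * sqsum h)))"
    by (simp add: mult_left_mono)
  also have "\<dots> = S ^ 3 * (c * (sqsum f * sqsum h))"
    by (simp add: power2_eq_square power3_eq_cube mult_ac)
  finally show ?thesis by (simp add: S_def)
qed

section \<open>Multilinear estimates\<close>

definition conv :: "(int \<Rightarrow> ennreal) \<Rightarrow> (int \<Rightarrow> ennreal) \<Rightarrow> int \<Rightarrow> ennreal"
  where "conv f g k = (\<Sum>\<^sup>+x. f x * g (k - x))"

definition tri :: "(int \<Rightarrow> int \<Rightarrow> int \<Rightarrow> ennreal) \<Rightarrow>
    (int \<Rightarrow> ennreal) \<Rightarrow> (int \<Rightarrow> ennreal) \<Rightarrow> (int \<Rightarrow> ennreal) \<Rightarrow> int \<Rightarrow> ennreal"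
  where "tri m f g h k = (\<Sum>\<^sup>+x. \<Sum>\<^sup>+y. m k x y * (f x * g y * h (k - x - y)))"

text \<open>Tame: the weight reaches one argument at a time. The first argument of T is the one
  measured in the sup norm, the other two are measured in l2; permuting the arguments of
  \<open>tri\<close> moves the bounded slot to any of the three frequencies.\<close>

definition tame3 :: "((int \<Rightarrow> ennreal) \<Rightarrow> (int \<Rightarrow> ennreal) \<Rightarrow> (int \<Rightarrow> ennreal) \<Rightarrow> int \<Rightarrow> ennreal) \<Rightarrow> bool"
  where "tame3 T \<longleftrightarrow>
    (\<forall>w g f h k. (\<forall>a b. w (a + b) \<le> w a + w b) \<longrightarrow>
        w k * T g f h k \<le> T (\<lambda>j. w j * g j) f h k + T g (\<lambda>j. w j * f j) h k + T g f (\<lambda>j. w j * h j) k) \<and>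
    (\<forall>g f h c. (\<forall>j. (g j)\<^sup>2 \<le> c) \<longrightarrow> sqsum (T g f h) \<le> recip_sqsum ^ 3 * (c * (sqsum f * sqsum h)))"

text \<open>For \<open>x = k\<^sub>1\<close>, \<open>y = k\<^sub>2\<close>, \<open>k - x - y = k\<^sub>3\<close> put \<open>A = k\<^sub>1 + k\<^sub>2\<close>, \<open>B = k\<^sub>2 + k\<^sub>3 = k - x\<close> and
  \<open>C = k\<^sub>3 + k\<^sub>1 = k - y\<close>. The three letters of \<open>ker_ABC\<close> are its reciprocals; the kernels with two letters
  have the additional reciprocal \<open>1/k\<^sub>1\<close>. Since \<open>recip 0 = 0\<close>, resonant terms drop out of all of them.\<close>

definition ker_ABC :: "int \<Rightarrow> int \<Rightarrow> int \<Rightarrow> ennreal"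
  where "ker_ABC k x y = recip (x + y) * recip (k - x) * recip (k - y)"
definition ker_BC :: "int \<Rightarrow> int \<Rightarrow> int \<Rightarrow> ennreal"
  where "ker_BC k x y = recip x * recip (k - x) * recip (k - y)"
definition ker_AB :: "int \<Rightarrow> int \<Rightarrow> int \<Rightarrow> ennreal"
  where "ker_AB k x y = recip x * recip (x + y) * recip (k - x)"
definition ker_AC :: "int \<Rightarrow> int \<Rightarrow> int \<Rightarrow> ennreal"
  where "ker_AC k x y = recip x * recip (x + y) * recip (k - y)"

section \<open>Tame bounds for trilinear forms with three reciprocals\<close>

lemma tri_weight:
  assumes sub: "\<And>a b. w (a + b) \<le> w a + w b"
  shows "w k * tri m f g h k \<le>
    tri m (\<lambda>j. w j * f j) g h k + tri m f (\<lambda>j. w j * g j) h k + tri m f g (\<lambda>j. w j * h j) k"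
proof -
  have w3: "w k \<le> w x + w y + w (k - x - y)" for x y
  proof -
    have "w k \<le> w (x + y) + w (k - x - y)"
      using sub[of "x + y" "k - x - y"] by simp
    also have "\<dots> \<le> w x + w y + w (k - x - y)"
      by (intro add_right_mono sub)
    finally show ?thesis .
  qed
  have "w k * tri m f g h k = (\<Sum>\<^sup>+x. \<Sum>\<^sup>+y. w k * (m k x y * (f x * g y * h (k - x - y))))"
    by (simp add: tri_def csum_cmult)
  also have "\<dots> \<le> (\<Sum>\<^sup>+x. \<Sum>\<^sup>+y. (w x + w y + w (k - x - y)) * (m k x y * (f x * g y * h (k - x - y))))"
    by (intro csum_mono mult_right_mono w3) auto
  also have "\<dots> = tri m (\<lambda>j. w j * f j) g h k + tri m f (\<lambda>j. w j * g j) h k + tri m f g (\<lambda>j. w j * h j) k"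
    by (simp add: tri_def distrib_left distrib_right csum_add mult_ac)
  finally show ?thesis .
qed

text \<open>The bounded factor sits at x, so the square summable ones sit at y and k - x - y. These
  two frequencies together with p must determine (k, x, y), while q and r must determine (x, y) once
  k is fixed. The next two lemmas repeat this with the bounded factor at y and at k - x - y.\<close>

lemma tri_slot1:
  assumes "\<And>k x y. m k x y = recip (p k x y) * recip (q k x y) * recip (r k x y)"
    and "inj (\<lambda>(k, x, y). (p k x y, y, k - x - y))" "\<And>k. inj (\<lambda>(x, y). (q k x y, r k x y))"
  shows "tame3 (tri m)"
  unfolding tame3_def
proof (intro conjI allI impI)
  fix g f h :: "int \<Rightarrow> ennreal" and c assume g: "\<forall>j. (g j)\<^sup>2 \<le> c"
  have "sqsum (\<lambda>k. \<Sum>\<^sup>+x. \<Sum>\<^sup>+y. recip (p k x y) * recip (q k x y) * recip (r k x y) *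
     (g x * f y * h (k - x - y))) \<le> recip_sqsum ^ 3 * (c * (sqsum f * sqsum h))"
    by (rule recip_trilinear[OF assms(2,3)]) (simp add: g)
  then show "sqsum (tri m g f h) \<le> recip_sqsum ^ 3 * (c * (sqsum f * sqsum h))"
    unfolding tri_def assms(1) .
qed (auto intro!: tri_weight)

lemma tri_slot2:
  assumes "\<And>k x y. m k x y = recip (p k x y) * recip (q k x y) * recip (r k x y)"
    and "inj (\<lambda>(k, x, y). (p k x y, x, k - x - y))" "\<And>k. inj (\<lambda>(x, y). (q k x y, r k x y))"
  shows "tame3 (\<lambda>g f h. tri m f g h)"
  unfolding tame3_def
proof (intro conjI allI impI)
  fix g f h :: "int \<Rightarrow> ennreal" and c assume g: "\<forall>j. (g j)\<^sup>2 \<le> c"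
  have "sqsum (\<lambda>k. \<Sum>\<^sup>+x. \<Sum>\<^sup>+y. recip (p k x y) * recip (q k x y) * recip (r k x y) *
     (g y * f x * h (k - x - y))) \<le> recip_sqsum ^ 3 * (c * (sqsum f * sqsum h))"
    by (rule recip_trilinear[OF assms(2,3)]) (simp add: g)
  moreover have "tri m f g h = (\<lambda>k. \<Sum>\<^sup>+x. \<Sum>\<^sup>+y. recip (p k x y) * recip (q k x y) * recip (r k x y) *
     (g y * f x * h (k - x - y)))"
    by (simp add: fun_eq_iff tri_def assms(1) mult_ac)
  ultimately show "sqsum (tri m f g h) \<le> recip_sqsum ^ 3 * (c * (sqsum f * sqsum h))"
    by simp
next
  fix w g f h :: "int \<Rightarrow> ennreal" and k assume "\<forall>a b. w (a + b) \<le> w a + w b"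
  then show "w k * tri m f g h k \<le> tri m f (\<lambda>j. w j * g j) h k + tri m (\<lambda>j. w j * f j) g h k + tri m f g (\<lambda>j. w j * h j) k"
    using tri_weight[of w k m f g h] by (simp add: add_ac)
qed

lemma tri_slot3:
  assumes "\<And>k x y. m k x y = recip (p k x y) * recip (q k x y) * recip (r k x y)"
    and "inj (\<lambda>(k, x, y). (p k x y, x, y))" "\<And>k. inj (\<lambda>(x, y). (q k x y, r k x y))"
  shows "tame3 (\<lambda>g f h. tri m f h g)"
  unfolding tame3_def
proof (intro conjI allI impI)
  fix g f h :: "int \<Rightarrow> ennreal" and c assume g: "\<forall>j. (g j)\<^sup>2 \<le> c"
  have "sqsum (\<lambda>k. \<Sum>\<^sup>+x. \<Sum>\<^sup>+y. recip (p k x y) * recip (q k x y) * recip (r k x y) *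
     (g (k - x - y) * f x * h y)) \<le> recip_sqsum ^ 3 * (c * (sqsum f * sqsum h))"
    by (rule recip_trilinear[OF assms(2,3)]) (simp add: g)
  moreover have "tri m f h g = (\<lambda>k. \<Sum>\<^sup>+x. \<Sum>\<^sup>+y. recip (p k x y) * recip (q k x y) * recip (r k x y) *
     (g (k - x - y) * f x * h y))"
    by (simp add: fun_eq_iff tri_def assms(1) mult_ac)
  ultimately show "sqsum (tri m f h g) \<le> recip_sqsum ^ 3 * (c * (sqsum f * sqsum h))"
    by simp
next
  fix w g f h :: "int \<Rightarrow> ennreal" and k assume "\<forall>a b. w (a + b) \<le> w a + w b"
  then show "w k * tri m f h g k \<le> tri m f h (\<lambda>j. w j * g j) k + tri m (\<lambda>j. w j * f j) h g k + tri m f (\<lambda>j. w j * h j) g k"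
    using tri_weight[of w k m f h g] by (simp add: add_ac)
qed

text \<open>What matters is the choice of p, which must not be a function of the two square summable
  frequencies. Here y + (k - x - y) = k - x rules out k - x, whereas x + y is admissible. The other
  five choices follow the same rule.\<close>

lemma tame3_ABC1: "tame3 (tri ker_ABC)"
  by (rule tri_slot1[where p="\<lambda>k x y. x + y" and q="\<lambda>k x y. k - x" and r="\<lambda>k x y. k - y"])
    (auto simp: ker_ABC_def inj_on_def)
lemma tame3_ABC2: "tame3 (\<lambda>g f h. tri ker_ABC f g h)"
  by (rule tri_slot2[where p="\<lambda>k x y. x + y" and q="\<lambda>k x y. k - x" and r="\<lambda>k x y. k - y"])
    (auto simp: ker_ABC_def inj_on_def)
lemma tame3_ABC3: "tame3 (\<lambda>g f h. tri ker_ABC f h g)"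
  by (rule tri_slot3[where p="\<lambda>k x y. k - x" and q="\<lambda>k x y. x + y" and r="\<lambda>k x y. k - y"])
    (auto simp: ker_ABC_def inj_on_def mult_ac)
lemma tame3_BC2: "tame3 (\<lambda>g f h. tri ker_BC f g h)"
  by (rule tri_slot2[where p="\<lambda>k x y. k - x" and q="\<lambda>k x y. x" and r="\<lambda>k x y. k - y"])
    (auto simp: ker_BC_def inj_on_def mult_ac)
lemma tame3_AB3: "tame3 (\<lambda>g f h. tri ker_AB f h g)"
  by (rule tri_slot3[where p="\<lambda>k x y. k - x" and q="\<lambda>k x y. x" and r="\<lambda>k x y. x + y"])
    (auto simp: ker_AB_def inj_on_def mult_ac)
lemma tame3_AC1: "tame3 (tri ker_AC)"
  by (rule tri_slot1[where p="\<lambda>k x y. x + y" and q="\<lambda>k x y. x" and r="\<lambda>k x y. k - y"])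
    (auto simp: ker_AC_def inj_on_def mult_ac)

text \<open>The factor 1/k1 left by the first integration by parts times the three reciprocals
  gained by the second.\<close>

definition ker4 :: "int \<Rightarrow> int \<Rightarrow> int \<Rightarrow> ennreal"
  where "ker4 k x y = recip x * recip (x + y) * recip (k - x) * recip (k - y)"

text \<open>Majorants for differences of products: in \<open>d2\<close>, \<open>d3\<close> and
  \<open>d4\<close> every monomial carries exactly one difference, z or \<open>Zc\<close>, and
  otherwise the sizes u and \<open>Uc\<close>. \<open>Zc\<close> and \<open>Uc\<close> stand for the
  difference and the size of the nonlinearity. The locale is free of assumptions so that it can be
  instantiated at every time.\<close>

locale pair_forms =
  fixes z u :: "int \<Rightarrow> ennreal"
begin

definition Zc :: "int \<Rightarrow> ennreal" where "Zc k = conv z u k + conv u z k"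
definition Uc :: "int \<Rightarrow> ennreal" where "Uc k = conv u u k"

definition quartic where "quartic T k = T Zc u u k + T Uc z u k + T Uc u z k"
definition cubic where "cubic T k = T z u u k + T u z u k + T u u z k"

definition d2 :: "int \<Rightarrow> int \<Rightarrow> ennreal"
  where "d2 k x = z x * u (k - x) + u x * z (k - x)"
definition d3 :: "int \<Rightarrow> int \<Rightarrow> int \<Rightarrow> ennreal"
  where "d3 k x y = z x * u y * u (k - x - y) + u x * z y * u (k - x - y) + u x * u y * z (k - x - y)"
definition d4a :: "int \<Rightarrow> int \<Rightarrow> int \<Rightarrow> ennreal"
  where "d4a k x y = Zc x * u y * u (k - x - y) + Uc x * z y * u (k - x - y) + Uc x * u y * z (k - x - y)"
definition d4b :: "int \<Rightarrow> int \<Rightarrow> int \<Rightarrow> ennreal"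
  where "d4b k x y = u x * Zc y * u (k - x - y) + z x * Uc y * u (k - x - y) + u x * Uc y * z (k - x - y)"
definition d4c :: "int \<Rightarrow> int \<Rightarrow> int \<Rightarrow> ennreal"
  where "d4c k x y = u x * u y * Zc (k - x - y) + z x * u y * Uc (k - x - y) + u x * z y * Uc (k - x - y)"

text \<open>Majorises the difference of the time derivatives of two cubic products: differentiating
  the mode j costs |j| and replaces the mode by the nonlinearity.\<close>

definition d4 :: "int \<Rightarrow> int \<Rightarrow> int \<Rightarrow> ennreal"
  where "d4 k x y = ennreal \<bar>real_of_int x\<bar> * d4a k x y + ennreal \<bar>real_of_int y\<bar> * d4b k x y
    + ennreal \<bar>real_of_int (k - x - y)\<bar> * d4c k x y"

definition bnd :: "int \<Rightarrow> ennreal"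
  where "bnd k = (\<Sum>\<^sup>+x. recip x * recip (k - x) * d2 k x) + (\<Sum>\<^sup>+x. \<Sum>\<^sup>+y. ker4 k x y * d3 k x y)"
text \<open>The resonant set of the second phase without its component k = x: there the outer
  product contains the mode 0 and vanishes.\<close>

definition res :: "int \<Rightarrow> ennreal"
  where "res k = (\<Sum>\<^sup>+x. \<Sum>\<^sup>+y. recip x * (if x + y = 0 \<or> k = y then d3 k x y else 0))"
definition rem :: "int \<Rightarrow> ennreal"
  where "rem k = res k + (\<Sum>\<^sup>+x. \<Sum>\<^sup>+y. ker4 k x y * d4 k x y)"

end

text \<open>The tame pair \<open>(z, u)\<close> stands for \<open>z = \<bar>v - v'\<bar>\<close> and \<open>u = \<bar>v\<bar> + \<bar>v'\<bar>\<close>. Hypothesis \<open>cross\<close> holds both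
  when \<open>v' = 0\<close> (a priori bounds, with \<open>L\<close> independent of the weighted norms) and when
  both weighted norms are bounded (Lipschitz bounds).\<close>

lemma ennreal_three: "x + x + x = 3 * x" for x :: ennreal
  by (metis distrib_right mult_1 numeral_Bit1 numeral_One)

locale tame_pair = pair_forms z u for z u :: "int \<Rightarrow> ennreal" +
  fixes w :: "int \<Rightarrow> ennreal" and L :: ennreal
  assumes weight_sub: "\<And>a b. w (a + b) \<le> w a + w b"
    and sq_u: "sqsum u \<le> L"
    and cross: "sqsum z * sqsum (\<lambda>k. w k * u k) \<le> L * sqsum (\<lambda>k. w k * z k)"
begin

abbreviation "Y \<equiv> sqsum (\<lambda>k. w k * z k)"
abbreviation "Wu \<equiv> sqsum (\<lambda>k. w k * u k)"
abbreviation "S \<equiv> recip_sqsum"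

lemma tame3_sq:
  assumes "tame3 T" "\<And>j. (g j)\<^sup>2 \<le> c" "\<And>j. (w j * g j)\<^sup>2 \<le> c'"
  shows "sqsum (\<lambda>k. w k * T g f h k) \<le> 4 * S ^ 3 * (c' * (sqsum f * sqsum h)
    + c * (sqsum (\<lambda>k. w k * f k) * sqsum h) + c * (sqsum f * sqsum (\<lambda>k. w k * h k)))"
proof -
  have "sqsum (\<lambda>k. w k * T g f h k) \<le> sqsum (\<lambda>k. T (\<lambda>j. w j * g j) f h k + T g (\<lambda>j. w j * f j) h k + T g f (\<lambda>j. w j * h j) k)"
    using assms(1) weight_sub unfolding tame3_def by (intro sqsum_mono) blast
  also have "\<dots> \<le> 4 * (sqsum (T (\<lambda>j. w j * g j) f h) + sqsum (T g (\<lambda>j. w j * f j) h) + sqsum (T g f (\<lambda>j. w j * h j)))"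
    by (rule sqsum_add3)
  also have "\<dots> \<le> 4 * (S ^ 3 * (c' * (sqsum f * sqsum h)) + S ^ 3 * (c * (sqsum (\<lambda>k. w k * f k) * sqsum h))
      + S ^ 3 * (c * (sqsum f * sqsum (\<lambda>k. w k * h k))))"
    using assms unfolding tame3_def by (intro mult_left_mono add_mono) auto
  finally show ?thesis by (simp add: algebra_simps)
qed

text \<open>The difference occupies the bounded slot. When the weight falls on u, the product of
  \<open>sqsum z\<close> and \<open>Wu\<close> appears, and \<open>cross\<close> converts it into
  \<open>L * Y\<close>. The constant 12 is three equal terms times the 4 of
  \<open>sqsum_add3\<close>.\<close>

lemma tame3_z:
  assumes "tame3 T" "\<And>j. (g j)\<^sup>2 \<le> a * sqsum z" "\<And>j. (w j * g j)\<^sup>2 \<le> a * Y"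
  shows "sqsum (\<lambda>k. w k * T g u u k) \<le> 12 * S ^ 3 * (a * L\<^sup>2) * Y"
proof -
  have 1: "a * Y * (sqsum u * sqsum u) \<le> a * Y * (L * L)"
    by (intro mult_mono sq_u) auto
  have 2: "a * sqsum z * (Wu * sqsum u) \<le> a * Y * (L * L)"
  proof -
    have "a * sqsum z * (Wu * sqsum u) = a * (sqsum z * Wu) * sqsum u" by (simp add: mult_ac)
    also have "\<dots> \<le> a * (L * Y) * L" by (intro mult_mono cross sq_u) auto
    finally show ?thesis by (simp add: mult_ac)
  qed
  have 3: "a * sqsum z * (sqsum u * Wu) \<le> a * Y * (L * L)"
    using 2 by (subst mult.commute[of "sqsum u"])
  have "sqsum (\<lambda>k. w k * T g u u k) \<le> 4 * S ^ 3 * (a * Y * (sqsum u * sqsum u)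
    + a * sqsum z * (Wu * sqsum u) + a * sqsum z * (sqsum u * Wu))"
    by (rule tame3_sq[OF assms])
  also have "\<dots> \<le> 4 * S ^ 3 * (a * Y * (L * L) + a * Y * (L * L) + a * Y * (L * L))"
    by (rule mult_left_mono[OF add_mono[OF add_mono[OF 1 2] 3]]) simp
  also have "\<dots> = 4 * S ^ 3 * (3 * (a * Y * (L * L)))"
    unfolding ennreal_three ..
  finally show ?thesis by (simp add: power2_eq_square mult_ac)
qed

text \<open>Now u or its convolution fills the bounded slot, with bounds b and c'. The last
  hypothesis is \<open>cross\<close> transported to that slot.\<close>

lemma tame3_u:
  assumes "tame3 T" "\<And>j. (g j)\<^sup>2 \<le> b" "\<And>j. (w j * g j)\<^sup>2 \<le> c'" "c' * sqsum z \<le> b * Y"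
  shows "sqsum (\<lambda>k. w k * T g z u k) \<le> 12 * S ^ 3 * (b * L) * Y" (is ?A)
    and "sqsum (\<lambda>k. w k * T g u z k) \<le> 12 * S ^ 3 * (b * L) * Y" (is ?B)
proof -
  have 1: "c' * (sqsum z * sqsum u) \<le> b * Y * L"
  proof -
    have "c' * (sqsum z * sqsum u) = (c' * sqsum z) * sqsum u" by (simp add: mult_ac)
    also have "\<dots> \<le> b * Y * L" by (intro mult_mono assms sq_u) auto
    finally show ?thesis .
  qed
  have 2: "b * (Y * sqsum u) \<le> b * Y * L"
    using mult_left_mono[OF sq_u, of "b * Y"] by (simp add: mult_ac)
  have 3: "b * (sqsum z * Wu) \<le> b * Y * L"
    using mult_left_mono[OF cross, of b] by (simp add: mult_ac)
  have c1: "c' * (sqsum u * sqsum z) \<le> b * Y * L" and c2: "b * (sqsum u * Y) \<le> b * Y * L"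
    and c3: "b * (Wu * sqsum z) \<le> b * Y * L"
    using 1 2 3 by (simp_all only: mult.commute)
  have "sqsum (\<lambda>k. w k * T g z u k) \<le> 4 * S ^ 3 * (c' * (sqsum z * sqsum u)
    + b * (Y * sqsum u) + b * (sqsum z * Wu))"
    by (rule tame3_sq[OF assms(1-3)])
  also have "\<dots> \<le> 4 * S ^ 3 * (b * Y * L + b * Y * L + b * Y * L)"
    by (rule mult_left_mono[OF add_mono[OF add_mono[OF 1 2] 3]]) simp
  finally show ?A unfolding ennreal_three by (simp add: power2_eq_square mult_ac)
  have "sqsum (\<lambda>k. w k * T g u z k) \<le> 4 * S ^ 3 * (c' * (sqsum u * sqsum z)
    + b * (Wu * sqsum z) + b * (sqsum u * Y))"
    by (rule tame3_sq[OF assms(1-3)])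
  also have "\<dots> \<le> 4 * S ^ 3 * (b * Y * L + b * Y * L + b * Y * L)"
    by (rule mult_left_mono[OF add_mono[OF add_mono[OF c1 c3] c2]]) simp
  finally show ?B unfolding ennreal_three by (simp add: power2_eq_square mult_ac)
qed

lemma conv_weight: "w k * conv f g k \<le> conv (\<lambda>j. w j * f j) g k + conv f (\<lambda>j. w j * g j) k"
proof -
  have w2: "w k \<le> w x + w (k - x)" for x using weight_sub[of x "k - x"] by simp
  have "w k * conv f g k \<le> (\<Sum>\<^sup>+x. (w x + w (k - x)) * (f x * g (k - x)))"
    unfolding conv_def csum_cmult[symmetric] by (intro csum_mono mult_right_mono w2) auto
  also have "\<dots> = conv (\<lambda>j. w j * f j) g k + conv f (\<lambda>j. w j * g j) k"
    by (simp add: conv_def distrib_right distrib_left csum_add mult_ac)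
  finally show ?thesis .
qed

lemma conv_sq: "(conv f g k)\<^sup>2 \<le> sqsum f * sqsum g"
  unfolding conv_def by (rule convolution_Cauchy_Schwarz)

lemma conv_weight_sq:
  "(w k * conv f g k)\<^sup>2 \<le> 2 * (sqsum (\<lambda>j. w j * f j) * sqsum g + sqsum f * sqsum (\<lambda>j. w j * g j))"
proof -
  have "(w k * conv f g k)\<^sup>2 \<le> (conv (\<lambda>j. w j * f j) g k + conv f (\<lambda>j. w j * g j) k)\<^sup>2"
    by (intro power_mono conv_weight) auto
  also have "\<dots> \<le> 2 * ((conv (\<lambda>j. w j * f j) g k)\<^sup>2 + (conv f (\<lambda>j. w j * g j) k)\<^sup>2)"
    by (rule ennreal_sum2_sq)
  also have "\<dots> \<le> 2 * (sqsum (\<lambda>j. w j * f j) * sqsum g + sqsum f * sqsum (\<lambda>j. w j * g j))"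
    by (intro mult_left_mono add_mono conv_sq) auto
  finally show ?thesis .
qed

lemma Zc_sq: "(Zc k)\<^sup>2 \<le> (16 * L) * sqsum z"
proof -
  have "(Zc k)\<^sup>2 \<le> 2 * ((conv z u k)\<^sup>2 + (conv u z k)\<^sup>2)"
    unfolding Zc_def by (rule ennreal_sum2_sq)
  also have "\<dots> \<le> 2 * (sqsum z * sqsum u + sqsum u * sqsum z)"
    by (intro mult_left_mono add_mono conv_sq) auto
  also have "\<dots> \<le> 2 * (sqsum z * L + L * sqsum z)"
    by (intro mult_left_mono add_mono mult_mono sq_u) auto
  also have "\<dots> = 4 * (L * sqsum z)" by (simp add: mult_ac flip: mult_2)
  \<comment> \<open>Weakened from 4 to 16 so that the unweighted and the weighted bound share the
    constant \<open>a\<close> of \<open>tame3_z\<close>.\<close>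
  also have "\<dots> \<le> 16 * (L * sqsum z)" by (intro mult_right_mono) auto
  finally show ?thesis by (simp add: mult_ac)
qed

lemma zu_weight: "Y * sqsum u + sqsum z * Wu \<le> 2 * (L * Y)"
proof -
  have "Y * sqsum u + sqsum z * Wu \<le> Y * L + L * Y"
    by (intro add_mono mult_left_mono sq_u cross) auto
  then show ?thesis by (simp add: mult_ac flip: mult_2)
qed

lemma Zc_weight_sq: "(w k * Zc k)\<^sup>2 \<le> (16 * L) * Y"
proof -
  have comm: "Wu * sqsum z + sqsum u * Y = Y * sqsum u + sqsum z * Wu"
    by (simp only: add.commute mult.commute)
  have double: "2 * (2 * P + 2 * P) = 8 * P" for P :: ennreal
  proof -
    have "2 * (2 * P + 2 * P) = (2 * (2 + 2)) * P" by (simp only: distrib_left distrib_right mult.assoc)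
    then show ?thesis by simp
  qed
  have "(w k * Zc k)\<^sup>2 \<le> 2 * ((w k * conv z u k)\<^sup>2 + (w k * conv u z k)\<^sup>2)"
    using ennreal_sum2_sq[of "w k * conv z u k" "w k * conv u z k"] by (simp only: Zc_def distrib_left)
  also have "\<dots> \<le> 2 * (2 * (Y * sqsum u + sqsum z * Wu) + 2 * (Wu * sqsum z + sqsum u * Y))"
    by (intro mult_left_mono add_mono conv_weight_sq) auto
  also have "\<dots> = 8 * (Y * sqsum u + sqsum z * Wu)"
    unfolding comm double ..
  also have "\<dots> \<le> 8 * (2 * (L * Y))"
    by (intro mult_left_mono zu_weight) auto
  finally show ?thesis by (simp add: mult_ac)
qed

lemma Uc_sq: "(Uc k)\<^sup>2 \<le> 4 * L\<^sup>2"
proof -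
  have "(Uc k)\<^sup>2 \<le> sqsum u * sqsum u" unfolding Uc_def by (rule conv_sq)
  also have "\<dots> \<le> L * L" by (intro mult_mono sq_u) auto
  \<comment> \<open>The factor 4 matches the weighted bound, as the last hypothesis of
    \<open>tame3_u\<close> compares the two.\<close>
  also have "\<dots> \<le> 4 * (L * L)" using mult_right_mono[of 1 4 "L * L"] by simp
  finally show ?thesis by (simp add: power2_eq_square)
qed

lemma Uc_weight_sq: "(w k * Uc k)\<^sup>2 \<le> 4 * L * Wu"
proof -
  have "(w k * Uc k)\<^sup>2 \<le> 2 * (Wu * sqsum u + sqsum u * Wu)"
    unfolding Uc_def by (rule conv_weight_sq)
  also have "\<dots> \<le> 2 * (Wu * L + L * Wu)"
    by (intro mult_left_mono add_mono mult_mono sq_u) auto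
  finally show ?thesis by (simp add: mult_ac flip: mult_2)
qed

lemma Wu_z: "4 * L * Wu * sqsum z \<le> 4 * L\<^sup>2 * Y"
  using mult_left_mono[OF cross, of "4 * L"] by (simp add: power2_eq_square mult_ac)

text \<open>The convolution is placed in the bounded slot, where its sup norm is enough. The
  constant is 4 times the sum of 12 * 16, 12 * 4 and 12 * 4.\<close>

lemma quartic_sq:
  assumes "tame3 T"
  shows "sqsum (\<lambda>k. w k * quartic T k) \<le> 1152 * S ^ 3 * L ^ 3 * Y"
proof -
  have "sqsum (\<lambda>k. w k * quartic T k)
    \<le> 4 * (sqsum (\<lambda>k. w k * T Zc u u k) + sqsum (\<lambda>k. w k * T Uc z u k) + sqsum (\<lambda>k. w k * T Uc u z k))"
    using sqsum_add3[of "\<lambda>k. w k * T Zc u u k" "\<lambda>k. w k * T Uc z u k" "\<lambda>k. w k * T Uc u z k"]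
    by (simp only: quartic_def distrib_left)
  also have "\<dots> \<le> 4 * (12 * S ^ 3 * (16 * L * L\<^sup>2) * Y + 12 * S ^ 3 * (4 * L\<^sup>2 * L) * Y + 12 * S ^ 3 * (4 * L\<^sup>2 * L) * Y)"
    by (intro mult_left_mono add_mono tame3_z tame3_u[OF assms Uc_sq Uc_weight_sq Wu_z] assms Zc_sq Zc_weight_sq) auto
  also have "\<dots> = 4 * (192 * (S ^ 3 * L ^ 3 * Y) + 48 * (S ^ 3 * L ^ 3 * Y) + 48 * (S ^ 3 * L ^ 3 * Y))"
    by (simp add: power2_eq_square power3_eq_cube mult_ac)
  also have "\<dots> = 1152 * (S ^ 3 * L ^ 3 * Y)"
    unfolding distrib_right[symmetric] by (simp add: mult.assoc[symmetric])
  finally show ?thesis by (simp add: mult_ac)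
qed

text \<open>Every value of a sequence is bounded by its l2 norm, so a plain factor z or u may take
  the bounded slot.\<close>

lemma cubic_sq:
  assumes "tame3 T"
  shows "sqsum (\<lambda>k. w k * cubic T k) \<le> 144 * S ^ 3 * L\<^sup>2 * Y"
proof -
  have cz: "(z j)\<^sup>2 \<le> 1 * sqsum z" "(w j * z j)\<^sup>2 \<le> 1 * Y" for j
    using sqsum_upper[of z j] sqsum_upper[of "\<lambda>k. w k * z k" j] by simp_all
  have cu: "(u j)\<^sup>2 \<le> L" "(w j * u j)\<^sup>2 \<le> Wu" for j
    using order_trans[OF sqsum_upper[of u j] sq_u] sqsum_upper[of "\<lambda>k. w k * u k" j] by simp_all
  have cr: "Wu * sqsum z \<le> L * Y" using cross by (simp add: mult_ac)
  have "sqsum (\<lambda>k. w k * cubic T k)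
    \<le> 4 * (sqsum (\<lambda>k. w k * T z u u k) + sqsum (\<lambda>k. w k * T u z u k) + sqsum (\<lambda>k. w k * T u u z k))"
    using sqsum_add3[of "\<lambda>k. w k * T z u u k" "\<lambda>k. w k * T u z u k" "\<lambda>k. w k * T u u z k"]
    by (simp only: cubic_def distrib_left)
  also have "\<dots> \<le> 4 * (12 * S ^ 3 * (1 * L\<^sup>2) * Y + 12 * S ^ 3 * (L * L) * Y + 12 * S ^ 3 * (L * L) * Y)"
    by (intro mult_left_mono add_mono tame3_z[OF assms cz] tame3_u[OF assms cu cr]) auto
  also have "\<dots> = 4 * (12 * (S ^ 3 * L\<^sup>2 * Y) + 12 * (S ^ 3 * L\<^sup>2 * Y) + 12 * (S ^ 3 * L\<^sup>2 * Y))"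
    by (simp add: power2_eq_square mult_ac)
  also have "\<dots> = 144 * (S ^ 3 * L\<^sup>2 * Y)"
    unfolding distrib_right[symmetric] by (simp add: mult.assoc[symmetric])
  finally show ?thesis by (simp add: mult_ac)
qed

end

text \<open>Since x + (k - x) = k, the product of two reciprocals is traded for 1/|k| and one of
  them. Three reciprocals remain next to the gain 1/|k|, as many as the trilinear bound
  consumes.\<close>

lemma ker4_le_recip:
  assumes "k \<noteq> 0"
  shows "ker4 k x y \<le> recip k * (ker_ABC k x y + ker_AC k x y)"
proof -
  have "ker4 k x y = recip x * recip (k - x) * (recip (x + y) * recip (k - y))"
    by (simp add: ker4_def mult_ac)
  also have "\<dots> \<le> recip k * (recip x + recip (k - x)) * (recip (x + y) * recip (k - y))"
    using assms by (intro mult_right_mono recip_mult_split) auto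
  also have "\<dots> = recip k * (ker_ABC k x y + ker_AC k x y)"
    by (simp add: ker_ABC_def ker_AC_def distrib_left distrib_right mult_ac add_ac)
  finally show ?thesis .
qed

text \<open>This lemma and the next two spend one of the four reciprocals on the derivative of the
  differentiated mode: k1 cancels 1/k1 directly, k2 is (k1 + k2) - k1, and k3 is (k3 + k1) -
  k1.\<close>

lemma ker4_mult1: "ennreal \<bar>real_of_int x\<bar> * ker4 k x y \<le> ker_ABC k x y"
proof -
  have "ennreal \<bar>real_of_int x\<bar> * ker4 k x y = ennreal \<bar>real_of_int x\<bar> * recip x * ker_ABC k x y"
    by (simp add: ker4_def ker_ABC_def mult_ac)
  also have "\<dots> \<le> 1 * ker_ABC k x y"
    by (intro mult_right_mono) (auto simp: abs_mult_recip)
  finally show ?thesis by simp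
qed

lemma ker4_mult2: "ennreal \<bar>real_of_int y\<bar> * ker4 k x y \<le> ker_ABC k x y + ker_BC k x y"
proof -
  have "ennreal \<bar>real_of_int y\<bar> * ker4 k x y
    = ennreal \<bar>real_of_int y\<bar> * (recip (x + y) * recip x) * (recip (k - x) * recip (k - y))"
    by (simp add: ker4_def mult_ac)
  also have "\<dots> \<le> (recip (x + y) + recip x) * (recip (k - x) * recip (k - y))"
    by (intro mult_right_mono abs_recip_mult_split) auto
  finally show ?thesis
    by (simp add: ker_ABC_def ker_BC_def distrib_left distrib_right mult_ac)
qed

lemma ker4_mult3: "ennreal \<bar>real_of_int (k - x - y)\<bar> * ker4 k x y \<le> ker_ABC k x y + ker_AB k x y"
proof -
  have "ennreal \<bar>real_of_int (k - x - y)\<bar> * ker4 k x y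
    = ennreal \<bar>real_of_int (k - x - y)\<bar> * (recip (k - y) * recip x) * (recip (x + y) * recip (k - x))"
    by (simp add: ker4_def mult_ac)
  also have "\<dots> \<le> (recip (k - y) + recip x) * (recip (x + y) * recip (k - x))"
    by (intro mult_right_mono abs_recip_mult_split) auto
  finally show ?thesis
    by (simp add: ker_ABC_def ker_AB_def distrib_left distrib_right mult_ac)
qed

section \<open>Bounds for the quartic, resonant and boundary terms\<close>

context tame_pair
begin

lemma d3_cubic: "cubic (tri m) k = (\<Sum>\<^sup>+x. \<Sum>\<^sup>+y. m k x y * d3 k x y)"
  by (simp add: cubic_def tri_def d3_def distrib_left csum_add)

lemma d4a_quartic: "quartic (tri m) k = (\<Sum>\<^sup>+x. \<Sum>\<^sup>+y. m k x y * d4a k x y)"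
  by (simp add: quartic_def tri_def d4a_def distrib_left csum_add)
lemma d4b_quartic: "quartic (\<lambda>g f h. tri m f g h) k = (\<Sum>\<^sup>+x. \<Sum>\<^sup>+y. m k x y * d4b k x y)"
  by (simp add: quartic_def tri_def d4b_def distrib_left csum_add)
lemma d4c_quartic: "quartic (\<lambda>g f h. tri m f h g) k = (\<Sum>\<^sup>+x. \<Sum>\<^sup>+y. m k x y * d4c k x y)"
  by (simp add: quartic_def tri_def d4c_def distrib_left csum_add)

lemma quartic_le: "(\<Sum>\<^sup>+x. \<Sum>\<^sup>+y. ker4 k x y * d4 k x y) \<le>
    quartic (tri ker_ABC) k
    + (quartic (\<lambda>g f h. tri ker_ABC f g h) k + quartic (\<lambda>g f h. tri ker_BC f g h) k)
    + (quartic (\<lambda>g f h. tri ker_ABC f h g) k + quartic (\<lambda>g f h. tri ker_AB f h g) k)"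
proof -
  have "ker4 k x y * d4 k x y \<le> ker_ABC k x y * d4a k x y
      + (ker_ABC k x y * d4b k x y + ker_BC k x y * d4b k x y)
      + (ker_ABC k x y * d4c k x y + ker_AB k x y * d4c k x y)" for x y
  proof -
    have "ker4 k x y * d4 k x y = (ennreal \<bar>real_of_int x\<bar> * ker4 k x y) * d4a k x y
      + (ennreal \<bar>real_of_int y\<bar> * ker4 k x y) * d4b k x y
      + (ennreal \<bar>real_of_int (k - x - y)\<bar> * ker4 k x y) * d4c k x y"
      by (simp add: d4_def distrib_left mult_ac)
    also have "\<dots> \<le> ker_ABC k x y * d4a k x y + (ker_ABC k x y + ker_BC k x y) * d4b k x y
      + (ker_ABC k x y + ker_AB k x y) * d4c k x y"
      by (intro add_mono mult_right_mono ker4_mult1 ker4_mult2 ker4_mult3) auto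
    finally show ?thesis by (simp add: distrib_right)
  qed
  then have "(\<Sum>\<^sup>+x. \<Sum>\<^sup>+y. ker4 k x y * d4 k x y) \<le> (\<Sum>\<^sup>+x. \<Sum>\<^sup>+y. ker_ABC k x y * d4a k x y
      + (ker_ABC k x y * d4b k x y + ker_BC k x y * d4b k x y)
      + (ker_ABC k x y * d4c k x y + ker_AB k x y * d4c k x y))"
    by (intro csum_mono)
  then show ?thesis
    by (simp add: csum_add d4a_quartic d4b_quartic d4c_quartic)
qed

text \<open>On y = -x the frequencies k1 and k2 cancel, on y = k the frequencies k1 and k3 do.
  Summing over x therefore produces a convolution at frequency 0 times a single mode at frequency k,
  and bounding \<open>recip x\<close> by 1 loses nothing of importance.\<close>

lemma res_le: "res k \<le> 2 * (Zc 0 * u k + Uc 0 * z k)"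
proof -
  have "res k \<le> (\<Sum>\<^sup>+x. \<Sum>\<^sup>+y. (if y = - x then d3 k x y else 0) + (if y = k then d3 k x y else 0))"
    unfolding res_def
  proof (intro csum_mono)
    fix x y :: int
    have "recip x * (if x + y = 0 \<or> k = y then d3 k x y else 0) \<le> 1 * (if x + y = 0 \<or> k = y then d3 k x y else 0)"
      by (intro mult_right_mono recip_le_1) auto
    also have "\<dots> \<le> (if y = - x then d3 k x y else 0) + (if y = k then d3 k x y else 0)"
      by auto
    finally show "recip x * (if x + y = 0 \<or> k = y then d3 k x y else 0) \<le>
      (if y = - x then d3 k x y else 0) + (if y = k then d3 k x y else 0)" .
  qed
  also have "\<dots> = (\<Sum>\<^sup>+x. d3 k x (- x)) + (\<Sum>\<^sup>+x. d3 k x k)"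
  proof -
    have "(\<Sum>\<^sup>+y. if y = a then d3 k x y else 0) = d3 k x a" for x a
      by (subst csum_single_int[of a]) auto
    then show ?thesis by (simp add: csum_add)
  qed
  also have "\<dots> = 2 * (Zc 0 * u k + Uc 0 * z k)"
  proof -
    have "(\<Sum>\<^sup>+x. d3 k x (- x)) = Zc 0 * u k + Uc 0 * z k"
      by (simp add: d3_def csum_add nn_integral_multc Zc_def Uc_def conv_def distrib_right)
    moreover have "(\<Sum>\<^sup>+x. d3 k x k) = Zc 0 * u k + Uc 0 * z k"
    proof -
      have "d3 k x k = z x * u (- x) * u k + u x * z (- x) * u k + u x * u (- x) * z k" for x
        by (simp add: d3_def mult_ac add_ac)
      then show ?thesis
        by (simp add: csum_add nn_integral_multc Zc_def Uc_def conv_def distrib_right)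
    qed
    ultimately show ?thesis by (simp only: mult_2)
  qed
  finally show ?thesis .
qed

lemma res_sq: "sqsum (\<lambda>k. w k * res k) \<le> 160 * L\<^sup>2 * Y"
proof -
  have "sqsum (\<lambda>k. w k * res k) \<le> sqsum (\<lambda>k. 2 * (Zc 0 * (w k * u k) + Uc 0 * (w k * z k)))"
  proof (intro sqsum_mono)
    fix k
    have "w k * res k \<le> w k * (2 * (Zc 0 * u k + Uc 0 * z k))"
      by (intro mult_left_mono res_le) auto
    then show "w k * res k \<le> 2 * (Zc 0 * (w k * u k) + Uc 0 * (w k * z k))"
      by (simp add: distrib_left mult_ac)
  qed
  also have "\<dots> = 4 * sqsum (\<lambda>k. Zc 0 * (w k * u k) + Uc 0 * (w k * z k))"
    by (subst sqsum_cmult) (simp add: power2_eq_square)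
  also have "\<dots> \<le> 4 * (2 * (sqsum (\<lambda>k. Zc 0 * (w k * u k)) + sqsum (\<lambda>k. Uc 0 * (w k * z k))))"
    by (intro mult_left_mono sqsum_add2) auto
  also have "\<dots> = 4 * (2 * ((Zc 0)\<^sup>2 * Wu + (Uc 0)\<^sup>2 * Y))"
    by (simp only: sqsum_cmult)
  also have "\<dots> \<le> 4 * (2 * (16 * L\<^sup>2 * Y + 4 * L\<^sup>2 * Y))"
  proof -
    have "(Zc 0)\<^sup>2 * Wu \<le> 16 * L * sqsum z * Wu" by (intro mult_right_mono Zc_sq) auto
    also have "\<dots> = 16 * L * (sqsum z * Wu)" by (simp only: mult.assoc)
    also have "\<dots> \<le> 16 * L * (L * Y)" by (intro mult_left_mono cross) auto
    finally have "(Zc 0)\<^sup>2 * Wu \<le> 16 * L\<^sup>2 * Y" by (simp add: power2_eq_square mult.assoc)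
    then show ?thesis
      by (intro mult_left_mono add_mono mult_right_mono Uc_sq) auto
  qed
  also have "\<dots> = 160 * L\<^sup>2 * Y"
    by (simp only: distrib_right[symmetric] mult.assoc[symmetric]) simp
  finally show ?thesis .
qed

definition "G = 1152 * S ^ 3 * L ^ 3"

text \<open>The resonant term and the five quartic ones are added up as two triples, whence the
  factor 8 = 2 * 4.\<close>

lemma rem_sq: "sqsum (\<lambda>k. w k * rem k) \<le> 8 * (160 * L\<^sup>2 + 5 * G) * Y"
proof -
  define q1 where "q1 k = w k * quartic (tri ker_ABC) k" for k
  define q2 where "q2 k = w k * quartic (\<lambda>g f h. tri ker_ABC f g h) k" for k
  define q3 where "q3 k = w k * quartic (\<lambda>g f h. tri ker_BC f g h) k" for k
  define q4 where "q4 k = w k * quartic (\<lambda>g f h. tri ker_ABC f h g) k" for k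
  define q5 where "q5 k = w k * quartic (\<lambda>g f h. tri ker_AB f h g) k" for k
  have q: "sqsum q1 \<le> G * Y" "sqsum q2 \<le> G * Y" "sqsum q3 \<le> G * Y" "sqsum q4 \<le> G * Y" "sqsum q5 \<le> G * Y"
    unfolding q1_def q2_def q3_def q4_def q5_def G_def
    by (intro quartic_sq tame3_ABC1 tame3_ABC2 tame3_ABC3 tame3_BC2 tame3_AB3)+
  have "sqsum (\<lambda>k. w k * rem k) \<le> sqsum (\<lambda>k. (w k * res k + q1 k + q2 k) + (q3 k + q4 k + q5 k))"
  proof (intro sqsum_mono)
    fix k
    have "w k * rem k \<le> w k * (res k + (quartic (tri ker_ABC) k
      + (quartic (\<lambda>g f h. tri ker_ABC f g h) k + quartic (\<lambda>g f h. tri ker_BC f g h) k)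
      + (quartic (\<lambda>g f h. tri ker_ABC f h g) k + quartic (\<lambda>g f h. tri ker_AB f h g) k)))"
      unfolding rem_def by (intro mult_left_mono add_left_mono quartic_le) auto
    then show "w k * rem k \<le> (w k * res k + q1 k + q2 k) + (q3 k + q4 k + q5 k)"
      by (simp add: q1_def q2_def q3_def q4_def q5_def distrib_left add_ac)
  qed
  also have "\<dots> \<le> 2 * (sqsum (\<lambda>k. w k * res k + q1 k + q2 k) + sqsum (\<lambda>k. q3 k + q4 k + q5 k))"
    by (rule sqsum_add2)
  also have "\<dots> \<le> 2 * (4 * (sqsum (\<lambda>k. w k * res k) + sqsum q1 + sqsum q2) + 4 * (sqsum q3 + sqsum q4 + sqsum q5))"
    by (intro mult_left_mono add_mono sqsum_add3) auto
  also have "\<dots> \<le> 2 * (4 * (160 * L\<^sup>2 * Y + G * Y + G * Y) + 4 * (G * Y + G * Y + G * Y))"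
    by (intro mult_left_mono add_mono q res_sq) auto
  also have "\<dots> = 8 * (160 * L\<^sup>2 + 5 * G) * Y"
  proof -
    have eq: "2 * (4 * (a + x + x) + 4 * (x + x + x)) = 8 * (a + 5 * x)" for a x :: ennreal
    proof -
      have "2 * (4 * (a + x + x) + 4 * (x + x + x)) = (2 * 4) * (a + (1 + 1 + 1 + 1 + 1) * x)"
        by (simp only: distrib_left[symmetric] mult.assoc distrib_right mult_1 add.assoc)
      then show ?thesis by simp
    qed
    show ?thesis unfolding eq by (simp add: distrib_right mult.assoc)
  qed
  finally show ?thesis .
qed

text \<open>A majorant of \<open>w k * bnd k\<close> from which the factor 1/|k| has been removed.
  Keeping that factor outside makes the boundary terms small above a cut-off frequency.\<close>

definition bnd' :: "int \<Rightarrow> ennreal"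
  where "bnd' k = w k * (\<Sum>\<^sup>+x. (recip x + recip (k - x)) * d2 k x)
    + w k * cubic (tri ker_ABC) k + w k * cubic (tri ker_AC) k"

lemma bnd_le:
  assumes "k \<noteq> 0"
  shows "w k * bnd k \<le> recip k * bnd' k"
proof -
  have "bnd k \<le> (\<Sum>\<^sup>+x. recip k * ((recip x + recip (k - x)) * d2 k x))
    + (\<Sum>\<^sup>+x. \<Sum>\<^sup>+y. recip k * (ker_ABC k x y + ker_AC k x y) * d3 k x y)"
    unfolding bnd_def mult.assoc[of "recip k", symmetric] using assms
    by (intro add_mono csum_mono mult_right_mono ker4_le_recip recip_mult_split) auto
  also have "\<dots> = recip k * ((\<Sum>\<^sup>+x. (recip x + recip (k - x)) * d2 k x)
    + cubic (tri ker_ABC) k + cubic (tri ker_AC) k)"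
    by (simp add: d3_cubic csum_cmult mult.assoc distrib_right csum_add add.assoc distrib_left)
  finally have "w k * bnd k \<le> w k * \<dots>" by (rule mult_left_mono) simp
  then show ?thesis by (simp add: bnd'_def distrib_left mult_ac)
qed

lemma recip_bilinear_weight:
  fixes p :: "int \<Rightarrow> int \<Rightarrow> int"
  assumes "\<And>k. inj (p k)"
  shows "sqsum (\<lambda>k. w k * (\<Sum>\<^sup>+x. recip (p k x) * (f x * h (k - x))))
    \<le> 2 * S * (sqsum (\<lambda>k. w k * f k) * sqsum h + sqsum f * sqsum (\<lambda>k. w k * h k))"
proof -
  have "sqsum (\<lambda>k. w k * (\<Sum>\<^sup>+x. recip (p k x) * (f x * h (k - x))))
    \<le> sqsum (\<lambda>k. (\<Sum>\<^sup>+x. recip (p k x) * ((w x * f x) * h (k - x))) + (\<Sum>\<^sup>+x. recip (p k x) * (f x * (w (k - x) * h (k - x)))))"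
  proof (intro sqsum_mono)
    fix k
    have w2: "w k \<le> w x + w (k - x)" for x using weight_sub[of x "k - x"] by simp
    have "w k * (\<Sum>\<^sup>+x. recip (p k x) * (f x * h (k - x))) \<le> (\<Sum>\<^sup>+x. (w x + w (k - x)) * (recip (p k x) * (f x * h (k - x))))"
      unfolding csum_cmult[symmetric] by (intro csum_mono mult_right_mono w2) auto
    then show "w k * (\<Sum>\<^sup>+x. recip (p k x) * (f x * h (k - x))) \<le>
      (\<Sum>\<^sup>+x. recip (p k x) * ((w x * f x) * h (k - x))) + (\<Sum>\<^sup>+x. recip (p k x) * (f x * (w (k - x) * h (k - x))))"
      by (simp add: distrib_left distrib_right csum_add mult_ac)
  qed
  also have "\<dots> \<le> 2 * (sqsum (\<lambda>k. \<Sum>\<^sup>+x. recip (p k x) * ((w x * f x) * h (k - x)))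
      + sqsum (\<lambda>k. \<Sum>\<^sup>+x. recip (p k x) * (f x * (w (k - x) * h (k - x)))))"
    by (rule sqsum_add2)
  also have "\<dots> \<le> 2 * (S * (sqsum (\<lambda>k. w k * f k) * sqsum h) + S * (sqsum f * sqsum (\<lambda>k. w k * h k)))"
    by (intro mult_left_mono add_mono recip_bilinear assms
        recip_bilinear[where f=f and h="\<lambda>k. w k * h k"] recip_bilinear[where f="\<lambda>k. w k * f k"]) auto
  finally show ?thesis by (simp add: distrib_left mult.assoc)
qed

lemma bnd'_sq: "sqsum bnd' \<le> 4 * (64 * S * L + 288 * S ^ 3 * L\<^sup>2) * Y"
proof -
  have inj: "inj (\<lambda>x. x)" "inj (\<lambda>x. k - x)" for k :: int by (auto simp: inj_on_def)
  define b where "b p f h k = w k * (\<Sum>\<^sup>+x. recip (p k x) * (f x * h (k - x)))"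
    for p :: "int \<Rightarrow> int \<Rightarrow> int" and f h :: "int \<Rightarrow> ennreal" and k
  have b: "sqsum (b p z u) \<le> 4 * S * L * Y" "sqsum (b p u z) \<le> 4 * S * L * Y" if "\<And>k. inj (p k)" for p
  proof -
    have *: "2 * S * (Y * sqsum u + sqsum z * Wu) \<le> 4 * S * L * Y"
    proof -
      have "2 * S * (Y * sqsum u + sqsum z * Wu) \<le> 2 * S * (2 * (L * Y))"
        by (intro mult_left_mono zu_weight) auto
      then show ?thesis by (simp add: mult_ac)
    qed
    have "sqsum (b p z u) \<le> 2 * S * (Y * sqsum u + sqsum z * Wu)"
      unfolding b_def by (rule recip_bilinear_weight[OF that])
    also note *
    finally show "sqsum (b p z u) \<le> 4 * S * L * Y" .
    have "sqsum (b p u z) \<le> 2 * S * (Wu * sqsum z + sqsum u * Y)"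
      unfolding b_def by (rule recip_bilinear_weight[OF that])
    also have "\<dots> = 2 * S * (Y * sqsum u + sqsum z * Wu)"
      by (simp only: add.commute mult.commute)
    also note *
    finally show "sqsum (b p u z) \<le> 4 * S * L * Y" .
  qed
  define V where "V k = w k * (\<Sum>\<^sup>+x. (recip x + recip (k - x)) * d2 k x)" for k
  have "V = (\<lambda>k. (b (\<lambda>_ x. x) z u k + b (\<lambda>_ x. x) u z k) + (b (\<lambda>k x. k - x) z u k + b (\<lambda>k x. k - x) u z k))"
    by (simp add: fun_eq_iff V_def b_def d2_def distrib_left distrib_right csum_add add_ac)
  then have "sqsum V \<le> 2 * (sqsum (\<lambda>k. b (\<lambda>_ x. x) z u k + b (\<lambda>_ x. x) u z k) + sqsum (\<lambda>k. b (\<lambda>k x. k - x) z u k + b (\<lambda>k x. k - x) u z k))"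
    by (simp only: sqsum_add2)
  also have "\<dots> \<le> 2 * (2 * (sqsum (b (\<lambda>_ x. x) z u) + sqsum (b (\<lambda>_ x. x) u z)) + 2 * (sqsum (b (\<lambda>k x. k - x) z u) + sqsum (b (\<lambda>k x. k - x) u z)))"
    by (intro mult_left_mono add_mono sqsum_add2) auto
  also have "\<dots> \<le> 2 * (2 * (4 * S * L * Y + 4 * S * L * Y) + 2 * (4 * S * L * Y + 4 * S * L * Y))"
    by (intro mult_left_mono add_mono b inj) auto
  also have "\<dots> = 64 * S * L * Y"
    by (simp only: distrib_right[symmetric] distrib_left[symmetric] mult.assoc[symmetric]) simp
  finally have V: "sqsum V \<le> 64 * S * L * Y" .
  have "sqsum bnd' \<le> 4 * (sqsum V + sqsum (\<lambda>k. w k * cubic (tri ker_ABC) k) + sqsum (\<lambda>k. w k * cubic (tri ker_AC) k))"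
    unfolding bnd'_def[abs_def] V_def by (rule sqsum_add3)
  also have "\<dots> \<le> 4 * (64 * S * L * Y + 144 * S ^ 3 * L\<^sup>2 * Y + 144 * S ^ 3 * L\<^sup>2 * Y)"
    by (intro mult_left_mono add_mono V cubic_sq tame3_ABC1 tame3_AC1) auto
  also have "\<dots> = 4 * (64 * S * L + 288 * S ^ 3 * L\<^sup>2) * Y"
    by (simp only: distrib_right[symmetric] mult.assoc[symmetric] add.assoc) simp
  finally show ?thesis .
qed

end

section \<open>Integration by parts\<close>

text \<open>A Lipschitz function with a bounded measurable derivative in the integral sense.
  \<open>kdv_rhs\<close> is shown to be measurable and bounded in time but not continuous, so the
  modes cannot be differentiated pointwise. Bounds on the whole line keep every integrability
  question trivial.\<close>

definition primitive :: "real \<Rightarrow> (real \<Rightarrow> complex) \<Rightarrow> (real \<Rightarrow> complex) \<Rightarrow> bool"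
  where "primitive T f f' \<longleftrightarrow> f \<in> borel_measurable borel \<and> f' \<in> borel_measurable borel \<and>
    bounded (range f) \<and> bounded (range f') \<and>
    (\<forall>t\<in>{0..T}. f t = f 0 + (LINT x:{0..t}|lborel. f' x))"

lemma bounded_range_mult:
  fixes f g :: "real \<Rightarrow> complex"
  assumes "bounded (range f)" "bounded (range g)"
  shows "bounded (range (\<lambda>x. f x * g x))"
proof -
  obtain a b where "\<And>x. norm (f x) \<le> a" "\<And>x. norm (g x) \<le> b"
    using assms by (auto simp: bounded_iff)
  then show ?thesis
    unfolding bounded_iff by (intro exI[of _ "a * b"]) (auto simp: norm_mult intro!: mult_mono' )
qed

lemma bounded_range_add:
  fixes f g :: "real \<Rightarrow> complex"
  assumes "bounded (range f)" "bounded (range g)"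
  shows "bounded (range (\<lambda>x. f x + g x))"
  by (rule bounded_plus_comp[OF assms])

lemma bounded_range_diff:
  fixes f g :: "real \<Rightarrow> complex"
  assumes "bounded (range f)" "bounded (range g)"
  shows "bounded (range (\<lambda>x. f x - g x))"
  by (rule bounded_minus_comp[OF assms])

lemma bounded_range_const: "bounded (range (\<lambda>\<tau>::real. a::complex))"
  unfolding bounded_iff by blast

lemma bounded_set_integrable:
  fixes f :: "real \<Rightarrow> complex"
  assumes [measurable]: "f \<in> borel_measurable borel" and "bounded (range f)"
  shows "set_integrable lborel {a..b} f"
proof -
  obtain c where "\<And>x. norm (f x) \<le> c" using assms(2) by (auto simp: bounded_iff)
  then show ?thesis
    unfolding set_integrable_def
    by (intro integrableI_bounded_set_indicator[where B=c]) (auto simp: emeasure_lborel_Icc_eq)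
qed

text \<open>The product rule in integrated form, by Fubini. The product of the integrals of f' and
  g' over [0, t] is a double integral over a square; its two triangles, together with the initial
  values, give the integrals of f g' and f' g.\<close>

lemma primitive_mult:
  assumes "primitive T f f'" "primitive T g g'"
  shows "primitive T (\<lambda>x. f x * g x) (\<lambda>x. f' x * g x + f x * g' x)"
proof -
  have [measurable]: "f \<in> borel_measurable borel" "f' \<in> borel_measurable borel"
      "g \<in> borel_measurable borel" "g' \<in> borel_measurable borel"
    and bdd: "bounded (range f)" "bounded (range f')" "bounded (range g)" "bounded (range g')"
    and f: "\<And>t. t \<in> {0..T} \<Longrightarrow> f t = f 0 + (LINT x:{0..t}|lborel. f' x)"
    and g: "\<And>t. t \<in> {0..T} \<Longrightarrow> g t = g 0 + (LINT x:{0..t}|lborel. g' x)"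
    using assms unfolding primitive_def by blast+
  have "f t * g t = f 0 * g 0 + (LINT x:{0..t}|lborel. f' x * g x + f x * g' x)" if t: "t \<in> {0..T}" for t
  proof -
    \<comment> \<open>Cut off to [0, t], the derivatives are integrable on the line, and f and g on
      [0, t] become integrals over half-lines.\<close>
    define a where "a x = indicator {0..t} x *\<^sub>R f' x" for x
    define b where "b x = indicator {0..t} x *\<^sub>R g' x" for x
    have [measurable]: "a \<in> borel_measurable borel" "b \<in> borel_measurable borel"
      unfolding a_def[abs_def] b_def[abs_def] by measurable
    have int_a: "integrable lborel a" and int_b: "integrable lborel b"
      using bounded_set_integrable[of f' 0 t] bounded_set_integrable[of g' 0 t] bdd
      by (simp_all add: set_integrable_def a_def[abs_def] b_def[abs_def])
    have fa: "f x = f 0 + (LINT y|lborel. indicator {..x} y *\<^sub>R a y)"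
      and gb: "g x = g 0 + (LINT y|lborel. indicator {..x} y *\<^sub>R b y)" if "x \<in> {0..t}" for x
    proof -
      have *: "indicator {..x} y *\<^sub>R indicator {0..t} y *\<^sub>R h y = indicator {0..x} y *\<^sub>R h y"
        for y and h :: "real \<Rightarrow> complex" using that by (auto simp: indicator_def)
      show "f x = f 0 + (LINT y|lborel. indicator {..x} y *\<^sub>R a y)"
        "g x = g 0 + (LINT y|lborel. indicator {..x} y *\<^sub>R b y)"
        unfolding a_def b_def * using f[of x] g[of x] that t unfolding set_lebesgue_integral_def by auto
    qed
    have int_ax: "integrable lborel (\<lambda>y. indicator {..x} y *\<^sub>R a y)"
      and int_bx: "integrable lborel (\<lambda>y. indicator {..x} y *\<^sub>R b y)" for x
      by (intro integrable_mult_indicator int_a int_b; simp)+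
    define h where "h = (\<lambda>(x, y). a x * b y)"
    have int_h: "integrable (lborel \<Otimes>\<^sub>M lborel) h"
    proof (rule lborel_pair.Fubini_integrable)
      show "h \<in> borel_measurable (lborel \<Otimes>\<^sub>M lborel)" unfolding h_def by measurable
      show "integrable lborel (\<lambda>x. LINT y|lborel. norm (h (x, y)))"
        unfolding h_def by (simp add: norm_mult int_a int_b)
      show "AE x in lborel. integrable lborel (\<lambda>y. h (x, y))"
        unfolding h_def by (simp add: int_b)
    qed
    \<comment> \<open>The cut runs along the diagonal: integrating y first over the lower triangle
      recovers g up to its initial value, integrating x first over the upper one recovers f.\<close>
    define h1 where "h1 = (\<lambda>p. indicator {p. snd p \<le> fst p} p *\<^sub>R h p)"
    define h2 where "h2 = (\<lambda>p. indicator {p. fst p < snd p} p *\<^sub>R h p)"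
    have m1: "{p :: real \<times> real. snd p \<le> fst p} \<in> sets (lborel \<Otimes>\<^sub>M lborel)"
      and m2: "{p :: real \<times> real. fst p < snd p} \<in> sets (lborel \<Otimes>\<^sub>M lborel)"
    proof -
      have "{p \<in> space (lborel \<Otimes>\<^sub>M lborel). snd p \<le> fst p} \<in> sets (lborel \<Otimes>\<^sub>M (lborel::real measure))"
        by measurable
      then show "{p :: real \<times> real. snd p \<le> fst p} \<in> sets (lborel \<Otimes>\<^sub>M lborel)" by (simp add: space_pair_measure)
      have "{p \<in> space (lborel \<Otimes>\<^sub>M lborel). fst p < snd p} \<in> sets (lborel \<Otimes>\<^sub>M (lborel::real measure))"
        by measurable
      then show "{p :: real \<times> real. fst p < snd p} \<in> sets (lborel \<Otimes>\<^sub>M lborel)" by (simp add: space_pair_measure)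
    qed
    have int_h1: "integrable (lborel \<Otimes>\<^sub>M lborel) h1" and int_h2: "integrable (lborel \<Otimes>\<^sub>M lborel) h2"
      unfolding h1_def h2_def by (intro integrable_mult_indicator int_h m1 m2)+
    have "(LINT x|lborel. a x) * (LINT y|lborel. b y) = (LINT x|lborel. LINT y|lborel. h (x, y))"
      by (simp add: h_def)
    also have "\<dots> = integral\<^sup>L (lborel \<Otimes>\<^sub>M lborel) h"
      by (rule lborel_pair.integral_fst'[OF int_h])
    also have "h = (\<lambda>p. h1 p + h2 p)"
      by (auto simp: h1_def h2_def fun_eq_iff indicator_def)
    also have "integral\<^sup>L (lborel \<Otimes>\<^sub>M lborel) (\<lambda>p. h1 p + h2 p)
      = integral\<^sup>L (lborel \<Otimes>\<^sub>M lborel) h1 + integral\<^sup>L (lborel \<Otimes>\<^sub>M lborel) h2"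
      by (rule Bochner_Integration.integral_add[OF int_h1 int_h2])
    also have "integral\<^sup>L (lborel \<Otimes>\<^sub>M lborel) h1 = (LINT x|lborel. LINT y|lborel. h1 (x, y))"
      by (rule lborel_pair.integral_fst'[OF int_h1, symmetric])
    also have "\<dots> = (LINT x|lborel. a x * (LINT y|lborel. indicator {..x} y *\<^sub>R b y))"
    proof -
      have "h1 (x, y) = a x * (indicator {..x} y *\<^sub>R b y)" for x y
        by (simp add: h1_def h_def indicator_def)
      then show ?thesis by (simp only: integral_mult_right_zero)
    qed
    also have "integral\<^sup>L (lborel \<Otimes>\<^sub>M lborel) h2 = (LINT y|lborel. LINT x|lborel. h2 (x, y))"
      using lborel_pair.integral_snd[of "\<lambda>x y. h2 (x, y)"] int_h2 by simp
    also have "\<dots> = (LINT y|lborel. (LINT x|lborel. indicator {..y} x *\<^sub>R a x) * b y)"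
    proof -
      have "(LINT x|lborel. h2 (x, y)) = (LINT x|lborel. indicator {..y} x *\<^sub>R a x) * b y" for y
      proof -
        have "(LINT x|lborel. h2 (x, y)) = (LINT x|lborel. (indicator {..<y} x *\<^sub>R a x) * b y)"
          by (intro Bochner_Integration.integral_cong) (auto simp: h2_def h_def indicator_def)
        also have "\<dots> = (LINT x|lborel. indicator {..<y} x *\<^sub>R a x) * b y" by (rule integral_mult_left_zero)
        \<comment> \<open>The strict inequality in \<open>h2\<close> is harmless, a single point
          having measure zero.\<close>
        also have "(LINT x|lborel. indicator {..<y} x *\<^sub>R a x) = (LINT x|lborel. indicator {..y} x *\<^sub>R a x)"
        proof (rule integral_cong_AE)
          show "AE x in lborel. indicator {..<y} x *\<^sub>R a x = indicator {..y} x *\<^sub>R a x"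
            using AE_lborel_singleton[of y] by eventually_elim (auto simp: indicator_def)
        qed auto
        finally show ?thesis .
      qed
      then show ?thesis by simp
    qed
    finally have FG: "(LINT x|lborel. a x) * (LINT y|lborel. b y)
      = (LINT x|lborel. a x * (LINT y|lborel. indicator {..x} y *\<^sub>R b y))
       + (LINT y|lborel. (LINT x|lborel. indicator {..y} x *\<^sub>R a x) * b y)" .
    have ag: "a x * g x = g 0 * a x + a x * (LINT y|lborel. indicator {..x} y *\<^sub>R b y)" for x
    proof (cases "x \<in> {0..t}")
      case True
      show ?thesis by (subst gb[OF True]) (simp only: distrib_left mult.commute)
    qed (simp add: a_def)
    have bf: "f x * b x = f 0 * b x + (LINT y|lborel. indicator {..x} y *\<^sub>R a y) * b x" for x
    proof (cases "x \<in> {0..t}")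
      case True
      show ?thesis by (subst fa[OF True]) (simp only: distrib_right)
    qed (simp add: b_def)
    have int_ag: "integrable lborel (\<lambda>x. a x * g x)" and int_bf: "integrable lborel (\<lambda>x. f x * b x)"
    proof -
      have "set_integrable lborel {0..t} (\<lambda>x. f' x * g x)" "set_integrable lborel {0..t} (\<lambda>x. f x * g' x)"
        by (intro bounded_set_integrable bounded_range_mult bdd; measurable)+
      then show "integrable lborel (\<lambda>x. a x * g x)" "integrable lborel (\<lambda>x. f x * b x)"
        by (simp_all add: set_integrable_def a_def[abs_def] b_def[abs_def])
    qed
    have int1: "integrable lborel (\<lambda>x. a x * (LINT y|lborel. indicator {..x} y *\<^sub>R b y))"
    proof -
      have "(\<lambda>x. a x * (LINT y|lborel. indicator {..x} y *\<^sub>R b y)) = (\<lambda>x. a x * g x - g 0 * a x)"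
        by (simp add: ag fun_eq_iff)
      then show ?thesis using int_ag int_a by simp
    qed
    have int2: "integrable lborel (\<lambda>x. (LINT y|lborel. indicator {..x} y *\<^sub>R a y) * b x)"
    proof -
      have "(\<lambda>x. (LINT y|lborel. indicator {..x} y *\<^sub>R a y) * b x) = (\<lambda>x. f x * b x - f 0 * b x)"
        by (simp add: bf fun_eq_iff)
      then show ?thesis using int_bf int_b by simp
    qed
    have "(LINT x:{0..t}|lborel. f' x * g x + f x * g' x) = (LINT x|lborel. a x * g x + f x * b x)"
      by (simp add: set_lebesgue_integral_def a_def b_def scaleR_add_right)
    also have "\<dots> = (LINT x|lborel. a x * g x) + (LINT x|lborel. f x * b x)"
      by (rule Bochner_Integration.integral_add[OF int_ag int_bf])
    also have "(LINT x|lborel. a x * g x) = g 0 * (LINT x|lborel. a x) + (LINT x|lborel. a x * (LINT y|lborel. indicator {..x} y *\<^sub>R b y))"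
      unfolding ag using int_a int1 by simp
    also have "(LINT x|lborel. f x * b x) = f 0 * (LINT x|lborel. b x) + (LINT x|lborel. (LINT y|lborel. indicator {..x} y *\<^sub>R a y) * b x)"
      unfolding bf using int_b int2 by simp
    finally have "(LINT x:{0..t}|lborel. f' x * g x + f x * g' x) =
      g 0 * (LINT x|lborel. a x) + f 0 * (LINT x|lborel. b x) + (LINT x|lborel. a x) * (LINT y|lborel. b y)"
      unfolding FG by (simp only: add_ac)
    moreover have "f t = f 0 + (LINT x|lborel. a x)" "g t = g 0 + (LINT x|lborel. b x)"
      unfolding a_def b_def
      by (simp_all only: f[OF t, unfolded set_lebesgue_integral_def] g[OF t, unfolded set_lebesgue_integral_def])
    moreover have "(f0 + A) * (g0 + B) = f0 * g0 + (g0 * A + f0 * B + A * B)" for f0 g0 A B :: complex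
      by (simp add: algebra_simps)
    ultimately show ?thesis by (simp only:)
  qed
  note * = this
  have m: "(\<lambda>x. f x * g x) \<in> borel_measurable borel" "(\<lambda>x. f' x * g x + f x * g' x) \<in> borel_measurable borel"
    by measurable
  show ?thesis
    unfolding primitive_def by (intro conjI ballI bounded_range_mult bounded_range_add bdd m *)
qed

lemma primitive_diff:
  assumes "primitive T f f'" "primitive T g g'"
  shows "primitive T (\<lambda>x. f x - g x) (\<lambda>x. f' x - g' x)"
proof -
  have [measurable]: "f \<in> borel_measurable borel" "f' \<in> borel_measurable borel"
      "g \<in> borel_measurable borel" "g' \<in> borel_measurable borel"
    and bdd: "bounded (range f)" "bounded (range f')" "bounded (range g)" "bounded (range g')"
    and f: "\<And>t. t \<in> {0..T} \<Longrightarrow> f t = f 0 + (LINT x:{0..t}|lborel. f' x)"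
    and g: "\<And>t. t \<in> {0..T} \<Longrightarrow> g t = g 0 + (LINT x:{0..t}|lborel. g' x)"
    using assms unfolding primitive_def by blast+
  have "f t - g t = f 0 - g 0 + (LINT x:{0..t}|lborel. f' x - g' x)" if "t \<in> {0..T}" for t
  proof -
    have "(LINT x:{0..t}|lborel. f' x - g' x) = (LINT x:{0..t}|lborel. f' x) - (LINT x:{0..t}|lborel. g' x)"
      by (intro set_integral_diff bounded_set_integrable bdd) measurable
    then show ?thesis
      using f[OF that] g[OF that] by (metis add_diff_add)
  qed
  note * = this
  have m: "(\<lambda>x. f x - g x) \<in> borel_measurable borel" "(\<lambda>x. f' x - g' x) \<in> borel_measurable borel"
    by measurable
  show ?thesis
    unfolding primitive_def by (intro conjI ballI bounded_range_diff bdd m *)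
qed

section \<open>Oscillating phases and the gain of one integration by parts\<close>

definition phase :: "real \<Rightarrow> real \<Rightarrow> complex"
  where "phase \<phi> t = exp (\<i> * of_real (\<phi> * t))"

lemma norm_phase [simp]: "norm (phase \<phi> t) = 1"
  unfolding phase_def by (rule norm_exp_i_times)

lemma phase_at_0 [simp]: "phase \<phi> 0 = 1"
  by (simp add: phase_def)

lemma phase_mult: "phase a t * phase b t = phase (a + b) t"
  by (simp add: phase_def exp_add[symmetric] algebra_simps)

lemma continuous_on_phase [continuous_intros]: "continuous_on A (phase \<phi>)"
  unfolding phase_def[abs_def] by (intro continuous_intros)

lemma phase_measurable [measurable]: "phase \<phi> \<in> borel_measurable borel"
  by (intro borel_measurable_continuous_onI continuous_on_phase)

lemma bounded_phase: "bounded (range (phase \<phi>))"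
  unfolding bounded_iff by (intro exI[of _ 1]) auto

lemma phase_has_vector_derivative:
  "(phase \<phi> has_vector_derivative (\<i> * of_real \<phi>) * phase \<phi> x) (at x within A)"
proof -
  have "((\<lambda>z. exp (\<i> * (of_real \<phi> * z))) has_field_derivative (\<i> * of_real \<phi>) * phase \<phi> x) (at (of_real x))"
    by (auto intro!: derivative_eq_intros simp: phase_def mult_ac)
  from has_vector_derivative_real_field[OF this] show ?thesis
    unfolding phase_def[abs_def] by simp
qed

lemma primitive_phase: "primitive T (phase \<phi>) (\<lambda>t. (\<i> * of_real \<phi>) * phase \<phi> t)"
proof -
  have "phase \<phi> t = phase \<phi> 0 + (LINT x:{0..t}|lborel. (\<i> * of_real \<phi>) * phase \<phi> x)" if "t \<in> {0..T}" for t
  proof -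
    have "(LINT x|lborel. indicator {0..t} x *\<^sub>R ((\<i> * of_real \<phi>) * phase \<phi> x)) = phase \<phi> t - phase \<phi> 0"
    proof (rule integral_FTC_Icc)
      show "continuous_on {0..t} (\<lambda>x. (\<i> * of_real \<phi>) * phase \<phi> x)"
        by (intro continuous_intros)
    qed (use that in \<open>auto intro: phase_has_vector_derivative\<close>)
    then show ?thesis unfolding set_lebesgue_integral_def by simp
  qed
  moreover have "bounded (range (\<lambda>t. (\<i> * of_real \<phi>) * phase \<phi> t))"
    unfolding bounded_iff by (intro exI[of _ "\<bar>\<phi>\<bar>"]) (auto simp: norm_mult)
  moreover have "(\<lambda>t. (\<i> * of_real \<phi>) * phase \<phi> t) \<in> borel_measurable borel" by measurable
  ultimately show ?thesis
    unfolding primitive_def using bounded_phase phase_measurable by blast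
qed

text \<open>The derivative of the phase is i \<phi> times the phase, so the product rule for phase
  times f can be solved for the integral, with the denominator \<phi>.\<close>

lemma oscillatory_integral_bound:
  assumes f: "primitive T f f'" and "\<phi> \<noteq> 0" and t: "t \<in> {0..T}"
  shows "norm (LINT x:{0..t}|lborel. phase \<phi> x * f x) \<le>
    1 / \<bar>\<phi>\<bar> * (norm (f t) + norm (f 0) + norm (LINT x:{0..t}|lborel. phase \<phi> x * f' x))"
proof -
  have [measurable]: "f \<in> borel_measurable borel" "f' \<in> borel_measurable borel"
    and bdd: "bounded (range f)" "bounded (range f')"
    using f unfolding primitive_def by blast+
  let ?I = "LINT x:{0..t}|lborel. phase \<phi> x * f x" and ?J = "LINT x:{0..t}|lborel. phase \<phi> x * f' x"
  have "phase \<phi> t * f t = phase \<phi> 0 * f 0 +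
    (LINT x:{0..t}|lborel. (\<i> * of_real \<phi>) * phase \<phi> x * f x + phase \<phi> x * f' x)"
    using primitive_mult[OF primitive_phase f] t unfolding primitive_def by blast
  also have "(LINT x:{0..t}|lborel. (\<i> * of_real \<phi>) * phase \<phi> x * f x + phase \<phi> x * f' x)
    = (LINT x:{0..t}|lborel. (\<i> * of_real \<phi>) * phase \<phi> x * f x) + ?J"
  proof (rule set_integral_add)
    show "set_integrable lborel {0..t} (\<lambda>x. phase \<phi> x * f' x)"
      by (intro bounded_set_integrable bounded_range_mult bounded_phase bdd) measurable
    have "set_integrable lborel {0..t} (\<lambda>x. phase \<phi> x * f x)"
      by (intro bounded_set_integrable bounded_range_mult bounded_phase bdd) measurable
    then show "set_integrable lborel {0..t} (\<lambda>x. (\<i> * of_real \<phi>) * phase \<phi> x * f x)"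
      unfolding mult.assoc[of "\<i> * of_real \<phi>"] by (rule set_integrable_mult_right)
  qed
  also have "(LINT x:{0..t}|lborel. (\<i> * of_real \<phi>) * phase \<phi> x * f x) = (\<i> * of_real \<phi>) * ?I"
    unfolding mult.assoc[of "\<i> * of_real \<phi>"] by (rule set_integral_mult_right)
  finally have "(\<i> * of_real \<phi>) * ?I = phase \<phi> t * f t - f 0 - ?J" by (simp add: algebra_simps)
  then have "norm ((\<i> * of_real \<phi>) * ?I) = norm (phase \<phi> t * f t - f 0 - ?J)" by simp
  then have "\<bar>\<phi>\<bar> * norm ?I = norm (phase \<phi> t * f t - f 0 - ?J)"
    by (simp add: norm_mult)
  also have "\<dots> \<le> norm (phase \<phi> t * f t) + norm (f 0) + norm ?J"
    by (meson norm_triangle_ineq4 order_trans add_right_mono)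
  finally show ?thesis using \<open>\<phi> \<noteq> 0\<close> by (simp add: norm_mult field_simps)
qed

section \<open>The normal form of a pair of solutions\<close>

abbreviation enorm :: "complex \<Rightarrow> ennreal" where "enorm c \<equiv> ennreal (cmod c)"

abbreviation time_integral :: "real \<Rightarrow> (real \<Rightarrow> ennreal) \<Rightarrow> ennreal"
  where "time_integral t F \<equiv> (\<integral>\<^sup>+\<tau>. F \<tau> * indicator {0..t} \<tau> \<partial>lborel)"

lemma enorm_mult: "enorm (a * b) = enorm a * enorm b"
  by (simp add: norm_mult ennreal_mult)

lemma enorm_add: "enorm (a + b) \<le> enorm a + enorm b"
  using ennreal_leI[OF norm_triangle_ineq[of a b]] by simp

lemma enorm_diff_le: "enorm a \<le> enorm b + enorm (a - b)"
  using enorm_add[of b "a - b"] by simp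

lemma enorm_diff2:
  assumes "enorm (a - a') \<le> za" "enorm (b - b') \<le> zb" "enorm b \<le> ub" "enorm a' \<le> ua"
  shows "enorm (a * b - a' * b') \<le> za * ub + ua * zb"
proof -
  have "enorm (a * b - a' * b') = enorm ((a - a') * b + a' * (b - b'))"
    by (simp add: algebra_simps)
  also have "\<dots> \<le> enorm ((a - a') * b) + enorm (a' * (b - b'))" by (rule enorm_add)
  also have "\<dots> \<le> za * ub + ua * zb"
    unfolding enorm_mult by (intro add_mono mult_mono assms) auto
  finally show ?thesis .
qed

lemma enorm_diff3:
  assumes "enorm (a - a') \<le> za" "enorm (b - b') \<le> zb" "enorm (c - c') \<le> zc"
    and "enorm b \<le> ub" "enorm c \<le> uc" "enorm a' \<le> ua" "enorm b' \<le> ub"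
  shows "enorm (a * b * c - a' * b' * c') \<le> za * ub * uc + ua * zb * uc + ua * ub * zc"
proof -
  have "enorm (a * b * c - a' * b' * c') \<le> (za * ub + ua * zb) * uc + (ua * ub) * zc"
  proof (rule enorm_diff2)
    show "enorm (a * b - a' * b') \<le> za * ub + ua * zb"
      by (intro enorm_diff2 assms)
    show "enorm (a' * b') \<le> ua * ub"
      unfolding enorm_mult by (intro mult_mono assms) auto
  qed (intro assms)+
  then show ?thesis by (simp add: distrib_right)
qed

lemma csum_finite_le: "finite F \<Longrightarrow> sum f F \<le> csum f"
proof -
  assume "finite F"
  then have "sum f F = (\<Sum>\<^sup>+x. f x * indicator F x)"
    by (subst nn_integral_indicator_finite) (auto simp: one_ennreal_def[symmetric])
  also have "\<dots> \<le> csum f" by (intro csum_mono) (auto simp: indicator_def)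
  finally show ?thesis .
qed

lemma csum_measurable [measurable (raw)]:
  fixes f :: "'a \<Rightarrow> int \<Rightarrow> ennreal"
  assumes [measurable]: "\<And>x. (\<lambda>\<tau>. f \<tau> x) \<in> borel_measurable N"
  shows "(\<lambda>\<tau>. \<Sum>\<^sup>+x. f \<tau> x) \<in> borel_measurable N"
proof -
  have "(\<Sum>\<^sup>+x. f \<tau> x) = (\<Sum>n. f \<tau> (int_decode n))" for \<tau>
    by (subst csum_bij[OF bij_int_decode, symmetric]) (simp add: nn_integral_count_space_nat)
  then show ?thesis by simp
qed

lemma time_integral_csum:
  fixes f :: "int \<Rightarrow> real \<Rightarrow> ennreal"
  assumes [measurable]: "\<And>x. f x \<in> borel_measurable borel"
  shows "(\<Sum>\<^sup>+x. time_integral t (f x)) = time_integral t (\<lambda>\<tau>. \<Sum>\<^sup>+x. f x \<tau>)"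
  by (subst nn_integral_count_space_nn_integral[symmetric]) (auto simp: nn_integral_multc)

text \<open>Turns an unconditional sum into a limit along a sequence, the form in which
  measurability of limits and dominated convergence apply.\<close>

lemma symmetric_intervals_cofinal:
  "filterlim (\<lambda>N. {- int N..int N}) (finite_subsets_at_top UNIV) sequentially"
  unfolding filterlim_finite_subsets_at_top
proof (intro allI impI)
  fix X :: "int set" assume X: "finite X \<and> X \<subseteq> UNIV"
  define m where "m = nat (Max (insert 0 (abs ` X)))"
  have "X \<subseteq> {- int N..int N}" if "N \<ge> m" for N
  proof
    fix x assume "x \<in> X"
    then have "\<bar>x\<bar> \<le> Max (insert 0 (abs ` X))" using X by (intro Max_ge) auto
    also have "\<dots> \<le> int N" using that by (simp add: m_def)
    finally show "x \<in> {- int N..int N}" by auto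
  qed
  then show "\<forall>\<^sub>F N in sequentially. finite {- int N..int N} \<and> X \<subseteq> {- int N..int N} \<and> {- int N..int N} \<subseteq> UNIV"
    by (auto simp: eventually_sequentially)
qed

lemma enorm_limit_le_csum:
  fixes c :: "int \<Rightarrow> complex"
  assumes "(\<lambda>N. \<Sum>x\<in>{- int N..int N}. c x) \<longlonglongrightarrow> l"
  shows "enorm l \<le> (\<Sum>\<^sup>+x. enorm (c x))"
proof (rule Lim_bounded)
  show "(\<lambda>N. enorm (\<Sum>x\<in>{- int N..int N}. c x)) \<longlonglongrightarrow> enorm l"
    by (intro tendsto_ennrealI tendsto_norm assms)
  have "enorm (\<Sum>x\<in>{- int N..int N}. c x) \<le> (\<Sum>x\<in>{- int N..int N}. enorm (c x))" for N
    by (subst sum_ennreal) (auto intro!: ennreal_leI norm_sum)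
  then show "\<forall>N\<ge>0. enorm (\<Sum>x\<in>{- int N..int N}. c x) \<le> (\<Sum>\<^sup>+x. enorm (c x))"
    by (meson csum_finite_le finite_atLeastAtMost_int order_trans)
qed

lemma enorm_set_integral_le:
  assumes "f \<in> borel_measurable borel" "bounded (range f)" "\<And>\<tau>. enorm (f \<tau>) \<le> F \<tau>"
  shows "enorm (LINT \<tau>:{0..t}|lborel. f \<tau>) \<le> time_integral t F"
proof -
  have "enorm (LINT \<tau>:{0..t}|lborel. f \<tau>) \<le> (\<integral>\<^sup>+\<tau>. enorm (indicator {0..t} \<tau> *\<^sub>R f \<tau>) \<partial>lborel)"
    unfolding set_lebesgue_integral_def
    using bounded_set_integrable[OF assms(1,2)] unfolding set_integrable_def
    by (rule integral_norm_bound_ennreal)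
  also have "\<dots> \<le> time_integral t F"
    by (intro nn_integral_mono) (use assms(3) in \<open>auto simp: indicator_def\<close>)
  finally show ?thesis .
qed

text \<open>When the mode 0 vanishes, so do the terms x = 0 and x = k; the sums may then range over
  all integers.\<close>

definition kdv_term :: "(real \<Rightarrow> int \<Rightarrow> complex) \<Rightarrow> int \<Rightarrow> real \<Rightarrow> int \<Rightarrow> complex"
  where "kdv_term v k \<tau> x = phase (3 * real_of_int (k * x * (k - x))) \<tau> * (v \<tau> x * v \<tau> (k - x))"

text \<open>The modes are continuous one at a time, without any continuity in l2. M bounds the
  square of the norm in H^0.\<close>

locale bounded_path =
  fixes v :: "real \<Rightarrow> int \<Rightarrow> complex" and M :: real
  assumes cont: "\<And>k. continuous_on UNIV (\<lambda>t. v t k)"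
    and zero [simp]: "\<And>t. v t 0 = 0"
    and sq_bound: "\<And>t. sqsum (\<lambda>k. enorm (v t k)) \<le> ennreal M"
    and M_nonneg: "0 \<le> M"
begin

lemma meas [measurable]: "(\<lambda>t. v t k) \<in> borel_measurable borel"
  by (intro borel_measurable_continuous_onI cont)

lemma finite_sum_sq:
  assumes "finite F"
  shows "(\<Sum>k\<in>F. (cmod (v t k))\<^sup>2) \<le> M"
proof -
  have "ennreal (\<Sum>k\<in>F. (cmod (v t k))\<^sup>2) = (\<Sum>k\<in>F. (enorm (v t k))\<^sup>2)"
    by (simp add: ennreal_power sum_ennreal)
  also have "\<dots> \<le> sqsum (\<lambda>k. enorm (v t k))"
    unfolding sqsum_def by (rule csum_finite_le[OF assms])
  also have "\<dots> \<le> ennreal M" by (rule sq_bound)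
  finally show ?thesis using M_nonneg by (simp add: ennreal_le_iff)
qed

lemma norm_le: "cmod (v t k) \<le> sqrt M"
  using finite_sum_sq[of "{k}" t] by (simp add: real_le_rsqrt)

lemma bounded_v: "bounded (range (\<lambda>t. v t k))"
  unfolding bounded_iff using norm_le by blast

lemma norm_term: "cmod (kdv_term v k \<tau> x) = cmod (v \<tau> x) * cmod (v \<tau> (k - x))"
  by (simp add: kdv_term_def norm_mult)

lemma sum_norm_term:
  assumes "finite F"
  shows "(\<Sum>x\<in>F. cmod (kdv_term v k \<tau> x)) \<le> M"
proof -
  have inj: "inj_on (\<lambda>x. k - x) F" by (auto simp: inj_on_def)
  have "(\<Sum>x\<in>F. cmod (kdv_term v k \<tau> x)) \<le> (\<Sum>x\<in>F. ((cmod (v \<tau> x))\<^sup>2 + (cmod (v \<tau> (k - x)))\<^sup>2) / 2)"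
    unfolding norm_term
  proof (intro sum_mono)
    show "cmod (v \<tau> x) * cmod (v \<tau> (k - x)) \<le> ((cmod (v \<tau> x))\<^sup>2 + (cmod (v \<tau> (k - x)))\<^sup>2) / 2" for x
      using sum_squares_bound[of "cmod (v \<tau> x)" "cmod (v \<tau> (k - x))"] by simp
  qed
  also have "\<dots> = ((\<Sum>x\<in>F. (cmod (v \<tau> x))\<^sup>2) + (\<Sum>x\<in>F. (cmod (v \<tau> (k - x)))\<^sup>2)) / 2"
    by (simp add: sum_divide_distrib[symmetric] sum.distrib)
  also have "(\<Sum>x\<in>F. (cmod (v \<tau> (k - x)))\<^sup>2) = (\<Sum>x\<in>(\<lambda>x. k - x) ` F. (cmod (v \<tau> x))\<^sup>2)"
    by (subst sum.reindex[OF inj]) simp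
  also have "((\<Sum>x\<in>F. (cmod (v \<tau> x))\<^sup>2) + \<dots>) / 2 \<le> (M + M) / 2"
    by (intro divide_right_mono add_mono finite_sum_sq) (auto simp: assms)
  finally show ?thesis by simp
qed

lemma kdv_rhs_has_sum: "(kdv_term v k \<tau> has_sum kdv_rhs v k \<tau>) UNIV"
proof -
  let ?A = "{k1. k1 \<noteq> 0 \<and> k - k1 \<noteq> 0}"
  have "(\<lambda>x. cmod (kdv_term v k \<tau> x)) summable_on ?A"
  proof (rule nonneg_bdd_above_summable_on)
    show "bdd_above (sum (\<lambda>x. cmod (kdv_term v k \<tau> x)) ` {F. F \<subseteq> ?A \<and> finite F})"
      by (rule bdd_aboveI[of _ M]) (auto intro: sum_norm_term)
  qed auto
  then have "kdv_term v k \<tau> summable_on ?A" by (rule abs_summable_summable)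
  moreover have "kdv_rhs v k \<tau> = infsum (kdv_term v k \<tau>) ?A"
    by (simp add: kdv_rhs_def kdv_term_def[abs_def] phase_def mult.assoc)
  ultimately have "(kdv_term v k \<tau> has_sum kdv_rhs v k \<tau>) ?A"
    by (simp add: has_sum_infsum)
  then show ?thesis
    by (subst has_sum_cong_neutral[of ?A UNIV]) (auto simp: kdv_term_def)
qed

lemma kdv_rhs_limit: "(\<lambda>N. \<Sum>x\<in>{- int N..int N}. kdv_term v k \<tau> x) \<longlonglongrightarrow> kdv_rhs v k \<tau>"
  using kdv_rhs_has_sum[unfolded has_sum_def] symmetric_intervals_cofinal
  by (rule filterlim_compose)

lemma kdv_term_measurable [measurable]: "(\<lambda>\<tau>. kdv_term v k \<tau> x) \<in> borel_measurable borel"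
  unfolding kdv_term_def by measurable

lemma kdv_rhs_measurable [measurable]: "kdv_rhs v k \<in> borel_measurable borel"
  by (rule borel_measurable_LIMSEQ_metric[OF _ kdv_rhs_limit]) measurable

lemma enorm_kdv_rhs_le: "enorm (kdv_rhs v k \<tau>) \<le> conv (\<lambda>k. enorm (v \<tau> k)) (\<lambda>k. enorm (v \<tau> k)) k"
proof -
  have "enorm (kdv_term v k \<tau> x) = enorm (v \<tau> x) * enorm (v \<tau> (k - x))" for x
    by (simp add: norm_term ennreal_mult)
  then show ?thesis
    using enorm_limit_le_csum[OF kdv_rhs_limit[of k \<tau>]] by (simp add: conv_def)
qed

lemma norm_partial_sum: "cmod (\<Sum>x\<in>{- int N..int N}. kdv_term v k \<tau> x) \<le> M"
  by (rule order_trans[OF norm_sum sum_norm_term]) simp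

lemma norm_kdv_rhs: "cmod (kdv_rhs v k \<tau>) \<le> M"
  by (rule Lim_bounded[OF tendsto_norm[OF kdv_rhs_limit]]) (use norm_partial_sum in blast)

lemma bounded_kdv_rhs: "bounded (range (kdv_rhs v k))"
  unfolding bounded_iff using norm_kdv_rhs by blast

lemma bounded_kdv_term: "bounded (range (\<lambda>\<tau>. kdv_term v k \<tau> x))"
  unfolding bounded_iff using sum_norm_term[of "{x}"] by auto

text \<open>Dominated convergence moves the time integral inside the frequency sum, so that
  integration by parts can be done term by term; the majorant comes from
  \<open>norm_partial_sum\<close>. The weight h will be 1 in the outer sum, and the phase times the
  undifferentiated mode in the nested one.\<close>

lemma integral_kdv_rhs_limit:
  assumes [measurable]: "h \<in> borel_measurable borel" and "bounded (range h)"
  shows "(\<lambda>N. \<Sum>x\<in>{- int N..int N}. LINT \<tau>:{0..t}|lborel. h \<tau> * kdv_term v k \<tau> x)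
    \<longlonglongrightarrow> (LINT \<tau>:{0..t}|lborel. h \<tau> * kdv_rhs v k \<tau>)"
proof -
  obtain c where c: "\<And>\<tau>. cmod (h \<tau>) \<le> c" using assms(2) by (auto simp: bounded_iff)
  have "(\<Sum>x\<in>F. LINT \<tau>:{0..t}|lborel. h \<tau> * kdv_term v k \<tau> x)
      = (LINT \<tau>|lborel. indicator {0..t} \<tau> *\<^sub>R (h \<tau> * (\<Sum>x\<in>F. kdv_term v k \<tau> x)))" for F
  proof -
    have "integrable lborel (\<lambda>\<tau>. indicator {0..t} \<tau> *\<^sub>R (h \<tau> * kdv_term v k \<tau> x))" for x
      using bounded_set_integrable[of "\<lambda>\<tau>. h \<tau> * kdv_term v k \<tau> x" 0 t]
        bounded_range_mult[OF assms(2) bounded_kdv_term] by (simp add: set_integrable_def)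
    then show ?thesis
      by (simp add: set_lebesgue_integral_def sum_distrib_left scaleR_sum_right
          Bochner_Integration.integral_sum)
  qed
  moreover have "(\<lambda>N. LINT \<tau>|lborel. indicator {0..t} \<tau> *\<^sub>R (h \<tau> * (\<Sum>x\<in>{- int N..int N}. kdv_term v k \<tau> x)))
      \<longlonglongrightarrow> (LINT \<tau>|lborel. indicator {0..t} \<tau> *\<^sub>R (h \<tau> * kdv_rhs v k \<tau>))"
  proof (rule integral_dominated_convergence[where w="\<lambda>\<tau>. indicator {0..t} \<tau> * (c * M)"])
    show "integrable lborel (\<lambda>\<tau>. indicator {0..t} \<tau> * (c * M))"
      by (intro integrable_mult_left) (auto simp: emeasure_lborel_Icc_eq)
    show "AE \<tau> in lborel. (\<lambda>N. indicator {0..t} \<tau> *\<^sub>R (h \<tau> * (\<Sum>x\<in>{- int N..int N}. kdv_term v k \<tau> x)))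
        \<longlonglongrightarrow> indicator {0..t} \<tau> *\<^sub>R (h \<tau> * kdv_rhs v k \<tau>)"
      by (intro AE_I2 tendsto_intros kdv_rhs_limit)
    show "AE \<tau> in lborel. norm (indicator {0..t} \<tau> *\<^sub>R (h \<tau> * (\<Sum>x\<in>{- int N..int N}. kdv_term v k \<tau> x)))
        \<le> indicator {0..t} \<tau> * (c * M)" for N
    proof (rule AE_I2)
      fix \<tau>
      have "norm (h \<tau>) * norm (\<Sum>x\<in>{- int N..int N}. kdv_term v k \<tau> x) \<le> c * M"
        by (rule mult_mono'[OF c norm_partial_sum]) auto
      then show "norm (indicator {0..t} \<tau> *\<^sub>R (h \<tau> * (\<Sum>x\<in>{- int N..int N}. kdv_term v k \<tau> x)))
        \<le> indicator {0..t} \<tau> * (c * M)"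
        by (simp add: norm_mult indicator_def)
    qed
  qed measurable
  ultimately show ?thesis by (simp add: set_lebesgue_integral_def)
qed

end

section \<open>Differences of two bounded paths\<close>

locale path_pair = v: bounded_path v M + v': bounded_path v' M
  for v v' :: "real \<Rightarrow> int \<Rightarrow> complex" and M :: real
begin

definition z :: "real \<Rightarrow> int \<Rightarrow> ennreal" where "z \<tau> k = enorm (v \<tau> k - v' \<tau> k)"
definition u :: "real \<Rightarrow> int \<Rightarrow> ennreal" where "u \<tau> k = enorm (v \<tau> k) + enorm (v' \<tau> k)"

sublocale pf: pair_forms "z \<tau>" "u \<tau>" for \<tau> .

lemma u_ge: "enorm (v \<tau> k) \<le> u \<tau> k" "enorm (v' \<tau> k) \<le> u \<tau> k"
  by (simp_all add: u_def)

lemma z_measurable [measurable]: "(\<lambda>\<tau>. z \<tau> k) \<in> borel_measurable borel"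
  unfolding z_def by measurable
lemma u_measurable [measurable]: "(\<lambda>\<tau>. u \<tau> k) \<in> borel_measurable borel"
  unfolding u_def by measurable
lemma Zc_measurable [measurable]: "(\<lambda>\<tau>. pf.Zc \<tau> k) \<in> borel_measurable borel"
  unfolding pf.Zc_def conv_def by measurable
lemma Uc_measurable [measurable]: "(\<lambda>\<tau>. pf.Uc \<tau> k) \<in> borel_measurable borel"
  unfolding pf.Uc_def conv_def by measurable
lemma d3_measurable [measurable]: "(\<lambda>\<tau>. pf.d3 \<tau> k x y) \<in> borel_measurable borel"
  unfolding pf.d3_def by measurable
lemma d4_measurable [measurable]: "(\<lambda>\<tau>. pf.d4 \<tau> k x y) \<in> borel_measurable borel"
  unfolding pf.d4_def pf.d4a_def pf.d4b_def pf.d4c_def by measurable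

lemma kdv_rhs_le_Uc: "enorm (kdv_rhs v k \<tau>) \<le> pf.Uc \<tau> k" "enorm (kdv_rhs v' k \<tau>) \<le> pf.Uc \<tau> k"
proof -
  have "conv (\<lambda>k. enorm (v \<tau> k)) (\<lambda>k. enorm (v \<tau> k)) k \<le> pf.Uc \<tau> k"
    "conv (\<lambda>k. enorm (v' \<tau> k)) (\<lambda>k. enorm (v' \<tau> k)) k \<le> pf.Uc \<tau> k"
    unfolding pf.Uc_def conv_def by (intro csum_mono mult_mono u_ge; simp)+
  then show "enorm (kdv_rhs v k \<tau>) \<le> pf.Uc \<tau> k" "enorm (kdv_rhs v' k \<tau>) \<le> pf.Uc \<tau> k"
    using v.enorm_kdv_rhs_le v'.enorm_kdv_rhs_le order_trans by blast+
qed

lemma diff2_le: "enorm (v \<tau> x * v \<tau> (k - x) - v' \<tau> x * v' \<tau> (k - x)) \<le> pf.d2 \<tau> k x"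
  unfolding pf.d2_def by (rule enorm_diff2) (auto simp: z_def u_ge)

lemma kdv_rhs_diff_le_Zc: "enorm (kdv_rhs v k \<tau> - kdv_rhs v' k \<tau>) \<le> pf.Zc \<tau> k"
proof -
  have "(\<lambda>N. \<Sum>x\<in>{- int N..int N}. kdv_term v k \<tau> x - kdv_term v' k \<tau> x)
      \<longlonglongrightarrow> kdv_rhs v k \<tau> - kdv_rhs v' k \<tau>"
    unfolding sum_subtractf by (intro tendsto_diff v.kdv_rhs_limit v'.kdv_rhs_limit)
  then have "enorm (kdv_rhs v k \<tau> - kdv_rhs v' k \<tau>) \<le> (\<Sum>\<^sup>+x. enorm (kdv_term v k \<tau> x - kdv_term v' k \<tau> x))"
    by (rule enorm_limit_le_csum)
  also have "\<dots> \<le> (\<Sum>\<^sup>+x. pf.d2 \<tau> k x)"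
  proof (rule csum_mono)
    fix x
    have "enorm (kdv_term v k \<tau> x - kdv_term v' k \<tau> x)
      = enorm (v \<tau> x * v \<tau> (k - x) - v' \<tau> x * v' \<tau> (k - x))"
      unfolding kdv_term_def right_diff_distrib[symmetric] by (simp add: norm_mult)
    then show "enorm (kdv_term v k \<tau> x - kdv_term v' k \<tau> x) \<le> pf.d2 \<tau> k x"
      using diff2_le[of \<tau> x k] by simp
  qed
  finally show ?thesis by (simp add: pf.Zc_def pf.d2_def conv_def csum_add)
qed

lemma diff3_le: "enorm (v \<tau> x * v \<tau> y * v \<tau> (k - x - y) - v' \<tau> x * v' \<tau> y * v' \<tau> (k - x - y)) \<le> pf.d3 \<tau> k x y"
  unfolding pf.d3_def by (rule enorm_diff3) (auto simp: z_def u_ge)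

text \<open>The left-hand side is literally the derivative that \<open>primitive_mult\<close> and
  \<open>primitive_diff\<close> produce for the difference of the cubic products. It is regrouped
  according to the factor that is differentiated.\<close>

lemma diff4_le:
  assumes "\<And>j. cmod (c j) \<le> \<bar>real_of_int j\<bar>"
  shows "enorm ((c x * kdv_rhs v x \<tau> * v \<tau> y + v \<tau> x * (c y * kdv_rhs v y \<tau>)) * v \<tau> (k - x - y)
      + v \<tau> x * v \<tau> y * (c (k - x - y) * kdv_rhs v (k - x - y) \<tau>)
    - ((c x * kdv_rhs v' x \<tau> * v' \<tau> y + v' \<tau> x * (c y * kdv_rhs v' y \<tau>)) * v' \<tau> (k - x - y)
      + v' \<tau> x * v' \<tau> y * (c (k - x - y) * kdv_rhs v' (k - x - y) \<tau>))) \<le> pf.d4 \<tau> k x y"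
    (is "enorm ?D \<le> _")
proof -
  let ?m = "k - x - y"
  define a where "a = kdv_rhs v x \<tau> * v \<tau> y * v \<tau> ?m - kdv_rhs v' x \<tau> * v' \<tau> y * v' \<tau> ?m"
  define b where "b = v \<tau> x * kdv_rhs v y \<tau> * v \<tau> ?m - v' \<tau> x * kdv_rhs v' y \<tau> * v' \<tau> ?m"
  define e where "e = v \<tau> x * v \<tau> y * kdv_rhs v ?m \<tau> - v' \<tau> x * v' \<tau> y * kdv_rhs v' ?m \<tau>"
  have a: "enorm a \<le> pf.d4a \<tau> k x y"
    unfolding a_def pf.d4a_def
    by (rule enorm_diff3) (auto simp: z_def u_ge kdv_rhs_le_Uc kdv_rhs_diff_le_Zc)
  have "enorm b \<le> z \<tau> x * pf.Uc \<tau> y * u \<tau> ?m + u \<tau> x * pf.Zc \<tau> y * u \<tau> ?m + u \<tau> x * pf.Uc \<tau> y * z \<tau> ?m"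
    unfolding b_def
    by (rule enorm_diff3) (auto simp: z_def u_ge kdv_rhs_le_Uc kdv_rhs_diff_le_Zc)
  then have b: "enorm b \<le> pf.d4b \<tau> k x y" unfolding pf.d4b_def by (simp add: add_ac)
  have "enorm e \<le> z \<tau> x * u \<tau> y * pf.Uc \<tau> ?m + u \<tau> x * z \<tau> y * pf.Uc \<tau> ?m + u \<tau> x * u \<tau> y * pf.Zc \<tau> ?m"
    unfolding e_def
    by (rule enorm_diff3) (auto simp: z_def u_ge kdv_rhs_le_Uc kdv_rhs_diff_le_Zc)
  then have e: "enorm e \<le> pf.d4c \<tau> k x y" unfolding pf.d4c_def by (simp add: add_ac)
  have "?D = c x * a + c y * b + c ?m * e"
    by (simp add: a_def b_def e_def algebra_simps)
  then have "enorm ?D \<le> enorm (c x * a) + enorm (c y * b) + enorm (c ?m * e)"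
    by (metis (no_types, lifting) add_right_mono enorm_add order_trans)
  also have "\<dots> \<le> ennreal \<bar>real_of_int x\<bar> * pf.d4a \<tau> k x y + ennreal \<bar>real_of_int y\<bar> * pf.d4b \<tau> k x y
    + ennreal \<bar>real_of_int ?m\<bar> * pf.d4c \<tau> k x y"
    unfolding enorm_mult by (intro add_mono mult_mono a b e ennreal_leI assms) auto
  finally show ?thesis by (simp only: pf.d4_def)
qed

text \<open>Two weights are needed because in the nested sums they contain the modes
  \<open>v \<tau> x\<close> and \<open>v' \<tau> x\<close> of the respective path.\<close>

lemma integral_kdv_rhs_diff_le:
  assumes h: "h \<in> borel_measurable borel" "bounded (range h)"
    and h': "h' \<in> borel_measurable borel" "bounded (range h')"
  shows "enorm (LINT \<tau>:{0..t}|lborel. h \<tau> * kdv_rhs v k \<tau> - h' \<tau> * kdv_rhs v' k \<tau>)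
    \<le> (\<Sum>\<^sup>+x. enorm (LINT \<tau>:{0..t}|lborel. h \<tau> * kdv_term v k \<tau> x - h' \<tau> * kdv_term v' k \<tau> x))"
proof (rule enorm_limit_le_csum)
  note [measurable] = h(1) h'(1)
  have "(LINT \<tau>:{0..t}|lborel. h \<tau> * kdv_term v k \<tau> x - h' \<tau> * kdv_term v' k \<tau> x)
    = (LINT \<tau>:{0..t}|lborel. h \<tau> * kdv_term v k \<tau> x) - (LINT \<tau>:{0..t}|lborel. h' \<tau> * kdv_term v' k \<tau> x)" for x
    by (intro set_integral_diff bounded_set_integrable bounded_range_mult h h' v.bounded_kdv_term v'.bounded_kdv_term)
      measurable
  moreover have "(LINT \<tau>:{0..t}|lborel. h \<tau> * kdv_rhs v k \<tau> - h' \<tau> * kdv_rhs v' k \<tau>)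
    = (LINT \<tau>:{0..t}|lborel. h \<tau> * kdv_rhs v k \<tau>) - (LINT \<tau>:{0..t}|lborel. h' \<tau> * kdv_rhs v' k \<tau>)"
    by (intro set_integral_diff bounded_set_integrable bounded_range_mult h h' v.bounded_kdv_rhs v'.bounded_kdv_rhs)
      measurable
  ultimately show "(\<lambda>N. \<Sum>x\<in>{- int N..int N}. LINT \<tau>:{0..t}|lborel. h \<tau> * kdv_term v k \<tau> x - h' \<tau> * kdv_term v' k \<tau> x)
    \<longlonglongrightarrow> (LINT \<tau>:{0..t}|lborel. h \<tau> * kdv_rhs v k \<tau> - h' \<tau> * kdv_rhs v' k \<tau>)"
    using tendsto_diff[OF v.integral_kdv_rhs_limit[OF h] v'.integral_kdv_rhs_limit[OF h']]
    by (simp add: sum_subtractf)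
qed

end

section \<open>The two integrations by parts for a pair of solutions\<close>

locale solution_pair = path_pair v v' M for v v' :: "real \<Rightarrow> int \<Rightarrow> complex" and M :: real +
  fixes T :: real and \<theta> :: "int \<Rightarrow> real"
  assumes chi_le: "\<And>k. \<bar>\<theta> k\<bar> \<le> 1"
    and eq: "\<And>k t. t \<in> {0..T} \<Longrightarrow> v t k = v 0 k
      + (LINT \<tau>:{0..t}|lborel. (1/2) * \<i> * of_int k * of_real (\<theta> k) * kdv_rhs v k \<tau>)"
    and eq': "\<And>k t. t \<in> {0..T} \<Longrightarrow> v' t k = v' 0 k
      + (LINT \<tau>:{0..t}|lborel. (1/2) * \<i> * of_int k * of_real (\<theta> k) * kdv_rhs v' k \<tau>)"
begin

definition coeff :: "int \<Rightarrow> complex" where "coeff k = (1/2) * \<i> * of_int k * of_real (\<theta> k)"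

lemma norm_coeff: "cmod (coeff k) \<le> \<bar>real_of_int k\<bar> / 2"
proof -
  have "\<bar>real_of_int k\<bar> / 2 * \<bar>\<theta> k\<bar> \<le> \<bar>real_of_int k\<bar> / 2 * 1"
    by (intro mult_left_mono chi_le) auto
  then show ?thesis by (simp add: coeff_def norm_mult)
qed

lemma norm_coeff': "cmod (coeff k) \<le> \<bar>real_of_int k\<bar>"
  using norm_coeff[of k] by simp

lemma enorm_coeff: "enorm (coeff k) \<le> ennreal (1/2) * ennreal \<bar>real_of_int k\<bar>"
proof -
  have "enorm (coeff k) \<le> ennreal (1/2 * \<bar>real_of_int k\<bar>)"
    by (rule ennreal_leI) (use norm_coeff[of k] in simp)
  also have "\<dots> = ennreal (1/2) * ennreal \<bar>real_of_int k\<bar>"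
    by (rule ennreal_mult) auto
  finally show ?thesis .
qed

lemma prim: "primitive T (\<lambda>t. v t k) (\<lambda>\<tau>. coeff k * kdv_rhs v k \<tau>)"
  and prim': "primitive T (\<lambda>t. v' t k) (\<lambda>\<tau>. coeff k * kdv_rhs v' k \<tau>)"
proof -
  have m: "(\<lambda>\<tau>. coeff k * kdv_rhs v k \<tau>) \<in> borel_measurable borel" "(\<lambda>\<tau>. coeff k * kdv_rhs v' k \<tau>) \<in> borel_measurable borel"
    by measurable
  have b: "bounded (range (\<lambda>\<tau>. coeff k * kdv_rhs v k \<tau>))" "bounded (range (\<lambda>\<tau>. coeff k * kdv_rhs v' k \<tau>))"
    by (intro bounded_range_mult bounded_range_const v.bounded_kdv_rhs v'.bounded_kdv_rhs)+
  show "primitive T (\<lambda>t. v t k) (\<lambda>\<tau>. coeff k * kdv_rhs v k \<tau>)"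
    unfolding primitive_def using eq[of _ k, folded coeff_def] v.meas v.bounded_v m(1) b(1) by blast
  show "primitive T (\<lambda>t. v' t k) (\<lambda>\<tau>. coeff k * kdv_rhs v' k \<tau>)"
    unfolding primitive_def using eq'[of _ k, folded coeff_def] v'.meas v'.bounded_v m(2) b(2) by blast
qed

definition rhs_diff :: "real \<Rightarrow> int \<Rightarrow> complex"
  where "rhs_diff t k = (LINT \<tau>:{0..t}|lborel. kdv_rhs v k \<tau> - kdv_rhs v' k \<tau>)"

lemma z_le_rhs_diff:
  assumes "t \<in> {0..T}"
  shows "z t k \<le> z 0 k + ennreal (1/2) * ennreal \<bar>real_of_int k\<bar> * enorm (rhs_diff t k)"
proof -
  have cancel: "x = x0 + p \<Longrightarrow> y = y0 + q \<Longrightarrow> x - y - (x0 - y0) = p - q" for x x0 p y y0 q :: complex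
    by simp
  have "v t k - v' t k - (v 0 k - v' 0 k) = (LINT \<tau>:{0..t}|lborel. coeff k * kdv_rhs v k \<tau>) - (LINT \<tau>:{0..t}|lborel. coeff k * kdv_rhs v' k \<tau>)"
    unfolding coeff_def by (rule cancel[OF eq[OF assms] eq'[OF assms]])
  also have "\<dots> = coeff k * (LINT \<tau>:{0..t}|lborel. kdv_rhs v k \<tau>) - coeff k * (LINT \<tau>:{0..t}|lborel. kdv_rhs v' k \<tau>)"
    by (simp only: set_integral_mult_right)
  also have "\<dots> = coeff k * rhs_diff t k"
    unfolding rhs_diff_def right_diff_distrib[symmetric]
    by (subst set_integral_diff) (auto intro!: bounded_set_integrable v.bounded_kdv_rhs v'.bounded_kdv_rhs)
  finally have "enorm (v t k - v' t k) \<le> enorm (v 0 k - v' 0 k) + enorm (coeff k * rhs_diff t k)"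
    using enorm_diff_le[of "v t k - v' t k" "v 0 k - v' 0 k"] by simp
  also have "enorm (coeff k * rhs_diff t k) \<le> ennreal (1/2) * ennreal \<bar>real_of_int k\<bar> * enorm (rhs_diff t k)"
    unfolding enorm_mult by (intro mult_right_mono enorm_coeff) auto
  finally show ?thesis by (simp add: z_def add_left_mono)
qed

lemma z_low:
  assumes "t \<in> {0..T}"
  shows "z t k \<le> z 0 k + ennreal \<bar>real_of_int k\<bar> * time_integral t (\<lambda>\<tau>. pf.Zc \<tau> k)"
proof -
  have "enorm (rhs_diff t k) \<le> time_integral t (\<lambda>\<tau>. pf.Zc \<tau> k)"
    unfolding rhs_diff_def
  proof (rule enorm_set_integral_le)
    show "(\<lambda>\<tau>. kdv_rhs v k \<tau> - kdv_rhs v' k \<tau>) \<in> borel_measurable borel" by measurable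
  qed (intro bounded_range_diff v.bounded_kdv_rhs v'.bounded_kdv_rhs kdv_rhs_diff_le_Zc)+
  moreover have half_le: "ennreal (1/2) \<le> 1"
    unfolding ennreal_1[symmetric] by (rule ennreal_leI) simp
  ultimately have "ennreal (1/2) * ennreal \<bar>real_of_int k\<bar> * enorm (rhs_diff t k) \<le> 1 * ennreal \<bar>real_of_int k\<bar> * time_integral t (\<lambda>\<tau>. pf.Zc \<tau> k)"
    by (intro mult_mono half_le) auto
  then show ?thesis
    using z_le_rhs_diff[OF assms, of k] by (simp add: add_left_mono order_trans)
qed

text \<open>What the first integration by parts leaves when the mode k - x is differentiated, with
  the coefficient of its equation pulled out.\<close>

definition nested :: "real \<Rightarrow> int \<Rightarrow> int \<Rightarrow> complex"
  where "nested t k x = (LINT \<tau>:{0..t}|lborel. phase (3 * real_of_int (k * x * (k - x))) \<tau> * v \<tau> x * kdv_rhs v (k - x) \<tau>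
    - phase (3 * real_of_int (k * x * (k - x))) \<tau> * v' \<tau> x * kdv_rhs v' (k - x) \<tau>)"

definition trilinear :: "real \<Rightarrow> int \<Rightarrow> int \<Rightarrow> int \<Rightarrow> complex"
  where "trilinear t k x y = (LINT \<tau>:{0..t}|lborel. phase (3 * real_of_int ((x + y) * (k - x) * (k - y))) \<tau> *
    (v \<tau> x * v \<tau> y * v \<tau> (k - x - y) - v' \<tau> x * v' \<tau> y * v' \<tau> (k - x - y)))"

lemma nested_le_trilinear: "enorm (nested t k x) \<le> (\<Sum>\<^sup>+y. enorm (trilinear t k x y))"
proof -
  let ?\<phi> = "3 * real_of_int (k * x * (k - x))"
  have "enorm (nested t k x) \<le> (\<Sum>\<^sup>+y. enorm (LINT \<tau>:{0..t}|lborel.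
      phase ?\<phi> \<tau> * v \<tau> x * kdv_term v (k - x) \<tau> y - phase ?\<phi> \<tau> * v' \<tau> x * kdv_term v' (k - x) \<tau> y))"
    unfolding nested_def
  proof (rule integral_kdv_rhs_diff_le)
    show "(\<lambda>\<tau>. phase ?\<phi> \<tau> * v \<tau> x) \<in> borel_measurable borel" "(\<lambda>\<tau>. phase ?\<phi> \<tau> * v' \<tau> x) \<in> borel_measurable borel"
      by measurable
  qed (intro bounded_range_mult bounded_phase v.bounded_v v'.bounded_v)+
  also have "\<dots> = (\<Sum>\<^sup>+y. enorm (trilinear t k x y))"
  proof -
    have "phase ?\<phi> \<tau> * v \<tau> x * kdv_term v (k - x) \<tau> y - phase ?\<phi> \<tau> * v' \<tau> x * kdv_term v' (k - x) \<tau> y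
      = phase (3 * real_of_int ((x + y) * (k - x) * (k - y))) \<tau> *
        (v \<tau> x * v \<tau> y * v \<tau> (k - x - y) - v' \<tau> x * v' \<tau> y * v' \<tau> (k - x - y))" for \<tau> y
    proof -
      \<comment> \<open>The phases telescope: with k3 = k - x - y the first is k^3 - x^3 - (k -
        x)^3, the second (k - x)^3 - y^3 - k3^3. Their sum is the classical factorisation of (k1 +
        k2 + k3)^3 - k1^3 - k2^3 - k3^3.\<close>
      have "?\<phi> + 3 * real_of_int ((k - x) * y * (k - x - y)) = 3 * real_of_int ((x + y) * (k - x) * (k - y))"
        by (simp add: algebra_simps)
      then have ph: "phase (3 * real_of_int ((x + y) * (k - x) * (k - y))) \<tau>
        = phase ?\<phi> \<tau> * phase (3 * real_of_int ((k - x) * y * (k - x - y))) \<tau>"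
        by (simp only: phase_mult)
      have alg: "p * f * (q * (g * h)) - p * f' * (q * (g' * h')) = p * q * (f * g * h - f' * g' * h')"
        for p q f g h f' g' h' :: complex by (simp add: algebra_simps)
      show ?thesis unfolding kdv_term_def ph by (rule alg)
    qed
    then show ?thesis by (simp only: trilinear_def)
  qed
  finally show ?thesis .
qed

lemma trilinear_resonant: "enorm (trilinear t k x y) \<le> time_integral t (\<lambda>\<tau>. pf.d3 \<tau> k x y)"
  unfolding trilinear_def
proof (rule enorm_set_integral_le)
  show "bounded (range (\<lambda>\<tau>. phase (3 * real_of_int ((x + y) * (k - x) * (k - y))) \<tau> *
    (v \<tau> x * v \<tau> y * v \<tau> (k - x - y) - v' \<tau> x * v' \<tau> y * v' \<tau> (k - x - y))))"
    by (intro bounded_range_mult bounded_range_diff bounded_phase v.bounded_v v'.bounded_v)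
  show "enorm (phase (3 * real_of_int ((x + y) * (k - x) * (k - y))) \<tau> *
    (v \<tau> x * v \<tau> y * v \<tau> (k - x - y) - v' \<tau> x * v' \<tau> y * v' \<tau> (k - x - y))) \<le> pf.d3 \<tau> k x y" for \<tau>
    using diff3_le[of \<tau> x y k] by (simp add: norm_mult)
qed measurable

lemma trilinear_nonresonant:
  assumes "x + y \<noteq> 0" "k - x \<noteq> 0" "k - y \<noteq> 0" and t: "t \<in> {0..T}"
  shows "enorm (trilinear t k x y) \<le> recip (x + y) * recip (k - x) * recip (k - y) *
    (pf.d3 t k x y + pf.d3 0 k x y + time_integral t (\<lambda>\<tau>. pf.d4 \<tau> k x y))"
proof -
  define om where "om = 3 * real_of_int ((x + y) * (k - x) * (k - y))"
  define m where "m = k - x - y"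
  define f where "f \<tau> = v \<tau> x * v \<tau> y * v \<tau> m - v' \<tau> x * v' \<tau> y * v' \<tau> m" for \<tau>
  define f' where "f' \<tau> = (coeff x * kdv_rhs v x \<tau> * v \<tau> y + v \<tau> x * (coeff y * kdv_rhs v y \<tau>)) * v \<tau> m
      + v \<tau> x * v \<tau> y * (coeff m * kdv_rhs v m \<tau>)
    - ((coeff x * kdv_rhs v' x \<tau> * v' \<tau> y + v' \<tau> x * (coeff y * kdv_rhs v' y \<tau>)) * v' \<tau> m
      + v' \<tau> x * v' \<tau> y * (coeff m * kdv_rhs v' m \<tau>))" for \<tau>
  have prim_f: "primitive T f f'"
    unfolding f_def[abs_def] f'_def[abs_def]
    by (intro primitive_diff primitive_mult prim prim')
  have om: "om \<noteq> 0" using assms by (auto simp: om_def)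
  have "norm (LINT \<tau>:{0..t}|lborel. phase om \<tau> * f \<tau>) \<le>
    1 / \<bar>om\<bar> * (norm (f t) + norm (f 0) + norm (LINT \<tau>:{0..t}|lborel. phase om \<tau> * f' \<tau>))"
    by (rule oscillatory_integral_bound[OF prim_f om t])
  then have "enorm (trilinear t k x y) \<le> ennreal (1 / \<bar>om\<bar> * (norm (f t) + norm (f 0) + norm (LINT \<tau>:{0..t}|lborel. phase om \<tau> * f' \<tau>)))"
    unfolding trilinear_def f_def om_def m_def by (rule ennreal_leI)
  also have "\<dots> = ennreal (1 / \<bar>om\<bar>) * (enorm (f t) + enorm (f 0) + enorm (LINT \<tau>:{0..t}|lborel. phase om \<tau> * f' \<tau>))"
    by (subst ennreal_mult) auto
  also have "\<dots> \<le> (recip (x + y) * recip (k - x) * recip (k - y)) *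
    (pf.d3 t k x y + pf.d3 0 k x y + time_integral t (\<lambda>\<tau>. pf.d4 \<tau> k x y))"
  proof (intro mult_mono add_mono)
    have "1 / \<bar>om\<bar> = 1 / 3 * (1 / \<bar>real_of_int (x + y)\<bar> * (1 / \<bar>real_of_int (k - x)\<bar>) * (1 / \<bar>real_of_int (k - y)\<bar>))"
      unfolding om_def by (simp add: abs_mult)
    also have "\<dots> \<le> 1 / \<bar>real_of_int (x + y)\<bar> * (1 / \<bar>real_of_int (k - x)\<bar>) * (1 / \<bar>real_of_int (k - y)\<bar>)"
      by (rule mult_left_le_one_le) auto
    finally have "ennreal (1 / \<bar>om\<bar>) \<le> ennreal \<dots>" by (rule ennreal_leI)
    then show "ennreal (1 / \<bar>om\<bar>) \<le> recip (x + y) * recip (k - x) * recip (k - y)"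
      unfolding recip_def by (simp only: ennreal_mult[symmetric] zero_le_divide_1_iff abs_ge_zero mult_nonneg_nonneg)
    show "enorm (f t) \<le> pf.d3 t k x y" "enorm (f 0) \<le> pf.d3 0 k x y"
      unfolding f_def m_def by (rule diff3_le)+
    show "enorm (LINT \<tau>:{0..t}|lborel. phase om \<tau> * f' \<tau>) \<le> time_integral t (\<lambda>\<tau>. pf.d4 \<tau> k x y)"
    proof (rule enorm_set_integral_le)
      have b: "bounded (range f')" and [measurable]: "f' \<in> borel_measurable borel"
        using prim_f unfolding primitive_def by blast+
      show "(\<lambda>\<tau>. phase om \<tau> * f' \<tau>) \<in> borel_measurable borel" by measurable
      show "bounded (range (\<lambda>\<tau>. phase om \<tau> * f' \<tau>))"
        by (intro bounded_range_mult bounded_phase b)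
      show "enorm (phase om \<tau> * f' \<tau>) \<le> pf.d4 \<tau> k x y" for \<tau>
        using diff4_le[of coeff x \<tau> y k, OF norm_coeff'] by (simp only: norm_mult norm_phase mult_1 f'_def m_def)
    qed
  qed auto
  finally show ?thesis .
qed

text \<open>The value 0 at k = x is legitimate because that term of the outer sum contains the mode
  0. It removes the factor k - x of the second phase from the resonances.\<close>

definition nested_recip :: "real \<Rightarrow> int \<Rightarrow> int \<Rightarrow> ennreal"
  where "nested_recip t k x = (if k = x then 0 else recip x * enorm (nested t k x))"

lemma nested_recip_le:
  assumes t: "t \<in> {0..T}"
  shows "nested_recip t k x \<le> (\<Sum>\<^sup>+y. recip x * (if x + y = 0 \<or> k = y then time_integral t (\<lambda>\<tau>. pf.d3 \<tau> k x y) else 0)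
    + ker4 k x y * (pf.d3 t k x y + pf.d3 0 k x y + time_integral t (\<lambda>\<tau>. pf.d4 \<tau> k x y)))"
proof (cases "k = x")
  case False
  have "nested_recip t k x \<le> recip x * (\<Sum>\<^sup>+y. enorm (trilinear t k x y))"
    unfolding nested_recip_def using False by (auto intro!: mult_left_mono nested_le_trilinear)
  also have "\<dots> = (\<Sum>\<^sup>+y. recip x * enorm (trilinear t k x y))" by (simp add: csum_cmult)
  also have "\<dots> \<le> (\<Sum>\<^sup>+y. recip x * (if x + y = 0 \<or> k = y then time_integral t (\<lambda>\<tau>. pf.d3 \<tau> k x y) else 0)
    + ker4 k x y * (pf.d3 t k x y + pf.d3 0 k x y + time_integral t (\<lambda>\<tau>. pf.d4 \<tau> k x y)))"
  proof (rule csum_mono)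
    fix y
    show "recip x * enorm (trilinear t k x y) \<le> recip x * (if x + y = 0 \<or> k = y then time_integral t (\<lambda>\<tau>. pf.d3 \<tau> k x y) else 0)
    + ker4 k x y * (pf.d3 t k x y + pf.d3 0 k x y + time_integral t (\<lambda>\<tau>. pf.d4 \<tau> k x y))"
    proof (cases "x + y = 0 \<or> k = y")
      case True
      then have "recip x * enorm (trilinear t k x y) \<le> recip x * (if x + y = 0 \<or> k = y then time_integral t (\<lambda>\<tau>. pf.d3 \<tau> k x y) else 0)"
        by (simp add: mult_left_mono trilinear_resonant)
      then show ?thesis by (rule order_trans) simp
    next
      case nr: False
      then have "recip x * enorm (trilinear t k x y) \<le> recip x * (recip (x + y) * recip (k - x) * recip (k - y) *
        (pf.d3 t k x y + pf.d3 0 k x y + time_integral t (\<lambda>\<tau>. pf.d4 \<tau> k x y)))"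
        using False t by (intro mult_left_mono trilinear_nonresonant) auto
      then show ?thesis using nr by (simp add: ker4_def mult.assoc)
    qed
  qed
  finally show ?thesis .
qed (simp add: nested_recip_def)

text \<open>The prefactor |k|/2 of the equation cancels against the phase 3 k x (k - x). The
  boundary keeps 1/(x (k - x)); in the interior the differentiated mode cancels its own reciprocal,
  and that of the other mode survives. The numerical factor 1/6 is thrown away.\<close>

lemma first_step:
  assumes t: "t \<in> {0..T}" and k: "k \<noteq> 0"
  shows "ennreal (1/2) * ennreal \<bar>real_of_int k\<bar> *
      enorm (LINT \<tau>:{0..t}|lborel. kdv_term v k \<tau> x - kdv_term v' k \<tau> x)
    \<le> recip x * recip (k - x) * (pf.d2 t k x + pf.d2 0 k x) + ennreal (1/2) * (nested_recip t k x + nested_recip t k (k - x))"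
proof (cases "x = 0 \<or> k - x = 0")
  case True
  then have "kdv_term v k \<tau> x - kdv_term v' k \<tau> x = 0" for \<tau> by (auto simp: kdv_term_def)
  then show ?thesis by (simp add: set_lebesgue_integral_def)
next
  case False
  define j where "j = k - x"
  define \<phi> where "\<phi> = 3 * real_of_int (k * x * j)"
  define f where "f \<tau> = v \<tau> x * v \<tau> j - v' \<tau> x * v' \<tau> j" for \<tau>
  define f' where "f' \<tau> = (coeff x * kdv_rhs v x \<tau> * v \<tau> j + v \<tau> x * (coeff j * kdv_rhs v j \<tau>))
    - (coeff x * kdv_rhs v' x \<tau> * v' \<tau> j + v' \<tau> x * (coeff j * kdv_rhs v' j \<tau>))" for \<tau>
  have xj: "x \<noteq> 0" "j \<noteq> 0" using False by (auto simp: j_def)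
  have prim_f: "primitive T f f'"
    unfolding f_def[abs_def] f'_def[abs_def] by (intro primitive_diff primitive_mult prim prim')
  have \<phi>: "\<phi> \<noteq> 0" using xj k by (auto simp: \<phi>_def)
  have "kdv_term v k \<tau> x - kdv_term v' k \<tau> x = phase \<phi> \<tau> * f \<tau>" for \<tau>
    unfolding kdv_term_def f_def \<phi>_def j_def by (simp only: right_diff_distrib)
  then have "cmod (LINT \<tau>:{0..t}|lborel. kdv_term v k \<tau> x - kdv_term v' k \<tau> x) \<le>
    1 / \<bar>\<phi>\<bar> * (norm (f t) + norm (f 0) + norm (LINT \<tau>:{0..t}|lborel. phase \<phi> \<tau> * f' \<tau>))"
    using oscillatory_integral_bound[OF prim_f \<phi> t] by (simp only:)
  also have "(LINT \<tau>:{0..t}|lborel. phase \<phi> \<tau> * f' \<tau>) = coeff x * nested t k j + coeff j * nested t k x"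
  proof -
    have eq: "phase \<phi> \<tau> * f' \<tau> = coeff x * (phase \<phi> \<tau> * v \<tau> j * kdv_rhs v x \<tau> - phase \<phi> \<tau> * v' \<tau> j * kdv_rhs v' x \<tau>)
      + coeff j * (phase \<phi> \<tau> * v \<tau> x * kdv_rhs v j \<tau> - phase \<phi> \<tau> * v' \<tau> x * kdv_rhs v' j \<tau>)" for \<tau>
      unfolding f'_def by (simp add: algebra_simps)
    have int: "set_integrable lborel {0..t} (\<lambda>\<tau>. coeff i * (phase \<phi> \<tau> * v \<tau> l * kdv_rhs v i \<tau> - phase \<phi> \<tau> * v' \<tau> l * kdv_rhs v' i \<tau>))" for i l
      by (intro bounded_set_integrable bounded_range_mult bounded_range_diff bounded_range_const bounded_phase
        v.bounded_v v'.bounded_v v.bounded_kdv_rhs v'.bounded_kdv_rhs) measurable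
    have P1: "nested t k x = (LINT \<tau>:{0..t}|lborel. phase \<phi> \<tau> * v \<tau> x * kdv_rhs v j \<tau> - phase \<phi> \<tau> * v' \<tau> x * kdv_rhs v' j \<tau>)"
      unfolding nested_def \<phi>_def j_def ..
    \<comment> \<open>The phase is symmetric in x and j = k - x, so differentiating either mode
      leads to \<open>nested\<close>.\<close>
    have "3 * real_of_int (k * j * (k - j)) = \<phi>" "k - j = x"
      by (simp_all add: \<phi>_def j_def)
    then have P2: "nested t k j = (LINT \<tau>:{0..t}|lborel. phase \<phi> \<tau> * v \<tau> j * kdv_rhs v x \<tau> - phase \<phi> \<tau> * v' \<tau> j * kdv_rhs v' x \<tau>)"
      unfolding nested_def by (simp only:)
    show ?thesis
      unfolding eq P1 P2 by (subst set_integral_add(2)[OF int int]) (simp only: set_integral_mult_right)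
  qed
  finally have le0: "cmod (LINT \<tau>:{0..t}|lborel. kdv_term v k \<tau> x - kdv_term v' k \<tau> x) \<le>
    1 / \<bar>\<phi>\<bar> * (norm (f t) + norm (f 0) + norm (coeff x * nested t k j + coeff j * nested t k x))" .
  have tri: "norm (f t) + norm (f 0) + norm (coeff x * nested t k j + coeff j * nested t k x)
    \<le> norm (f t) + norm (f 0) + (\<bar>real_of_int x\<bar> / 2 * norm (nested t k j) + \<bar>real_of_int j\<bar> / 2 * norm (nested t k x))"
    by (intro add_left_mono norm_triangle_le add_mono) (simp_all only: norm_mult mult_right_mono norm_coeff norm_ge_zero)
  have le: "cmod (LINT \<tau>:{0..t}|lborel. kdv_term v k \<tau> x - kdv_term v' k \<tau> x) \<le>
    1 / \<bar>\<phi>\<bar> * (norm (f t) + norm (f 0) + (\<bar>real_of_int x\<bar> / 2 * norm (nested t k j) + \<bar>real_of_int j\<bar> / 2 * norm (nested t k x)))"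
    by (rule order_trans[OF le0 mult_left_mono[OF tri]]) simp
  let ?X = "\<bar>real_of_int x\<bar>" and ?J = "\<bar>real_of_int j\<bar>" and ?K = "\<bar>real_of_int k\<bar>"
  have pos: "?X > 0" "?J > 0" "?K > 0" using xj k by auto
  have "1/2 * ?K * cmod (LINT \<tau>:{0..t}|lborel. kdv_term v k \<tau> x - kdv_term v' k \<tau> x) \<le>
    1/2 * ?K * (1 / \<bar>\<phi>\<bar> * (norm (f t) + norm (f 0) + (?X / 2 * norm (nested t k j) + ?J / 2 * norm (nested t k x))))"
    using le by (intro mult_left_mono) auto
  also have "\<dots> = 1 / 6 * (1 / ?X * (1 / ?J) * (norm (f t) + norm (f 0)) + 1 / 2 * (1 / ?X * norm (nested t k x) + 1 / ?J * norm (nested t k j)))"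
    unfolding \<phi>_def using pos by (simp add: abs_mult field_simps)
  also have "\<dots> \<le> 1 / ?X * (1 / ?J) * (norm (f t) + norm (f 0)) + 1 / 2 * (1 / ?X * norm (nested t k x) + 1 / ?J * norm (nested t k j))"
    by (rule mult_left_le_one_le) (use pos in auto)
  finally have "ennreal (1/2 * ?K * cmod (LINT \<tau>:{0..t}|lborel. kdv_term v k \<tau> x - kdv_term v' k \<tau> x)) \<le>
    ennreal (1 / ?X * (1 / ?J) * (norm (f t) + norm (f 0)) + 1 / 2 * (1 / ?X * norm (nested t k x) + 1 / ?J * norm (nested t k j)))"
    by (rule ennreal_leI)
  also have "\<dots> = recip x * recip j * (enorm (f t) + enorm (f 0)) + ennreal (1/2) * (recip x * enorm (nested t k x) + recip j * enorm (nested t k j))"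
    unfolding recip_def by (simp only: ennreal_mult ennreal_plus zero_le_divide_1_iff abs_ge_zero norm_ge_zero add_nonneg_nonneg mult_nonneg_nonneg zero_le_numeral)
  also have "\<dots> \<le> recip x * recip j * (pf.d2 t k x + pf.d2 0 k x) + ennreal (1/2) * (nested_recip t k x + nested_recip t k j)"
  proof (intro add_mono mult_left_mono)
    show "enorm (f t) \<le> pf.d2 t k x" "enorm (f 0) \<le> pf.d2 0 k x"
      unfolding f_def j_def by (rule diff2_le)+
    show "recip x * enorm (nested t k x) \<le> nested_recip t k x" "recip j * enorm (nested t k j) \<le> nested_recip t k j"
      using xj by (auto simp: nested_recip_def j_def)
  qed auto
  finally show ?thesis
    unfolding j_def by (simp only: ennreal_mult zero_le_divide_1_iff zero_le_numeral abs_ge_zero norm_ge_zero mult_nonneg_nonneg)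
qed

lemma z_high:
  assumes t: "t \<in> {0..T}" and k: "k \<noteq> 0"
  shows "z t k \<le> z 0 k + (pf.bnd t k + pf.bnd 0 k + time_integral t (\<lambda>\<tau>. pf.rem \<tau> k))"
proof -
  let ?I = "\<lambda>x. LINT \<tau>:{0..t}|lborel. kdv_term v k \<tau> x - kdv_term v' k \<tau> x"
  let ?h = "ennreal (1/2)"
  have half: "?h * (A + A) = A" for A
  proof -
    have "?h * (A + A) = (?h * 2) * A" by (simp only: mult_2[symmetric] mult.assoc)
    also have "?h * 2 = 1" using ennreal_mult[of "1/2" 2, symmetric] by (simp only: ennreal_numeral zero_le_numeral zero_le_divide_1_iff ennreal_1) simp
    finally show ?thesis by simp
  qed
  have "enorm (rhs_diff t k) \<le> (\<Sum>\<^sup>+x. enorm (?I x))"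
    using integral_kdv_rhs_diff_le[of "\<lambda>_. 1" "\<lambda>_. 1" t k] bounded_range_const by (simp add: rhs_diff_def)
  then have "?h * ennreal \<bar>real_of_int k\<bar> * enorm (rhs_diff t k) \<le> ?h * ennreal \<bar>real_of_int k\<bar> * (\<Sum>\<^sup>+x. enorm (?I x))"
    by (rule mult_left_mono) simp
  also have "\<dots> = (\<Sum>\<^sup>+x. ?h * ennreal \<bar>real_of_int k\<bar> * enorm (?I x))" by (simp add: csum_cmult)
  also have "\<dots> \<le> (\<Sum>\<^sup>+x. recip x * recip (k - x) * (pf.d2 t k x + pf.d2 0 k x) + ?h * (nested_recip t k x + nested_recip t k (k - x)))"
    by (intro csum_mono first_step assms)
  \<comment> \<open>The reflection x -> k - x identifies the two nested sums, and their coincidence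
    absorbs the factor 1/2.\<close>
  also have "\<dots> = (\<Sum>\<^sup>+x. recip x * recip (k - x) * pf.d2 t k x) + (\<Sum>\<^sup>+x. recip x * recip (k - x) * pf.d2 0 k x) + csum (nested_recip t k)"
    by (simp only: csum_add distrib_left csum_cmult csum_reflect half[unfolded distrib_left])
  finally have main: "?h * ennreal \<bar>real_of_int k\<bar> * enorm (rhs_diff t k) \<le>
    (\<Sum>\<^sup>+x. recip x * recip (k - x) * pf.d2 t k x) + (\<Sum>\<^sup>+x. recip x * recip (k - x) * pf.d2 0 k x) + csum (nested_recip t k)" .
  have "csum (nested_recip t k) \<le> (\<Sum>\<^sup>+x. \<Sum>\<^sup>+y. recip x * (if x + y = 0 \<or> k = y then time_integral t (\<lambda>\<tau>. pf.d3 \<tau> k x y) else 0)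
    + ker4 k x y * (pf.d3 t k x y + pf.d3 0 k x y + time_integral t (\<lambda>\<tau>. pf.d4 \<tau> k x y)))"
    by (intro csum_mono nested_recip_le assms)
  also have "\<dots> = (\<Sum>\<^sup>+x. \<Sum>\<^sup>+y. recip x * (if x + y = 0 \<or> k = y then time_integral t (\<lambda>\<tau>. pf.d3 \<tau> k x y) else 0))
    + ((\<Sum>\<^sup>+x. \<Sum>\<^sup>+y. ker4 k x y * pf.d3 t k x y) + (\<Sum>\<^sup>+x. \<Sum>\<^sup>+y. ker4 k x y * pf.d3 0 k x y)
    + (\<Sum>\<^sup>+x. \<Sum>\<^sup>+y. ker4 k x y * time_integral t (\<lambda>\<tau>. pf.d4 \<tau> k x y)))"
    by (simp add: csum_add distrib_left)
  also have "(\<Sum>\<^sup>+x. \<Sum>\<^sup>+y. recip x * (if x + y = 0 \<or> k = y then time_integral t (\<lambda>\<tau>. pf.d3 \<tau> k x y) else 0))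
    = time_integral t (\<lambda>\<tau>. pf.res \<tau> k)"
  proof -
    have "recip x * (if x + y = 0 \<or> k = y then time_integral t (\<lambda>\<tau>. pf.d3 \<tau> k x y) else 0)
      = time_integral t (\<lambda>\<tau>. recip x * (if x + y = 0 \<or> k = y then pf.d3 \<tau> k x y else 0))" for x y
      by (auto simp: nn_integral_cmult mult.assoc)
    then show ?thesis
      unfolding pf.res_def by (simp only:) (simp add: time_integral_csum)
  qed
  also have "(\<Sum>\<^sup>+x. \<Sum>\<^sup>+y. ker4 k x y * time_integral t (\<lambda>\<tau>. pf.d4 \<tau> k x y))
    = time_integral t (\<lambda>\<tau>. \<Sum>\<^sup>+x. \<Sum>\<^sup>+y. ker4 k x y * pf.d4 \<tau> k x y)"
  proof -
    have "ker4 k x y * time_integral t (\<lambda>\<tau>. pf.d4 \<tau> k x y)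
      = time_integral t (\<lambda>\<tau>. ker4 k x y * pf.d4 \<tau> k x y)" for x y
      by (simp add: nn_integral_cmult mult.assoc)
    then show ?thesis by (simp only:) (simp add: time_integral_csum)
  qed
  finally have "?h * ennreal \<bar>real_of_int k\<bar> * enorm (rhs_diff t k) \<le>
    (\<Sum>\<^sup>+x. recip x * recip (k - x) * pf.d2 t k x) + (\<Sum>\<^sup>+x. recip x * recip (k - x) * pf.d2 0 k x) +
    (time_integral t (\<lambda>\<tau>. pf.res \<tau> k) + ((\<Sum>\<^sup>+x. \<Sum>\<^sup>+y. ker4 k x y * pf.d3 t k x y) + (\<Sum>\<^sup>+x. \<Sum>\<^sup>+y. ker4 k x y * pf.d3 0 k x y)
    + time_integral t (\<lambda>\<tau>. \<Sum>\<^sup>+x. \<Sum>\<^sup>+y. ker4 k x y * pf.d4 \<tau> k x y)))"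
    by (rule order_trans[OF main add_left_mono])
  also have "\<dots> = pf.bnd t k + pf.bnd 0 k +
    (time_integral t (\<lambda>\<tau>. pf.res \<tau> k) + time_integral t (\<lambda>\<tau>. \<Sum>\<^sup>+x. \<Sum>\<^sup>+y. ker4 k x y * pf.d4 \<tau> k x y))"
    unfolding pf.bnd_def by (simp only: add_ac)
  also have "time_integral t (\<lambda>\<tau>. pf.res \<tau> k) + time_integral t (\<lambda>\<tau>. \<Sum>\<^sup>+x. \<Sum>\<^sup>+y. ker4 k x y * pf.d4 \<tau> k x y)
    = time_integral t (\<lambda>\<tau>. pf.rem \<tau> k)"
    unfolding pf.rem_def distrib_right by (subst nn_integral_add) (auto simp: pf.res_def)
  finally show ?thesis
    using z_le_rhs_diff[OF t, of k] by (meson add_left_mono order_trans)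
qed

end

section \<open>Stability\<close>

text \<open>Inserting the bound (2A + K/2^n) exp(2bt) into the inequality reproduces it with n + 1,
  because b times the integral of exp(2bt) is at most exp(2bt)/2. The a priori bound K thus
  disappears in the limit, at the price of the doubled rate 2b and the doubled constant 2A.\<close>

lemma gronwall_ennreal:
  fixes Y :: "real \<Rightarrow> ennreal"
  assumes "0 \<le> A" "0 < b" "0 \<le> K"
    and bdd: "\<And>t. t \<in> {0..T} \<Longrightarrow> Y t \<le> ennreal K"
    and ineq: "\<And>t. t \<in> {0..T} \<Longrightarrow> Y t \<le> ennreal A + ennreal b * time_integral t Y"
    and t: "t \<in> {0..T}"
  shows "Y t \<le> ennreal (2 * A * exp (2 * b * t))"
proof -
  have iter: "Y t \<le> ennreal ((2 * A + K / 2 ^ n) * exp (2 * b * t))" if "t \<in> {0..T}" for t n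
    using that
  proof (induction n arbitrary: t)
    case 0
    have "1 \<le> exp (2 * b * t)" using 0 assms by simp
    then have "(2 * A + K) * 1 \<le> (2 * A + K) * exp (2 * b * t)"
      using assms by (intro mult_left_mono) auto
    moreover have "K \<le> (2 * A + K) * 1" using assms(1) by simp
    ultimately have "K \<le> (2 * A + K) * exp (2 * b * t)" by (rule order_trans[rotated])
    then show ?case using bdd[OF 0] by (simp add: order_trans ennreal_leI)
  next
    case (Suc n)
    define D where "D = 2 * A + K / 2 ^ n"
    have D: "0 \<le> D" using assms by (simp add: D_def)
    have e1: "1 \<le> exp (2 * b * t)" using Suc.prems assms by simp
    have "time_integral t Y \<le> (\<integral>\<^sup>+\<tau>. ennreal (D * exp (2 * b * \<tau>)) * indicator {0..t} \<tau> \<partial>lborel)"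
      using Suc by (intro nn_integral_mono) (auto simp: indicator_def D_def)
    also have "\<dots> = ennreal (D / (2 * b) * exp (2 * b * t) - D / (2 * b) * exp (2 * b * 0))"
    proof (rule nn_integral_FTC_Icc)
      show "((\<lambda>t. D / (2 * b) * exp (2 * b * t)) has_real_derivative D * exp (2 * b * x)) (at x)" for x
        using assms(2) by (auto intro!: derivative_eq_intros)
    qed (use Suc.prems D in auto)
    finally have "Y t \<le> ennreal A + ennreal b * ennreal (D / (2 * b) * exp (2 * b * t) - D / (2 * b) * exp (2 * b * 0))"
      using ineq[OF Suc.prems] by (meson add_left_mono mult_left_mono order_trans zero_le)
    also have "\<dots> = ennreal (A + b * (D / (2 * b) * exp (2 * b * t) - D / (2 * b) * exp (2 * b * 0)))"
    proof -
      have "D / (2 * b) * 1 \<le> D / (2 * b) * exp (2 * b * t)"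
        using e1 D assms by (intro mult_left_mono) auto
      then have "0 \<le> D / (2 * b) * exp (2 * b * t) - D / (2 * b) * exp (2 * b * 0)" by simp
      then show ?thesis using assms by (simp only: ennreal_mult ennreal_plus mult_nonneg_nonneg less_imp_le)
    qed
    also have "\<dots> \<le> ennreal ((2 * A + K / 2 ^ Suc n) * exp (2 * b * t))"
    proof (rule ennreal_leI)
      have "A + b * (D / (2 * b) * exp (2 * b * t) - D / (2 * b) * exp (2 * b * 0)) = A + D / 2 * exp (2 * b * t) - D / 2"
        using assms(2) by (simp add: field_simps)
      also have "\<dots> \<le> A * exp (2 * b * t) + D / 2 * exp (2 * b * t)"
        using mult_left_mono[OF e1 assms(1)] D by simp
      also have "\<dots> = (2 * A + K / 2 ^ Suc n) * exp (2 * b * t)"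
        by (simp add: D_def field_simps)
      finally show "A + b * (D / (2 * b) * exp (2 * b * t) - D / (2 * b) * exp (2 * b * 0)) \<le> (2 * A + K / 2 ^ Suc n) * exp (2 * b * t)" .
    qed
    finally show ?case .
  qed
  have "(\<lambda>n. K / 2 ^ n) \<longlonglongrightarrow> 0"
    using tendsto_mult[OF tendsto_const[of K] LIMSEQ_realpow_zero[of "1/2"]] by (simp add: power_divide)
  then have "(\<lambda>n. ennreal ((2 * A + K / 2 ^ n) * exp (2 * b * t))) \<longlonglongrightarrow> ennreal ((2 * A + 0) * exp (2 * b * t))"
    by (intro tendsto_ennrealI tendsto_intros)
  then have "Y t \<le> ennreal ((2 * A + 0) * exp (2 * b * t))"
    by (rule Lim_bounded2) (use iter[OF t] in blast)
  then show ?thesis by simp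
qed

lemma time_integral_cmult:
  "F \<in> borel_measurable borel \<Longrightarrow> time_integral t (\<lambda>\<tau>. C * F \<tau>) = C * time_integral t F"
  by (simp add: nn_integral_cmult mult.assoc)

lemma time_integral_Cauchy_Schwarz:
  assumes [measurable]: "g \<in> borel_measurable borel" and "0 \<le> t"
  shows "(time_integral t g)\<^sup>2 \<le> ennreal t * time_integral t (\<lambda>\<tau>. (g \<tau>)\<^sup>2)"
proof -
  have "time_integral t g = (\<integral>\<^sup>+\<tau>. (g \<tau> * indicator {0..t} \<tau>) * indicator {0..t} \<tau> \<partial>lborel)"
    by (intro nn_integral_cong) (auto simp: indicator_def)
  then have "(time_integral t g)\<^sup>2 \<le> (\<integral>\<^sup>+\<tau>. (g \<tau> * indicator {0..t} \<tau>)\<^sup>2 \<partial>lborel) * (\<integral>\<^sup>+\<tau>. (indicator {0..t} \<tau>)\<^sup>2 \<partial>lborel)"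
    by (simp only:) (rule Cauchy_Schwarz_nn_integral; measurable)
  also have "(\<integral>\<^sup>+\<tau>. (g \<tau> * indicator {0..t} \<tau>)\<^sup>2 \<partial>lborel) = time_integral t (\<lambda>\<tau>. (g \<tau>)\<^sup>2)"
    by (intro nn_integral_cong) (auto simp: indicator_def)
  also have "(\<integral>\<^sup>+\<tau>. (indicator {0..t} \<tau>)\<^sup>2 \<partial>lborel) = (\<integral>\<^sup>+\<tau>. indicator {0..t} \<tau> \<partial>lborel)"
    by (intro nn_integral_cong) (auto simp: indicator_def)
  also have "\<dots> = ennreal t" using assms(2) by simp
  finally show ?thesis by (simp add: mult.commute)
qed

lemma sqsum_time_integral:
  fixes g :: "real \<Rightarrow> int \<Rightarrow> ennreal"
  assumes [measurable]: "\<And>k. (\<lambda>\<tau>. g \<tau> k) \<in> borel_measurable borel" and "0 \<le> t"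
  shows "sqsum (\<lambda>k. time_integral t (\<lambda>\<tau>. g \<tau> k)) \<le> ennreal t * time_integral t (\<lambda>\<tau>. sqsum (g \<tau>))"
proof -
  have "sqsum (\<lambda>k. time_integral t (\<lambda>\<tau>. g \<tau> k)) \<le> (\<Sum>\<^sup>+k. ennreal t * time_integral t (\<lambda>\<tau>. (g \<tau> k)\<^sup>2))"
    unfolding sqsum_def by (intro csum_mono time_integral_Cauchy_Schwarz assms)
  also have "\<dots> = ennreal t * time_integral t (\<lambda>\<tau>. sqsum (g \<tau>))"
    by (simp add: csum_cmult time_integral_csum sqsum_def)
  finally show ?thesis .
qed

text \<open>The nonlinearity is bounded but not square summable in k; at low frequencies this costs
  the number 2N + 1 of modes.\<close>

lemma sqsum_low_modes:
  fixes f :: "int \<Rightarrow> ennreal"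
  assumes "\<And>k. (f k)\<^sup>2 \<le> B"
  shows "sqsum (\<lambda>k. if \<bar>k\<bar> \<le> int N then ennreal (real N) * f k else 0) \<le> ennreal (real (2 * N + 1) * (real N)\<^sup>2) * B"
proof -
  have "sqsum (\<lambda>k. if \<bar>k\<bar> \<le> int N then ennreal (real N) * f k else 0)
    \<le> (\<Sum>\<^sup>+k. (ennreal (real N))\<^sup>2 * B * indicator {- int N..int N} k)"
    unfolding sqsum_def
  proof (intro csum_mono)
    fix k
    show "(if \<bar>k\<bar> \<le> int N then ennreal (real N) * f k else 0)\<^sup>2 \<le> (ennreal (real N))\<^sup>2 * B * indicator {- int N..int N} k"
      using assms[of k] by (auto simp: indicator_def power_mult_distrib intro!: mult_left_mono)
  qed
  also have "\<dots> = (ennreal (real N))\<^sup>2 * B * of_nat (2 * N + 1)"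
    by (subst nn_integral_cmult_indicator) (auto simp: emeasure_count_space nat_add_distrib nat_mult_distrib)
  also have "\<dots> = ennreal (real (2 * N + 1) * (real N)\<^sup>2) * B"
    by (subst ennreal_mult) (auto simp only: ennreal_power ennreal_of_nat_eq_real_of_nat mult_ac of_nat_0_le_iff zero_le_power2)
  finally show ?thesis .
qed

section \<open>Explicit constants of the stability estimate\<close>

definition recip_const :: real where "recip_const = enn2real recip_sqsum"

lemma recip_const: "recip_sqsum = ennreal recip_const" "0 \<le> recip_const"
  using recip_sqsum_finite by (simp_all add: recip_const_def)

definition bnd_const :: "real \<Rightarrow> real"
  where "bnd_const L = 4 * (64 * recip_const * L + 288 * recip_const ^ 3 * L\<^sup>2)"
definition rem_const :: "real \<Rightarrow> real"
  where "rem_const L = 8 * (160 * L\<^sup>2 + 5 * (1152 * recip_const ^ 3 * L ^ 3))"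
text \<open>With N this large, 8 \<open>bnd_const L\<close> / N^2 is at most 1/2, so the boundary
  term at the final time can be absorbed into the left-hand side. The summand 1 keeps N
  positive.\<close>

definition cut_off :: "real \<Rightarrow> nat"
  where "cut_off L = nat \<lceil>16 * bnd_const L\<rceil> + 1"
definition rate_const :: "real \<Rightarrow> real"
  where "rate_const L = 2 * (real (2 * cut_off L + 1) * (real (cut_off L))\<^sup>2 * (16 * L) + rem_const L)"
text \<open>Absorption turns the initial data into 9 times their square norm, which the Gronwall
  bound doubles to 18. In the rate, 8 T comes from the factor 4 of \<open>sqsum_add3\<close>, from
  the doubling by absorption and from Cauchy-Schwarz in time.\<close>

definition growth_const :: "real \<Rightarrow> real \<Rightarrow> real"
  where "growth_const L T = 18 * exp (2 * (8 * T * rate_const L + 1) * T)"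

lemma ennreal_real_ops:
  "0 \<le> x \<Longrightarrow> 0 \<le> y \<Longrightarrow> ennreal x * ennreal y = ennreal (x * y)"
  "0 \<le> x \<Longrightarrow> 0 \<le> y \<Longrightarrow> ennreal x + ennreal y = ennreal (x + y)"
  "0 \<le> x \<Longrightarrow> ennreal x ^ n = ennreal (x ^ n)"
  "numeral m * ennreal x = ennreal (numeral m * x)"
  by (simp_all add: ennreal_mult ennreal_power ennreal_mult'[of "numeral m"])

lemma (in tame_pair) real_bounds:
  assumes "L = ennreal l" "0 \<le> l"
  shows "sqsum bnd' \<le> ennreal (bnd_const l) * Y" "sqsum (\<lambda>k. w k * rem k) \<le> ennreal (rem_const l) * Y"
proof -
  have n: "0 \<le> recip_const" by (rule recip_const)
  have "4 * (64 * S * L + 288 * S ^ 3 * L\<^sup>2) = ennreal (bnd_const l)"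
    unfolding assms(1) recip_const(1) bnd_const_def using n assms(2)
    by (simp only: ennreal_real_ops mult_nonneg_nonneg add_nonneg_nonneg zero_le_power zero_le_numeral)
  then show "sqsum bnd' \<le> ennreal (bnd_const l) * Y" using bnd'_sq by simp
  have "8 * (160 * L\<^sup>2 + 5 * G) = ennreal (rem_const l)"
    unfolding G_def unfolding assms(1) recip_const(1) rem_const_def using n assms(2)
    by (simp only: ennreal_real_ops mult_nonneg_nonneg add_nonneg_nonneg zero_le_power zero_le_numeral)
  then show "sqsum (\<lambda>k. w k * rem k) \<le> ennreal (rem_const l) * Y" using rem_sq by simp
qed

context solution_pair
begin

lemma rem_measurable [measurable]: "(\<lambda>\<tau>. pf.rem \<tau> k) \<in> borel_measurable borel"
  unfolding pf.rem_def pf.res_def by measurable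

text \<open>The bound K makes the weighted norm finite, so that half of it can be subtracted and the
  Gronwall iteration can start; the constant does not contain K. Finiteness known only qualitatively
  therefore turns into a bound by the initial data.\<close>

lemma difference_estimate:
  fixes w :: "int \<Rightarrow> ennreal" and L K :: real
  assumes w_sub: "\<And>a b. w (a + b) \<le> w a + w b"
    and LK: "0 \<le> L" "0 \<le> K"
    and u_bd: "\<And>\<tau>. \<tau> \<in> {0..T} \<Longrightarrow> sqsum (u \<tau>) \<le> ennreal L"
    and cross: "\<And>\<tau>. \<tau> \<in> {0..T} \<Longrightarrow>
      sqsum (z \<tau>) * sqsum (\<lambda>k. w k * u \<tau> k) \<le> ennreal L * sqsum (\<lambda>k. w k * z \<tau> k)"
    and fin: "\<And>\<tau>. \<tau> \<in> {0..T} \<Longrightarrow> sqsum (\<lambda>k. w k * z \<tau> k) \<le> ennreal K"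
    and t: "t \<in> {0..T}"
  shows "sqsum (\<lambda>k. w k * z t k) \<le> ennreal (growth_const L T) * sqsum (\<lambda>k. w k * z 0 k)"
proof -
  define Y where "Y \<tau> = sqsum (\<lambda>k. w k * z \<tau> k)" for \<tau>
  define N where "N = cut_off L"
  have T: "0 \<le> T" and zero: "0 \<in> {0..T}" using t by auto
  have tp: "tame_pair (z \<tau>) (u \<tau>) w (ennreal L)" if "\<tau> \<in> {0..T}" for \<tau>
    by (unfold_locales) (use w_sub u_bd[OF that] cross[OF that] in auto)
  have cb: "0 \<le> bnd_const L" and cr: "0 \<le> rem_const L" and cg: "0 \<le> rate_const L"
    using LK recip_const(2) by (auto simp: bnd_const_def rem_const_def rate_const_def)
  have N: "1 \<le> real N" "16 * bnd_const L \<le> (real N)\<^sup>2"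
  proof -
    show 1: "1 \<le> real N" by (simp add: N_def cut_off_def)
    have "16 * bnd_const L \<le> real N" unfolding N_def cut_off_def by linarith
    also have "\<dots> \<le> (real N)\<^sup>2" using 1 by (simp add: power2_eq_square mult_le_cancel_left1)
    finally show "16 * bnd_const L \<le> (real N)\<^sup>2" .
  qed
  \<comment> \<open>For |k| \<le> N the derivative costs at most N. Adding the remainder of the high
    modes gives one integrand g that serves all k at once.\<close>
  define low where "low \<tau> k = (if \<bar>k\<bar> \<le> int N then ennreal (real N) * (w k * pf.Zc \<tau> k) else 0)" for \<tau> k
  define g where "g \<tau> k = low \<tau> k + w k * pf.rem \<tau> k" for \<tau> k
  define b' where "b' \<tau> = tame_pair.bnd' (z \<tau>) (u \<tau>) w" for \<tau>
  have [measurable]: "(\<lambda>\<tau>. g \<tau> k) \<in> borel_measurable borel" for k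
    unfolding g_def low_def by measurable
  have bb: "sqsum (b' \<tau>) \<le> ennreal (bnd_const L) * Y \<tau>" if "\<tau> \<in> {0..T}" for \<tau>
    unfolding b'_def Y_def by (rule tame_pair.real_bounds(1)[OF tp[OF that] refl LK(1)])
  have gg: "sqsum (g \<tau>) \<le> ennreal (rate_const L) * Y \<tau>" if "\<tau> \<in> {0..T}" for \<tau>
  proof -
    have lowb: "sqsum (low \<tau>) \<le> ennreal (real (2 * N + 1) * (real N)\<^sup>2) * (16 * ennreal L * Y \<tau>)"
      unfolding low_def Y_def
      by (rule sqsum_low_modes) (rule tame_pair.Zc_weight_sq[OF tp[OF that]])
    have "sqsum (g \<tau>) \<le> 2 * (sqsum (low \<tau>) + sqsum (\<lambda>k. w k * pf.rem \<tau> k))"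
      unfolding g_def[abs_def] by (rule sqsum_add2)
    also have "\<dots> \<le> 2 * (ennreal (real (2 * N + 1) * (real N)\<^sup>2) * (16 * ennreal L * Y \<tau>) + ennreal (rem_const L) * Y \<tau>)"
      unfolding Y_def
      by (intro mult_left_mono add_mono tame_pair.real_bounds(2)[OF tp[OF that] refl LK(1)] lowb[unfolded Y_def]) auto
    also have "\<dots> = (2 * (ennreal (real (2 * N + 1) * (real N)\<^sup>2) * (16 * ennreal L) + ennreal (rem_const L))) * Y \<tau>"
      by (simp only: distrib_right distrib_left mult.assoc)
    also have "2 * (ennreal (real (2 * N + 1) * (real N)\<^sup>2) * (16 * ennreal L) + ennreal (rem_const L)) = ennreal (rate_const L)"
      unfolding rate_const_def N_def[symmetric] using LK cr
      by (simp only: ennreal_real_ops of_nat_0_le_iff zero_le_power2 mult_nonneg_nonneg zero_le_numeral add_nonneg_nonneg)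
    finally show ?thesis .
  qed
  have pt: "w k * z t k \<le> w k * z 0 k + ennreal (1 / real N) * (b' t k + b' 0 k) + time_integral t (\<lambda>\<tau>. g \<tau> k)"
    if t: "t \<in> {0..T}" for k t
  proof (cases "\<bar>k\<bar> \<le> int N")
    case True
    have "w k * z t k \<le> w k * (z 0 k + ennreal \<bar>real_of_int k\<bar> * time_integral t (\<lambda>\<tau>. pf.Zc \<tau> k))"
      by (intro mult_left_mono z_low t) auto
    also have "\<dots> \<le> w k * (z 0 k + ennreal (real N) * time_integral t (\<lambda>\<tau>. pf.Zc \<tau> k))"
      by (intro mult_left_mono add_left_mono mult_right_mono ennreal_leI) (use True in auto)
    also have "\<dots> = w k * z 0 k + time_integral t (\<lambda>\<tau>. ennreal (real N) * (w k * pf.Zc \<tau> k))"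
    proof -
      have "time_integral t (\<lambda>\<tau>. ennreal (real N) * (w k * pf.Zc \<tau> k)) = ennreal (real N) * (w k * time_integral t (\<lambda>\<tau>. pf.Zc \<tau> k))"
      proof -
        have m: "(\<lambda>\<tau>. w k * pf.Zc \<tau> k) \<in> borel_measurable borel" by measurable
        show ?thesis by (simp only: time_integral_cmult[OF m] time_integral_cmult[OF Zc_measurable])
      qed
      then show ?thesis by (simp only: distrib_left mult.left_commute)
    qed
    also have "\<dots> \<le> w k * z 0 k + time_integral t (\<lambda>\<tau>. g \<tau> k)"
      using True by (intro add_left_mono nn_integral_mono mult_right_mono) (auto simp: g_def low_def)
    also have "\<dots> \<le> w k * z 0 k + ennreal (1 / real N) * (b' t k + b' 0 k) + time_integral t (\<lambda>\<tau>. g \<tau> k)"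
      by (intro add_right_mono) simp
    finally show ?thesis .
  next
    case False
    then have k: "k \<noteq> 0" and Nk: "real N \<le> \<bar>real_of_int k\<bar>" by auto
    have rk: "recip k \<le> ennreal (1 / real N)"
      unfolding recip_def using Nk N(1) by (intro ennreal_leI frac_le) auto
    have bn: "w k * pf.bnd \<tau> k \<le> ennreal (1 / real N) * b' \<tau> k" if "\<tau> \<in> {0..T}" for \<tau>
    proof -
      have "w k * pf.bnd \<tau> k \<le> recip k * b' \<tau> k"
        unfolding b'_def by (rule tame_pair.bnd_le[OF tp[OF that] k])
      also have "\<dots> \<le> ennreal (1 / real N) * b' \<tau> k" by (intro mult_right_mono rk) auto
      finally show ?thesis .
    qed
    have "w k * z t k \<le> w k * (z 0 k + (pf.bnd t k + pf.bnd 0 k + time_integral t (\<lambda>\<tau>. pf.rem \<tau> k)))"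
      by (intro mult_left_mono z_high t k) auto
    also have "\<dots> = w k * z 0 k + (w k * pf.bnd t k + w k * pf.bnd 0 k) + time_integral t (\<lambda>\<tau>. w k * pf.rem \<tau> k)"
      by (simp only: time_integral_cmult rem_measurable distrib_left add.assoc)
    also have "\<dots> \<le> w k * z 0 k + (ennreal (1 / real N) * b' t k + ennreal (1 / real N) * b' 0 k) + time_integral t (\<lambda>\<tau>. g \<tau> k)"
      by (intro add_mono bn t zero nn_integral_mono mult_right_mono order_refl) (auto simp: g_def)
    finally show ?thesis by (simp only: distrib_left)
  qed
  define A where "A = 9 * enn2real (Y 0)"
  have Yfin: "Y \<tau> = ennreal (enn2real (Y \<tau>))" if "\<tau> \<in> {0..T}" for \<tau>
    using fin[OF that] unfolding Y_def by (metis ennreal_enn2real ennreal_less_top order_le_less_trans)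
  have ineq: "Y t \<le> ennreal A + ennreal (8 * T * rate_const L + 1) * time_integral t Y" if t: "t \<in> {0..T}" for t
  proof -
    define I where "I = time_integral t Y"
    have "Y t \<le> sqsum (\<lambda>k. w k * z 0 k + ennreal (1 / real N) * (b' t k + b' 0 k) + time_integral t (\<lambda>\<tau>. g \<tau> k))"
      unfolding Y_def by (intro sqsum_mono pt t)
    also have "\<dots> \<le> 4 * (sqsum (\<lambda>k. w k * z 0 k) + sqsum (\<lambda>k. ennreal (1 / real N) * (b' t k + b' 0 k))
        + sqsum (\<lambda>k. time_integral t (\<lambda>\<tau>. g \<tau> k)))"
      by (rule sqsum_add3)
    also have "\<dots> \<le> 4 * (Y 0 + (ennreal (1 / real N))\<^sup>2 * (2 * (ennreal (bnd_const L) * Y t + ennreal (bnd_const L) * Y 0))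
        + ennreal (T * rate_const L) * I)"
    proof (intro mult_left_mono add_mono)
      show "sqsum (\<lambda>k. w k * z 0 k) \<le> Y 0" by (simp add: Y_def)
      have "sqsum (\<lambda>k. b' t k + b' 0 k) \<le> 2 * (sqsum (b' t) + sqsum (b' 0))" by (rule sqsum_add2)
      also have "\<dots> \<le> 2 * (ennreal (bnd_const L) * Y t + ennreal (bnd_const L) * Y 0)"
        by (intro mult_left_mono add_mono bb t zero) auto
      finally show "sqsum (\<lambda>k. ennreal (1 / real N) * (b' t k + b' 0 k)) \<le>
        (ennreal (1 / real N))\<^sup>2 * (2 * (ennreal (bnd_const L) * Y t + ennreal (bnd_const L) * Y 0))"
        unfolding sqsum_cmult by (rule mult_left_mono) simp
      have "sqsum (\<lambda>k. time_integral t (\<lambda>\<tau>. g \<tau> k)) \<le> ennreal t * time_integral t (\<lambda>\<tau>. sqsum (g \<tau>))"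
        using t by (intro sqsum_time_integral) auto
      also have "time_integral t (\<lambda>\<tau>. sqsum (g \<tau>)) \<le> time_integral t (\<lambda>\<tau>. ennreal (rate_const L) * Y \<tau>)"
        using t by (intro nn_integral_mono) (auto simp: indicator_def intro!: gg)
      also have "\<dots> = ennreal (rate_const L) * I"
        unfolding I_def mult.assoc by (rule nn_integral_cmult) (simp add: Y_def sqsum_def)
      also have "ennreal t * (ennreal (rate_const L) * I) \<le> ennreal T * (ennreal (rate_const L) * I)"
        using t by (intro mult_right_mono ennreal_leI) auto
      finally show "sqsum (\<lambda>k. time_integral t (\<lambda>\<tau>. g \<tau> k)) \<le> ennreal (T * rate_const L) * I"
        using T cg by (simp add: ennreal_mult mult.assoc mult_left_mono)
    qed auto
    finally have le: "Y t \<le> 4 * (Y 0 + (ennreal (1 / real N))\<^sup>2 * (2 * (ennreal (bnd_const L) * Y t + ennreal (bnd_const L) * Y 0))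
        + ennreal (T * rate_const L) * I)" .
    show ?thesis
    proof (cases "I = top")
      case True
      \<comment> \<open>With an infinite integral the right-hand side is \<open>top\<close>, because
        the summand 1 makes its coefficient positive.\<close>
      then show ?thesis using T cg by (simp add: I_def[symmetric] ennreal_mult_top add_nonneg_pos)
    next
      case False
      then obtain i where i: "I = ennreal i" "0 \<le> i" by (metis ennreal_cases)
      define y where "y = enn2real (Y t)"
      define y0 where "y0 = enn2real (Y 0)"
      have y: "Y t = ennreal y" "Y 0 = ennreal y0" "0 \<le> y" "0 \<le> y0"
        using Yfin[OF t] Yfin[OF zero] by (simp_all add: y_def y0_def)
      have N0: "0 \<le> 1 / real N" by simp
      have "ennreal y \<le> ennreal (4 * (y0 + (1 / real N)\<^sup>2 * (2 * (bnd_const L * y + bnd_const L * y0)) + T * rate_const L * i))"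
        using le unfolding y(1,2) i(1) using y(3,4) i(2) cb T cg N0
        by (simp only: ennreal_real_ops mult_nonneg_nonneg add_nonneg_nonneg zero_le_power2 zero_le_numeral)
      then have le': "y \<le> 4 * (y0 + (1 / real N)\<^sup>2 * (2 * (bnd_const L * y + bnd_const L * y0)) + T * rate_const L * i)"
        using y i cb T cg by (subst (asm) ennreal_le_iff) auto
      have "(1 / real N)\<^sup>2 * (16 * bnd_const L) \<le> 1"
        using N by (simp add: power_divide divide_le_eq)
      then have "((1 / real N)\<^sup>2 * (16 * bnd_const L)) * (y + y0) \<le> 1 * (y + y0)"
        using y by (intro mult_right_mono) auto
      then have "4 * ((1 / real N)\<^sup>2 * (2 * (bnd_const L * y + bnd_const L * y0))) \<le> (y + y0) / 2"
        by (simp add: algebra_simps)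
      then have "y \<le> 4 * y0 + (y + y0) / 2 + 4 * (T * rate_const L * i)" using le' by argo
      \<comment> \<open>The absorption: half of y moves to the left. The added i pays for the
        summand 1 in the rate.\<close>
      then have "y \<le> 9 * y0 + 8 * (T * rate_const L * i) + i" using i(2) by argo
      also have "\<dots> = A + (8 * T * rate_const L + 1) * i"
        by (simp add: A_def y0_def algebra_simps)
      finally have "ennreal y \<le> ennreal (A + (8 * T * rate_const L + 1) * i)" by (rule ennreal_leI)
      also have "\<dots> = ennreal A + ennreal (8 * T * rate_const L + 1) * ennreal i"
        using i(2) T cg by (simp add: A_def ennreal_mult)
      finally show ?thesis unfolding y(1) i(1)[symmetric] I_def .
    qed
  qed
  have "Y t \<le> ennreal (2 * A * exp (2 * (8 * T * rate_const L + 1) * t))"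
  proof (rule gronwall_ennreal[OF _ _ LK(2) _ ineq t])
    show "0 \<le> A" by (simp add: A_def)
    show "0 < 8 * T * rate_const L + 1" using T cg by (simp add: add_nonneg_pos)
  qed (auto simp: Y_def fin)
  also have "\<dots> \<le> ennreal (growth_const L T * enn2real (Y 0))"
  proof (rule ennreal_leI)
    have "exp (2 * (8 * T * rate_const L + 1) * t) \<le> exp (2 * (8 * T * rate_const L + 1) * T)"
      using t T cg by (simp add: mult_left_mono)
    then have "2 * A * exp (2 * (8 * T * rate_const L + 1) * t) \<le> 2 * A * exp (2 * (8 * T * rate_const L + 1) * T)"
      by (intro mult_left_mono) (auto simp: A_def)
    then show "2 * A * exp (2 * (8 * T * rate_const L + 1) * t) \<le> growth_const L T * enn2real (Y 0)"
      by (simp add: growth_const_def A_def mult_ac)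
  qed
  also have "\<dots> = ennreal (growth_const L T) * Y 0"
    by (subst (2) Yfin[OF zero]) (simp add: ennreal_mult growth_const_def)
  finally show ?thesis by (simp only: Y_def)
qed

end

section \<open>Sobolev weights and norms\<close>

definition wt :: "real \<Rightarrow> int \<Rightarrow> ennreal"
  where "wt s k = ennreal (\<bar>real_of_int k\<bar> powr s)"

text \<open>The squared norm, with the value \<open>top\<close> off the space.
  \<open>hs_norm\<close> is 0 there, so estimates are proved for \<open>hsq\<close> and transferred
  only where it is finite.\<close>

definition hsq :: "real \<Rightarrow> (int \<Rightarrow> complex) \<Rightarrow> ennreal"
  where "hsq s v = sqsum (\<lambda>k. wt s k * enorm (v k))"

text \<open>For s \<le> 1 the function r powr (s - 1) is decreasing, so each summand of x + y
  prefers its own base.\<close>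

lemma powr_subadditive:
  fixes x y s :: real
  assumes "0 < x" "0 < y" "s \<le> 1"
  shows "(x + y) powr s \<le> x powr s + y powr s"
proof -
  have "(x + y) powr s = (x + y) powr (s - 1) * (x + y)"
    using assms powr_mult_base[of "x + y" "s - 1"] by (simp add: mult.commute)
  also have "\<dots> = x * (x + y) powr (s - 1) + y * (x + y) powr (s - 1)" by (simp add: algebra_simps)
  also have "\<dots> \<le> x * x powr (s - 1) + y * y powr (s - 1)"
    using assms by (intro add_mono mult_left_mono powr_mono2') auto
  also have "\<dots> = x powr s + y powr s"
    using assms powr_mult_base[of x "s - 1"] powr_mult_base[of y "s - 1"] by simp
  finally show ?thesis .
qed

lemma wt_subadditive:
  assumes "0 \<le> s" "s \<le> 1"
  shows "wt s (a + b) \<le> wt s a + wt s b"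
proof -
  let ?a = "\<bar>real_of_int a\<bar>" and ?b = "\<bar>real_of_int b\<bar>"
  have "\<bar>real_of_int (a + b)\<bar> powr s \<le> ?a powr s + ?b powr s"
  proof (cases "a = 0 \<or> b = 0")
    case False
    have "\<bar>real_of_int (a + b)\<bar> powr s \<le> (?a + ?b) powr s"
      using assms by (intro powr_mono2) auto
    also have "\<dots> \<le> ?a powr s + ?b powr s"
      using False assms by (intro powr_subadditive) auto
    finally show ?thesis .
  qed auto
  then have "ennreal (\<bar>real_of_int (a + b)\<bar> powr s) \<le> ennreal (?a powr s + ?b powr s)" by (rule ennreal_leI)
  then show ?thesis unfolding wt_def by simp
qed

lemma wt_0 [simp]: "wt s 0 = 0"
  by (simp add: wt_def)

lemma wt_mono:
  assumes "s \<le> s'"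
  shows "wt s k \<le> wt s' k"
proof (cases "k = 0")
  case False
  then have "1 \<le> \<bar>real_of_int k\<bar>" by (simp flip: of_int_abs)
  then show ?thesis unfolding wt_def by (intro ennreal_leI powr_mono assms)
qed simp

text \<open>Because \<open>0 powr 0 = 0\<close>, the weight ignores the mode 0 also for s = 0; the
  statements that follow compensate by asking that mode to vanish.\<close>

lemma wt_zero_exponent: "wt 0 k = (if k = 0 then 0 else 1)"
  by (simp add: wt_def)

lemma sqsum_le_weighted:
  assumes "f 0 = 0" "0 \<le> s"
  shows "sqsum f \<le> sqsum (\<lambda>k. wt s k * f k)"
proof (rule sqsum_mono)
  fix k
  have "f k = wt 0 k * f k" using assms(1) by (simp add: wt_zero_exponent)
  also have "\<dots> \<le> wt s k * f k" by (intro mult_right_mono wt_mono assms) auto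
  finally show "f k \<le> wt s k * f k" .
qed

lemma hsq_mono: "s \<le> s' \<Longrightarrow> hsq s v \<le> hsq s' v"
  unfolding hsq_def by (intro sqsum_mono mult_right_mono wt_mono) auto

lemma hsq_zero_exponent: "v 0 = 0 \<Longrightarrow> hsq 0 v = sqsum (\<lambda>k. enorm (v k))"
  unfolding hsq_def by (rule arg_cong[where f=sqsum]) (auto simp: wt_zero_exponent)

lemma csum_eq_suminf:
  fixes f :: "int \<Rightarrow> ennreal"
  shows "csum f = (\<Sum>n. f (int_decode n))"
  by (subst csum_bij[OF bij_int_decode, symmetric]) (simp add: nn_integral_count_space_nat)

lemma csum_le_const:
  fixes f :: "int \<Rightarrow> ennreal"
  assumes "\<And>F. finite F \<Longrightarrow> sum f F \<le> C"
  shows "csum f \<le> C"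
  unfolding csum_eq_suminf
proof (rule suminf_le_const)
  fix n
  have "(\<Sum>i<n. f (int_decode i)) = sum f (int_decode ` {..<n})"
    by (subst sum.reindex) (auto simp: inj_on_def dest: bij_int_decode[THEN bij_is_inj, THEN injD])
  then show "(\<Sum>i<n. f (int_decode i)) \<le> C" by (simp add: assms)
qed (rule summableI)

lemma csum_ennreal_iff_summable:
  fixes f :: "int \<Rightarrow> real"
  assumes "\<And>k. 0 \<le> f k"
  shows "f summable_on UNIV \<longleftrightarrow> (\<Sum>\<^sup>+k. ennreal (f k)) < top"
    and "f summable_on UNIV \<Longrightarrow> (\<Sum>\<^sup>+k. ennreal (f k)) = ennreal (infsum f UNIV)"
proof -
  show eq: "(\<Sum>\<^sup>+k. ennreal (f k)) = ennreal (infsum f UNIV)" if "f summable_on UNIV"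
  proof -
    have "(f has_sum infsum f UNIV) UNIV" using that by (rule has_sum_infsum)
    then have "((\<lambda>n. f (int_decode n)) has_sum infsum f UNIV) UNIV"
      by (subst has_sum_reindex_bij_betw[OF bij_int_decode])
    then have "(\<lambda>n. f (int_decode n)) sums infsum f UNIV" by (rule has_sum_imp_sums)
    then show ?thesis
      unfolding csum_eq_suminf using assms by (simp add: suminf_ennreal2 sums_iff)
  qed
  have "f summable_on UNIV" if fin: "(\<Sum>\<^sup>+k. ennreal (f k)) < top"
  proof (rule nonneg_bdd_above_summable_on)
    show "bdd_above (sum f ` {F. F \<subseteq> UNIV \<and> finite F})"
    proof (rule bdd_aboveI)
      fix x assume "x \<in> sum f ` {F. F \<subseteq> UNIV \<and> finite F}"
      then obtain F where F: "finite F" "x = sum f F" by auto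
      have "ennreal (sum f F) \<le> (\<Sum>\<^sup>+k. ennreal (f k))"
        using csum_finite_le[OF F(1), of "\<lambda>k. ennreal (f k)"] assms by (simp add: sum_ennreal)
      then show "x \<le> enn2real (\<Sum>\<^sup>+k. ennreal (f k))"
        using fin F(2) assms by (metis enn2real_ennreal enn2real_mono sum_nonneg)
    qed
  qed (use assms in auto)
  with eq show "f summable_on UNIV \<longleftrightarrow> (\<Sum>\<^sup>+k. ennreal (f k)) < top" by auto
qed

lemma hsq_alt: "hsq s v = (\<Sum>\<^sup>+k. ennreal (\<bar>real_of_int k\<bar> powr (2 * s) * (cmod (v k))\<^sup>2))"
proof -
  have "(wt s k * enorm (v k))\<^sup>2 = ennreal (\<bar>real_of_int k\<bar> powr (2 * s) * (cmod (v k))\<^sup>2)" for k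
  proof -
    have "(wt s k * enorm (v k))\<^sup>2 = ennreal ((\<bar>real_of_int k\<bar> powr s)\<^sup>2 * (cmod (v k))\<^sup>2)"
      by (simp add: wt_def ennreal_mult ennreal_power power_mult_distrib)
    also have "(\<bar>real_of_int k\<bar> powr s)\<^sup>2 = \<bar>real_of_int k\<bar> powr (2 * s)"
      by (simp add: power2_eq_square powr_add[symmetric])
    finally show ?thesis .
  qed
  then show ?thesis by (simp add: hsq_def sqsum_def)
qed

lemma summable_iff_hsq:
  "(\<lambda>k. real_of_int \<bar>k\<bar> powr (2 * s) * (cmod (v k))\<^sup>2) summable_on (UNIV - {0}) \<longleftrightarrow> hsq s v < top" (is ?A)
  and hs_norm_hsq: "hs_norm s v = sqrt (enn2real (hsq s v))" (is ?B)
proof -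
  let ?f = "\<lambda>k. \<bar>real_of_int k\<bar> powr (2 * s) * (cmod (v k))\<^sup>2"
  have s: "?f summable_on (UNIV - {0}) \<longleftrightarrow> ?f summable_on UNIV"
    by (rule summable_on_cong_neutral) auto
  have i: "infsum ?f (UNIV - {0}) = infsum ?f UNIV"
    by (rule infsum_cong_neutral) auto
  have c: "?f summable_on UNIV \<longleftrightarrow> hsq s v < top" "?f summable_on UNIV \<Longrightarrow> hsq s v = ennreal (infsum ?f UNIV)"
    unfolding hsq_alt by (intro csum_ennreal_iff_summable; simp)+
  show ?A using s c by simp
  have "infsum ?f UNIV = enn2real (hsq s v)"
  proof (cases "?f summable_on UNIV")
    case True
    then show ?thesis using c(2) by (simp add: infsum_nonneg)
  next
    case False
    \<comment> \<open>On a divergent sum both \<open>infsum\<close> and \<open>enn2real top\<close>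
      default to 0.\<close>
    then have "hsq s v = top" using c(1) by (simp add: not_less top_unique)
    with False show ?thesis by (simp add: infsum_not_exists)
  qed
  then show ?B unfolding hs_norm_def using i by simp
qed

lemma Hdot_iff: "v \<in> Hdot s \<longleftrightarrow> v 0 = 0 \<and> (\<forall>k. v (- k) = cnj (v k)) \<and> hsq s v < top"
  unfolding Hdot_def using summable_iff_hsq by simp

lemma hsq_hs_norm: "hsq s v < top \<Longrightarrow> hsq s v = ennreal ((hs_norm s v)\<^sup>2)"
  by (simp add: hs_norm_hsq)

lemma hs_norm_nonneg: "0 \<le> hs_norm s v"
  by (simp add: hs_norm_hsq)

lemma hs_norm_leI: "hsq s v \<le> ennreal (C\<^sup>2) \<Longrightarrow> 0 \<le> C \<Longrightarrow> hs_norm s v \<le> C"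
  unfolding hs_norm_hsq
  by (rule real_le_lsqrt) (auto intro: enn2real_leI)

lemma hsq_diff_le: "hsq s (\<lambda>k. v k - w k) \<le> 2 * (hsq s v + hsq s w)"
proof -
  have "hsq s (\<lambda>k. v k - w k) \<le> sqsum (\<lambda>k. wt s k * enorm (v k) + wt s k * enorm (w k))"
    unfolding hsq_def distrib_left[symmetric]
  proof (intro sqsum_mono mult_left_mono)
    show "enorm (v k - w k) \<le> enorm (v k) + enorm (w k)" for k
      using enorm_add[of "v k" "- w k"] by simp
  qed auto
  also have "\<dots> \<le> 2 * (hsq s v + hsq s w)" unfolding hsq_def by (rule sqsum_add2)
  finally show ?thesis .
qed

text \<open>The multiplier \<open>\<theta>\<close> is \<open>1\<close> for the KdV system and the indicator of \<open>\<bar>k\<bar> \<le> n\<close> for its Galerkin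
  truncations; no truncation of the factors is needed, as modes that vanish initially stay zero.\<close>

definition strong_solution :: "real \<Rightarrow> (int \<Rightarrow> real) \<Rightarrow> real \<Rightarrow> (real \<Rightarrow> int \<Rightarrow> complex) \<Rightarrow> bool"
  where "strong_solution T \<theta> M v \<longleftrightarrow> bounded_path v M \<and> (\<forall>k. \<bar>\<theta> k\<bar> \<le> 1) \<and>
    (\<forall>k. \<forall>t\<in>{0..T}. v t k = v 0 k
      + (LINT \<tau>:{0..t}|lborel. (1/2) * \<i> * of_int k * of_real (\<theta> k) * kdv_rhs v k \<tau>))"

section \<open>A priori bounds, Lipschitz bounds and uniqueness of strong solutions\<close>

lemma strong_solutionD:
  assumes "strong_solution T \<theta> M v"
  shows "bounded_path v M" and "\<bar>\<theta> k\<bar> \<le> 1"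
    and "t \<in> {0..T} \<Longrightarrow> v t k = v 0 k
      + (LINT \<tau>:{0..t}|lborel. (1/2) * \<i> * of_int k * of_real (\<theta> k) * kdv_rhs v k \<tau>)"
  using assms[unfolded strong_solution_def, THEN conjunct1]
    assms[unfolded strong_solution_def, THEN conjunct2, THEN conjunct1, rule_format]
    assms[unfolded strong_solution_def, THEN conjunct2, THEN conjunct2, rule_format]
  by - assumption+

lemma bounded_path_mono:
  assumes "bounded_path v M" "M \<le> M'"
  shows "bounded_path v M'"
proof -
  interpret bounded_path v M by fact
  show ?thesis
  proof
    show "sqsum (\<lambda>k. enorm (v t k)) \<le> ennreal M'" for t
      by (rule order_trans[OF sq_bound ennreal_leI[OF assms(2)]])
    show "0 \<le> M'" using M_nonneg assms(2) by linarith
  qed (rule cont zero)+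
qed

lemma strong_solution_mono:
  assumes "strong_solution T \<theta> M v" "M \<le> M'"
  shows "strong_solution T \<theta> M' v"
  unfolding strong_solution_def
  by (intro conjI allI ballI bounded_path_mono[OF _ assms(2)] strong_solutionD[OF assms(1)])

lemma solution_pairI:
  assumes "strong_solution T \<theta> M v" "strong_solution T \<theta> M v'"
  shows "solution_pair v v' M T \<theta>"
proof -
  note v = strong_solutionD[OF assms(1)] and v' = strong_solutionD[OF assms(2)]
  show ?thesis
    by (intro solution_pair.intro path_pair.intro solution_pair_axioms.intro v v')
qed

lemma kdv_rhs_zero: "kdv_rhs (\<lambda>_ _. 0) k \<tau> = 0"
  by (simp add: kdv_rhs_def)

lemma strong_solution_zero:
  assumes "0 \<le> M" "\<And>k. \<bar>\<theta> k\<bar> \<le> 1"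
  shows "strong_solution T \<theta> M (\<lambda>_ _. 0)"
  unfolding strong_solution_def
proof (intro conjI allI ballI)
  show "bounded_path (\<lambda>_ _. 0) M" by unfold_locales (auto simp: sqsum_def assms)
qed (simp_all only: assms kdv_rhs_zero set_lebesgue_integral_def mult_zero_right scaleR_zero_right integral_zero add_0)

lemma growth_const_nonneg: "0 \<le> growth_const L T"
  by (simp add: growth_const_def)

text \<open>Comparison with the zero solution. Then z and u are both |v|, \<open>cross\<close>
  reduces to the bound in H^0, and the constant depends on M and T alone.\<close>

lemma a_priori_bound:
  assumes v: "strong_solution T \<theta> M v" and s: "0 \<le> s" "s \<le> 1" and K: "0 \<le> K"
    and fin: "\<And>t. t \<in> {0..T} \<Longrightarrow> hsq s (v t) \<le> ennreal K" and t: "t \<in> {0..T}"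
  shows "hsq s (v t) \<le> ennreal (growth_const M T) * hsq s (v 0)"
proof -
  interpret b: bounded_path v M by (rule strong_solutionD[OF v])
  define v' :: "real \<Rightarrow> int \<Rightarrow> complex" where "v' = (\<lambda>_ _. 0)"
  have "strong_solution T \<theta> M v'"
    unfolding v'_def by (intro strong_solution_zero b.M_nonneg strong_solutionD(2)[OF v])
  then interpret solution_pair v v' M T \<theta> by (rule solution_pairI[OF v])
  have z: "z \<tau> k = enorm (v \<tau> k)" and u: "u \<tau> k = enorm (v \<tau> k)" for \<tau> k
    unfolding z_def u_def by (simp_all add: v'_def)
  have "sqsum (\<lambda>k. wt s k * z t k) \<le> ennreal (growth_const M T) * sqsum (\<lambda>k. wt s k * z 0 k)"
  proof (rule difference_estimate[where w="wt s", OF wt_subadditive[OF s] b.M_nonneg K _ _ _ t])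
    show "sqsum (u \<tau>) \<le> ennreal M" for \<tau> using b.sq_bound by (simp add: u[abs_def])
    show "sqsum (z \<tau>) * sqsum (\<lambda>k. wt s k * u \<tau> k) \<le> ennreal M * sqsum (\<lambda>k. wt s k * z \<tau> k)" for \<tau>
      unfolding z[abs_def] u by (intro mult_right_mono b.sq_bound) auto
    show "sqsum (\<lambda>k. wt s k * z \<tau> k) \<le> ennreal K" if "\<tau> \<in> {0..T}" for \<tau>
      using fin[OF that] by (simp add: z hsq_def)
  qed
  then show ?thesis by (simp add: z hsq_def)
qed

text \<open>\<open>cross\<close> holds for two reasons: the l2 norm of z is below its weighted norm
  because the mode 0 vanishes, and the weighted square norm of u is at most 2 (B + B) = 4 B.\<close>

lemma lipschitz_bound:
  assumes v: "strong_solution T \<theta> M v" and v': "strong_solution T \<theta> M v'" and s: "0 \<le> s" "s \<le> 1"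
    and B: "M \<le> B" "\<And>t. t \<in> {0..T} \<Longrightarrow> hsq s (v t) \<le> ennreal B" "\<And>t. t \<in> {0..T} \<Longrightarrow> hsq s (v' t) \<le> ennreal B"
    and t: "t \<in> {0..T}"
  shows "hsq s (\<lambda>k. v t k - v' t k) \<le> ennreal (growth_const (4 * B) T) * hsq s (\<lambda>k. v 0 k - v' 0 k)"
proof -
  interpret solution_pair v v' M T \<theta> by (intro solution_pairI v v')
  have B0: "0 \<le> B" "0 \<le> 4 * B" using B(1) v.M_nonneg by auto
  have four: "2 * (ennreal B + ennreal B) = ennreal (4 * B)"
    using B0 by (simp add: ennreal_real_ops)
  have ub: "sqsum (\<lambda>k. w k * u \<tau> k) \<le> 2 * (sqsum (\<lambda>k. w k * enorm (v \<tau> k)) + sqsum (\<lambda>k. w k * enorm (v' \<tau> k)))" for w \<tau>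
    unfolding u_def distrib_left by (rule order_trans[OF sqsum_add2]) simp
  have z0: "z \<tau> 0 = 0" for \<tau> by (simp add: z_def)
  have "sqsum (\<lambda>k. wt s k * z t k) \<le> ennreal (growth_const (4 * B) T) * sqsum (\<lambda>k. wt s k * z 0 k)"
  proof (rule difference_estimate[where w="wt s", OF wt_subadditive[OF s] B0(2) B0(2) _ _ _ t])
    fix \<tau> assume \<tau>: "\<tau> \<in> {0..T}"
    have "sqsum (u \<tau>) \<le> 2 * (sqsum (\<lambda>k. enorm (v \<tau> k)) + sqsum (\<lambda>k. enorm (v' \<tau> k)))"
      using ub[of "\<lambda>_. 1"] by simp
    also have "\<dots> \<le> 2 * (ennreal B + ennreal B)"
      by (intro mult_left_mono add_mono order_trans[OF v.sq_bound ennreal_leI[OF B(1)]]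
          order_trans[OF v'.sq_bound ennreal_leI[OF B(1)]]) auto
    finally show "sqsum (u \<tau>) \<le> ennreal (4 * B)" unfolding four .
    have "sqsum (\<lambda>k. wt s k * u \<tau> k) \<le> 2 * (hsq s (v \<tau>) + hsq s (v' \<tau>))"
      unfolding hsq_def by (rule ub)
    also have "\<dots> \<le> 2 * (ennreal B + ennreal B)"
      by (intro mult_left_mono add_mono B \<tau>) auto
    finally have "sqsum (\<lambda>k. wt s k * u \<tau> k) \<le> ennreal (4 * B)" unfolding four .
    then show "sqsum (z \<tau>) * sqsum (\<lambda>k. wt s k * u \<tau> k) \<le> ennreal (4 * B) * sqsum (\<lambda>k. wt s k * z \<tau> k)"
      by (subst mult.commute) (intro mult_mono sqsum_le_weighted[where f="z \<tau>", OF z0 s(1)]; simp)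
    have "sqsum (\<lambda>k. wt s k * z \<tau> k) = hsq s (\<lambda>k. v \<tau> k - v' \<tau> k)" by (simp add: z_def hsq_def)
    also have "\<dots> \<le> 2 * (hsq s (v \<tau>) + hsq s (v' \<tau>))" by (rule hsq_diff_le)
    also have "\<dots> \<le> 2 * (ennreal B + ennreal B)"
      by (intro mult_left_mono add_mono B \<tau>) auto
    finally show "sqsum (\<lambda>k. wt s k * z \<tau> k) \<le> ennreal (4 * B)" unfolding four .
  qed
  then show ?thesis by (simp add: z_def hsq_def)
qed

text \<open>The Lipschitz bound at s = 0, where the required bound on both solutions is part of the
  notion of a strong solution.\<close>

lemma strong_solution_unique:
  assumes v: "strong_solution T \<theta> M v" and v': "strong_solution T \<theta> M' v'"
    and eq: "v 0 = v' 0" and t: "t \<in> {0..T}"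
  shows "v t = v' t"
proof -
  define B where "B = max M M'"
  have vB: "strong_solution T \<theta> B v" "strong_solution T \<theta> B v'"
    by (rule strong_solution_mono[OF v], simp add: B_def) (rule strong_solution_mono[OF v'], simp add: B_def)
  interpret v: bounded_path v B by (rule strong_solutionD[OF vB(1)])
  interpret v': bounded_path v' B by (rule strong_solutionD[OF vB(2)])
  have "hsq 0 (\<lambda>k. v t k - v' t k) \<le> ennreal (growth_const (4 * B) T) * hsq 0 (\<lambda>k. v 0 k - v' 0 k)"
  proof (rule lipschitz_bound[OF vB _ _ order_refl _ _ t])
    show "hsq 0 (v t) \<le> ennreal B" "hsq 0 (v' t) \<le> ennreal B" for t
      using v.sq_bound v'.sq_bound by (simp_all add: hsq_zero_exponent)
  qed auto
  also have "\<dots> = 0" by (simp add: eq hsq_def sqsum_def)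
  finally have "sqsum (\<lambda>k. enorm (v t k - v' t k)) \<le> 0" by (simp add: hsq_zero_exponent)
  then have "(enorm (v t k - v' t k))\<^sup>2 \<le> 0" for k using sqsum_upper order_trans by blast
  then show ?thesis by (simp add: fun_eq_iff ennreal_eq_0_iff)
qed

section \<open>Galerkin approximations\<close>

text \<open>Successive approximation on all of [0, T] at once. The increments are measured against
  exp(2 \<Lambda> t), which makes every step a contraction by 1/2, so the interval is never
  subdivided. Modes outside K stay constant.\<close>

lemma picard_finite_system:
  fixes G :: "real \<Rightarrow> (int \<Rightarrow> complex) \<Rightarrow> int \<Rightarrow> complex" and K :: "int set"
  assumes K: "finite K" and T: "0 \<le> T" and \<Lambda>: "0 < \<Lambda>"
    and contG: "\<And>x k. (\<And>k. continuous_on {0..T} (\<lambda>t. x t k)) \<Longrightarrow> continuous_on {0..T} (\<lambda>t. G t (x t) k)"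
    and lip: "\<And>t x y. t \<in> {0..T} \<Longrightarrow> (\<Sum>k\<in>K. cmod (G t x k - G t y k)) \<le> \<Lambda> * (\<Sum>k\<in>K. cmod (x k - y k))"
    and supp: "\<And>t x k. k \<notin> K \<Longrightarrow> G t x k = 0"
  shows "\<exists>x. (\<forall>k. continuous_on {0..T} (\<lambda>t. x t k)) \<and>
    (\<forall>t\<in>{0..T}. \<forall>k. x t k = a k + integral {0..t} (\<lambda>\<tau>. G \<tau> (x \<tau>) k))"
proof -
  define \<Phi> where "\<Phi> x = (\<lambda>t k. a k + integral {0..t} (\<lambda>\<tau>. G \<tau> (x \<tau>) k))" for x
  define X where "X j = (\<Phi> ^^ j) (\<lambda>_. a)" for j
  have XS: "X (Suc j) t k = a k + integral {0..t} (\<lambda>\<tau>. G \<tau> (X j \<tau>) k)" for j t k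
    by (simp add: X_def \<Phi>_def)
  have cont_\<Phi>: "continuous_on {0..T} (\<lambda>t. \<Phi> x t k)" if "\<And>k. continuous_on {0..T} (\<lambda>t. x t k)" for x k
    unfolding \<Phi>_def
    by (rule continuous_on_add[OF continuous_on_const indefinite_integral_continuous_1[OF integrable_continuous_real[OF contG[OF that]]]])
  have contX: "continuous_on {0..T} (\<lambda>t. X j t k)" for j k
  proof (induction j arbitrary: k)
    case (Suc j)
    have "X (Suc j) = \<Phi> (X j)" by (simp add: X_def)
    then show ?case using cont_\<Phi>[OF Suc] by simp
  qed (simp add: X_def)
  define \<delta> where "\<delta> j t = (\<Sum>k\<in>K. cmod (X (Suc j) t k - X j t k))" for j t
  have cont\<delta>: "continuous_on {0..T} (\<delta> j)" for j
    unfolding \<delta>_def[abs_def] by (intro continuous_on_sum continuous_on_norm continuous_on_diff contX)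
  have "compact (\<delta> 0 ` {0..T})" by (intro compact_continuous_image cont\<delta>) simp
  then have "bounded (\<delta> 0 ` {0..T})" by (rule compact_imp_bounded)
  then obtain C where C: "0 < C" "\<forall>y\<in>\<delta> 0 ` {0..T}. norm y \<le> C"
    unfolding bounded_pos by blast
  have C': "\<delta> 0 t \<le> C" if "t \<in> {0..T}" for t
  proof -
    have "norm (\<delta> 0 t) \<le> C" using C(2) that by blast
    then show ?thesis by simp
  qed
  have int_bound: "(\<Sum>k\<in>K. cmod (integral {0..t} (\<lambda>\<tau>. G \<tau> (x \<tau>) k) - integral {0..t} (\<lambda>\<tau>. G \<tau> (y \<tau>) k)))
      \<le> integral {0..t} D"
    if x: "\<And>k. continuous_on {0..T} (\<lambda>t. x t k)" and y: "\<And>k. continuous_on {0..T} (\<lambda>t. y t k)"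
      and t: "t \<in> {0..T}" and D: "continuous_on {0..t} D" "\<And>\<tau>. \<tau> \<in> {0..t} \<Longrightarrow> \<Lambda> * (\<Sum>k\<in>K. cmod (x \<tau> k - y \<tau> k)) \<le> D \<tau>"
    for x y t D
  proof -
    have sub: "{0..t} \<subseteq> {0..T}" using t by auto
    have cx: "continuous_on {0..t} (\<lambda>\<tau>. G \<tau> (x \<tau>) k)" and cy: "continuous_on {0..t} (\<lambda>\<tau>. G \<tau> (y \<tau>) k)" for k
      by (rule continuous_on_subset[OF contG[OF x] sub], rule continuous_on_subset[OF contG[OF y] sub])
    have cd: "continuous_on {0..t} (\<lambda>\<tau>. G \<tau> (x \<tau>) k - G \<tau> (y \<tau>) k)" for k
      by (rule continuous_on_diff[OF cx cy])
    have cn: "continuous_on {0..t} (\<lambda>\<tau>. cmod (G \<tau> (x \<tau>) k - G \<tau> (y \<tau>) k))" for k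
      by (rule continuous_on_norm[OF cd])
    have "cmod (integral {0..t} (\<lambda>\<tau>. G \<tau> (x \<tau>) k) - integral {0..t} (\<lambda>\<tau>. G \<tau> (y \<tau>) k))
        \<le> integral {0..t} (\<lambda>\<tau>. cmod (G \<tau> (x \<tau>) k - G \<tau> (y \<tau>) k))" for k
    proof -
      have "integral {0..t} (\<lambda>\<tau>. G \<tau> (x \<tau>) k) - integral {0..t} (\<lambda>\<tau>. G \<tau> (y \<tau>) k)
        = integral {0..t} (\<lambda>\<tau>. G \<tau> (x \<tau>) k - G \<tau> (y \<tau>) k)"
        by (rule Henstock_Kurzweil_Integration.integral_diff[OF integrable_continuous_real[OF cx] integrable_continuous_real[OF cy], symmetric])
      also have "cmod \<dots> \<le> integral {0..t} (\<lambda>\<tau>. cmod (G \<tau> (x \<tau>) k - G \<tau> (y \<tau>) k))"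
        by (rule integral_norm_bound_integral[OF integrable_continuous_real[OF cd] integrable_continuous_real[OF cn]]) simp
      finally show ?thesis .
    qed
    then have "(\<Sum>k\<in>K. cmod (integral {0..t} (\<lambda>\<tau>. G \<tau> (x \<tau>) k) - integral {0..t} (\<lambda>\<tau>. G \<tau> (y \<tau>) k)))
        \<le> (\<Sum>k\<in>K. integral {0..t} (\<lambda>\<tau>. cmod (G \<tau> (x \<tau>) k - G \<tau> (y \<tau>) k)))"
      by (rule sum_mono)
    also have "\<dots> = integral {0..t} (\<lambda>\<tau>. \<Sum>k\<in>K. cmod (G \<tau> (x \<tau>) k - G \<tau> (y \<tau>) k))"
      by (rule Henstock_Kurzweil_Integration.integral_sum[OF K integrable_continuous_real[OF cn], symmetric])
    also have "\<dots> \<le> integral {0..t} D"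
    proof (rule Henstock_Kurzweil_Integration.integral_le[OF integrable_continuous_real[OF continuous_on_sum[OF cn]]
          integrable_continuous_real[OF D(1)]])
      fix \<tau> assume \<tau>: "\<tau> \<in> {0..t}"
      show "(\<Sum>k\<in>K. cmod (G \<tau> (x \<tau>) k - G \<tau> (y \<tau>) k)) \<le> D \<tau>"
        using sub \<tau> by (intro order_trans[OF lip D(2)[OF \<tau>]]) blast
    qed
    finally show ?thesis .
  qed
  have bound: "\<delta> j t \<le> C * (1/2) ^ j * exp (2 * \<Lambda> * t)" if "t \<in> {0..T}" for j t
    using that
  proof (induction j arbitrary: t)
    case 0
    have "C * 1 \<le> C * exp (2 * \<Lambda> * t)" using C(1) 0 \<Lambda> by (intro mult_left_mono) auto
    then show ?case using C'[OF 0] by simp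
  next
    case (Suc j)
    have "\<delta> (Suc j) t = (\<Sum>k\<in>K. cmod (integral {0..t} (\<lambda>\<tau>. G \<tau> (X (Suc j) \<tau>) k) - integral {0..t} (\<lambda>\<tau>. G \<tau> (X j \<tau>) k)))"
      unfolding \<delta>_def XS[of "Suc j"] by (simp add: XS[of j])
    also have "\<dots> \<le> integral {0..t} (\<lambda>\<tau>. \<Lambda> * (C * (1/2) ^ j * exp (2 * \<Lambda> * \<tau>)))"
    proof (rule int_bound[OF contX contX Suc.prems])
      fix \<tau> assume "\<tau> \<in> {0..t}"
      then have "\<tau> \<in> {0..T}" using Suc.prems by auto
      then show "\<Lambda> * (\<Sum>k\<in>K. cmod (X (Suc j) \<tau> k - X j \<tau> k)) \<le> \<Lambda> * (C * (1/2) ^ j * exp (2 * \<Lambda> * \<tau>))"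
        using Suc.IH[of \<tau>] \<Lambda> by (simp add: \<delta>_def)
    next
      show "continuous_on {0..t} (\<lambda>\<tau>. \<Lambda> * (C * (1/2) ^ j * exp (2 * \<Lambda> * \<tau>)))"
        by (intro continuous_intros)
    qed
    finally have le: "\<delta> (Suc j) t \<le> integral {0..t} (\<lambda>\<tau>. \<Lambda> * (C * (1/2) ^ j * exp (2 * \<Lambda> * \<tau>)))" .
    \<comment> \<open>Integrating \<Lambda> exp(2 \<Lambda> \<tau>) gives half of exp(2 \<Lambda> t)
      minus 1: this is the contraction factor.\<close>
    have hi: "((\<lambda>\<tau>. \<Lambda> * (C * (1/2) ^ j * exp (2 * \<Lambda> * \<tau>))) has_integral
        C * (1/2) ^ Suc j * exp (2 * \<Lambda> * t) - C * (1/2) ^ Suc j * exp (2 * \<Lambda> * 0)) {0..t}"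
      using Suc.prems \<Lambda>
      by (intro fundamental_theorem_of_calculus)
        (auto intro!: derivative_eq_intros simp: has_real_derivative_iff_has_vector_derivative[symmetric])
    have "C * (1/2) ^ Suc j * exp (2 * \<Lambda> * 0) \<ge> 0" using C(1) by simp
    then show ?case using le unfolding integral_unique[OF hi] by linarith
  qed
  define x where "x t k = a k + (\<Sum>j. X (Suc j) t k - X j t k)" for t k
  have telescope: "(\<Sum>i<j. X (Suc i) t k - X i t k) = X j t k - a k" for j t k
    using sum_lessThan_telescope[of "\<lambda>i. X i t k" j] by (simp add: X_def)
  have unif: "uniform_limit {0..T} (\<lambda>j t. X j t k) (\<lambda>t. x t k) sequentially" for k
  proof -
    have "uniform_limit {0..T} (\<lambda>n t. \<Sum>i<n. X (Suc i) t k - X i t k) (\<lambda>t. \<Sum>j. X (Suc j) t k - X j t k) sequentially"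
    proof (rule Weierstrass_m_test)
      fix j t assume t: "t \<in> {0..T}"
      have nonneg: "0 \<le> C * (1/2) ^ j * exp (2 * \<Lambda> * T)" using C(1) by simp
      have le: "exp (2 * \<Lambda> * t) \<le> exp (2 * \<Lambda> * T)" using t \<Lambda> by simp
      show "norm (X (Suc j) t k - X j t k) \<le> C * (1/2) ^ j * exp (2 * \<Lambda> * T)"
      proof (cases "k \<in> K")
        case True
        have "norm (X (Suc j) t k - X j t k) \<le> \<delta> j t"
          unfolding \<delta>_def using K True by (intro member_le_sum) auto
        also have "\<dots> \<le> C * (1/2) ^ j * exp (2 * \<Lambda> * t)" by (rule bound[OF t])
        also have "\<dots> \<le> C * (1/2) ^ j * exp (2 * \<Lambda> * T)"
          using C(1) le by (intro mult_left_mono) auto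
        finally show ?thesis .
      next
        case False
        have "X j t k = a k" for j
          by (cases j) (simp_all add: XS supp[OF False], simp add: X_def)
        then show ?thesis using nonneg by simp
      qed
    next
      show "summable (\<lambda>j. C * (1/2) ^ j * exp (2 * \<Lambda> * T))"
        by (intro summable_mult summable_mult2 summable_geometric) simp
    qed
    then have "uniform_limit {0..T} (\<lambda>n t. a k + (\<Sum>i<n. X (Suc i) t k - X i t k)) (\<lambda>t. x t k) sequentially"
      unfolding x_def by (intro uniform_limit_intros)
    then show ?thesis by (simp add: telescope)
  qed
  have contx: "continuous_on {0..T} (\<lambda>t. x t k)" for k
    by (rule uniform_limit_theorem[OF always_eventually unif]) (auto intro: contX)
  have eqx: "x t k = a k + integral {0..t} (\<lambda>\<tau>. G \<tau> (x \<tau>) k)" if t: "t \<in> {0..T}" for t k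
  proof (cases "k \<in> K")
    case False
    have "X j t k = a k" for j
      by (cases j) (simp_all add: XS supp[OF False], simp add: X_def)
    then have "(\<lambda>j. X j t k) \<longlonglongrightarrow> a k" by simp
    moreover have "(\<lambda>j. X j t k) \<longlonglongrightarrow> x t k" using tendsto_uniform_limitI[OF unif t] .
    ultimately have "x t k = a k" using LIMSEQ_unique by blast
    then show ?thesis by (simp add: supp[OF False])
  next
    case True
    have "(\<lambda>j. X (Suc j) t k) \<longlonglongrightarrow> a k + integral {0..t} (\<lambda>\<tau>. G \<tau> (x \<tau>) k)"
    proof (rule LIMSEQ_I)
      fix e :: real assume e: "0 < e"
      \<comment> \<open>q dominates the factor that the Picard map applies to a uniform error d in
        the modes of K. The added ones keep q positive when K is empty or T = 0.\<close>
      define q where "q = \<Lambda> * (real (card K) + 1) * (T + 1)"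
      define d where "d = e / (2 * q)"
      have q: "0 < q" using \<Lambda> T by (simp add: q_def add_nonneg_pos)
      have d: "0 < d" using e q by (simp add: d_def)
      have "\<forall>\<^sub>F j in sequentially. \<forall>k\<in>K. \<forall>\<tau>\<in>{0..T}. dist (X j \<tau> k) (x \<tau> k) < d"
        using K d unif by (intro eventually_ball_finite) (auto simp: uniform_limit_iff)
      then obtain j0 where j0: "\<And>j k \<tau>. j \<ge> j0 \<Longrightarrow> k \<in> K \<Longrightarrow> \<tau> \<in> {0..T} \<Longrightarrow> dist (X j \<tau> k) (x \<tau> k) < d"
        unfolding eventually_sequentially by blast
      have "norm (X (Suc j) t k - (a k + integral {0..t} (\<lambda>\<tau>. G \<tau> (x \<tau>) k))) < e" if j: "j \<ge> j0" for j
      proof -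
        have "norm (X (Suc j) t k - (a k + integral {0..t} (\<lambda>\<tau>. G \<tau> (x \<tau>) k)))
          = norm (integral {0..t} (\<lambda>\<tau>. G \<tau> (X j \<tau>) k) - integral {0..t} (\<lambda>\<tau>. G \<tau> (x \<tau>) k))"
          by (simp add: XS)
        also have "\<dots> \<le> (\<Sum>k\<in>K. cmod (integral {0..t} (\<lambda>\<tau>. G \<tau> (X j \<tau>) k) - integral {0..t} (\<lambda>\<tau>. G \<tau> (x \<tau>) k)))"
          using K True by (intro member_le_sum[of k K "\<lambda>k. cmod (integral {0..t} (\<lambda>\<tau>. G \<tau> (X j \<tau>) k) - integral {0..t} (\<lambda>\<tau>. G \<tau> (x \<tau>) k))"]) auto
        also have "\<dots> \<le> integral {0..t} (\<lambda>_. \<Lambda> * (real (card K) * d))"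
        proof (rule int_bound[OF contX contx t])
          fix \<tau> assume "\<tau> \<in> {0..t}"
          then have "(\<Sum>k\<in>K. cmod (X j \<tau> k - x \<tau> k)) \<le> (\<Sum>k\<in>K. d)"
            using j0[OF j] t by (intro sum_mono) (force simp: dist_norm intro: less_imp_le)
          then show "\<Lambda> * (\<Sum>k\<in>K. cmod (X j \<tau> k - x \<tau> k)) \<le> \<Lambda> * (real (card K) * d)"
            using \<Lambda> by simp
        qed simp
        also have "\<dots> = t * (\<Lambda> * (real (card K) * d))" using t by simp
        also have "\<dots> \<le> (T + 1) * (\<Lambda> * ((real (card K) + 1) * d))"
          using t \<Lambda> d by (intro mult_mono) auto
        also have "\<dots> = q * d" by (simp add: q_def mult_ac)
        also have "\<dots> = e / 2" using q by (simp add: d_def)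
        also have "\<dots> < e" using e by simp
        finally show ?thesis .
      qed
      then show "\<exists>j0. \<forall>j\<ge>j0. norm (X (Suc j) t k - (a k + integral {0..t} (\<lambda>\<tau>. G \<tau> (x \<tau>) k))) < e" by blast
    qed
    moreover have "(\<lambda>j. X (Suc j) t k) \<longlonglongrightarrow> x t k"
      using tendsto_uniform_limitI[OF unif t] by (rule LIMSEQ_Suc)
    ultimately show ?thesis using LIMSEQ_unique by blast
  qed
  show ?thesis by (intro exI[of _ x] conjI allI ballI contx eqx)
qed

text \<open>The sum runs over triads a + b + c = 0 and f is symmetric in a, b, c. The weights a, b
  and c thus give the same sum S, while their total weight is 0; hence 3 S = 0. The support
  condition keeps c inside K, so the finite index set respects the symmetry.\<close>

lemma cubic_cancellation:
  fixes f :: "int \<Rightarrow> int \<Rightarrow> complex"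
  assumes K: "finite K" and sym: "\<And>a b. f a b = f b a" and rot: "\<And>a b. f a b = f (- a - b) b"
    and supp: "\<And>a b. - a - b \<notin> K \<Longrightarrow> f a b = 0"
  shows "(\<Sum>a\<in>K. \<Sum>b\<in>K. of_int a * f a b) = 0"
proof -
  define S where "S = (\<Sum>a\<in>K. \<Sum>b\<in>K. of_int a * f a b)"
  have S2: "S = (\<Sum>a\<in>K. \<Sum>b\<in>K. of_int b * f a b)"
    unfolding S_def by (subst sum.swap) (simp add: sym)
  have "(\<Sum>a\<in>K. of_int a * f a b) = (\<Sum>a\<in>K. of_int (- a - b) * f a b)" for b
  proof -
    let ?K = "{a \<in> K. - a - b \<in> K}"
    have "(\<Sum>a\<in>K. of_int a * f a b) = (\<Sum>a\<in>?K. of_int a * f a b)"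
      by (intro sum.mono_neutral_right) (auto simp: K supp)
    also have "\<dots> = (\<Sum>a\<in>?K. of_int (- a - b) * f a b)"
      by (rule sum.reindex_bij_witness[where i="\<lambda>a. - a - b" and j="\<lambda>a. - a - b"]) (auto simp: rot[symmetric])
    also have "\<dots> = (\<Sum>a\<in>K. of_int (- a - b) * f a b)"
      by (intro sum.mono_neutral_left) (auto simp: K supp)
    finally show ?thesis .
  qed
  then have "S = (\<Sum>b\<in>K. \<Sum>a\<in>K. of_int (- a - b) * f a b)"
    unfolding S_def by (subst sum.swap) simp
  also have "\<dots> = (\<Sum>a\<in>K. \<Sum>b\<in>K. of_int (- a - b) * f a b)" by (rule sum.swap)
  also have "\<dots> = (\<Sum>a\<in>K. \<Sum>b\<in>K. - (of_int a * f a b) - of_int b * f a b)"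
    by (simp add: algebra_simps)
  also have "\<dots> = - S - S"
    unfolding sum_subtractf sum_negf S2[symmetric] S_def[symmetric] ..
  finally have "3 * S = 0" by (simp add: algebra_simps)
  then show ?thesis by (simp add: S_def)
qed

text \<open>The radial retraction onto the l1 ball of radius R, which is the identity inside the
  ball. The Lipschitz constant 2 consists of 1 for moving x at a fixed factor \<rho> and 1 for the
  change of \<rho>.\<close>

lemma radial_cutoff_Lipschitz:
  fixes x y :: "int \<Rightarrow> complex" and K :: "int set" and R :: real
  defines "N \<equiv> \<lambda>x. \<Sum>k\<in>K. cmod (x k)"
  defines "\<rho> \<equiv> \<lambda>x. R / max R (N x)"
  assumes K: "finite K" and R: "0 < R"
  shows "(\<Sum>k\<in>K. cmod (of_real (\<rho> x) * x k)) \<le> R"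
    and "(\<Sum>k\<in>K. cmod (of_real (\<rho> x) * x k - of_real (\<rho> y) * y k)) \<le> 2 * (\<Sum>k\<in>K. cmod (x k - y k))"
proof -
  have N0: "0 \<le> N x" for x by (simp add: N_def sum_nonneg)
  have m: "0 < max R (N x)" "R \<le> max R (N x)" "N x \<le> max R (N x)" for x using R by auto
  have \<rho>: "0 \<le> \<rho> x" "\<rho> x \<le> 1" for x
    using R m[of x] by (auto simp: \<rho>_def divide_le_eq)
  have "(\<Sum>k\<in>K. cmod (of_real (\<rho> x) * x k)) = \<rho> x * N x"
    using \<rho>(1) by (simp add: norm_mult N_def sum_distrib_left)
  also have "\<dots> \<le> R"
    using R m[of x] by (simp add: \<rho>_def divide_le_eq mult_left_mono)
  finally show "(\<Sum>k\<in>K. cmod (of_real (\<rho> x) * x k)) \<le> R" .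
  define d where "d = (\<Sum>k\<in>K. cmod (x k - y k))"
  have tri: "\<bar>N x - N y\<bar> \<le> d"
  proof -
    have "\<bar>N x - N y\<bar> \<le> (\<Sum>k\<in>K. \<bar>cmod (x k) - cmod (y k)\<bar>)"
      unfolding N_def sum_subtractf[symmetric] by (rule sum_abs)
    also have "\<dots> \<le> d" unfolding d_def by (intro sum_mono norm_triangle_ineq3)
    finally show ?thesis .
  qed
  have rho_diff: "\<bar>\<rho> x - \<rho> y\<bar> * N y \<le> d"
  proof -
    have "\<rho> x - \<rho> y = R * (max R (N y) - max R (N x)) / (max R (N x) * max R (N y))"
      using m(1)[of x] m(1)[of y] unfolding \<rho>_def by (simp add: divide_simps) (simp add: algebra_simps)
    then have "\<bar>\<rho> x - \<rho> y\<bar> * N y = \<rho> x * (N y / max R (N y)) * \<bar>max R (N y) - max R (N x)\<bar>"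
      using m(1)[of x] m(1)[of y] R N0 by (simp add: \<rho>_def abs_mult)
    also have "\<dots> \<le> 1 * 1 * d"
    proof (intro mult_mono)
      show "N y / max R (N y) \<le> 1" using m[of y] by (simp add: divide_le_eq)
      show "\<bar>max R (N y) - max R (N x)\<bar> \<le> d" using tri by (simp add: max_def abs_le_iff)
    qed (use \<rho>[of x] N0[of y] m(1)[of y] in \<open>auto simp: less_imp_le\<close>)
    finally show ?thesis by simp
  qed
  have "(\<Sum>k\<in>K. cmod (of_real (\<rho> x) * x k - of_real (\<rho> y) * y k))
    \<le> (\<Sum>k\<in>K. \<rho> x * cmod (x k - y k) + \<bar>\<rho> x - \<rho> y\<bar> * cmod (y k))"
  proof (rule sum_mono)
    fix k
    have "of_real (\<rho> x) * x k - of_real (\<rho> y) * y k = of_real (\<rho> x) * (x k - y k) + of_real (\<rho> x - \<rho> y) * y k"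
      by (simp add: algebra_simps)
    also have "cmod \<dots> \<le> cmod (of_real (\<rho> x) * (x k - y k)) + cmod (of_real (\<rho> x - \<rho> y) * y k)"
      by (rule norm_triangle_ineq)
    also have "\<dots> = \<rho> x * cmod (x k - y k) + \<bar>\<rho> x - \<rho> y\<bar> * cmod (y k)"
      unfolding norm_mult norm_of_real using \<rho>(1)[of x] by simp
    finally show "cmod (of_real (\<rho> x) * x k - of_real (\<rho> y) * y k) \<le> \<dots>" .
  qed
  also have "\<dots> = \<rho> x * d + \<bar>\<rho> x - \<rho> y\<bar> * N y"
    by (simp add: sum.distrib sum_distrib_left d_def N_def)
  also have "\<dots> \<le> 1 * d + d"
    by (intro add_mono mult_right_mono \<rho> rho_diff) (simp add: d_def sum_nonneg)
  finally show "(\<Sum>k\<in>K. cmod (of_real (\<rho> x) * x k - of_real (\<rho> y) * y k)) \<le> 2 * (\<Sum>k\<in>K. cmod (x k - y k))"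
    by (simp add: d_def)
qed

definition galerkin_form :: "int set \<Rightarrow> real \<Rightarrow> (int \<Rightarrow> complex) \<Rightarrow> int \<Rightarrow> complex"
  where "galerkin_form K t p k =
    (1/2) * \<i> * of_int k * (\<Sum>j\<in>K. phase (3 * real_of_int (k * j * (k - j))) t * (p j * p (k - j)))"

lemma cmod_mult_diff: "cmod (a * b - c * d) \<le> cmod (a - c) * cmod b + cmod c * cmod (b - d)"
proof -
  have "a * b - c * d = (a - c) * b + c * (b - d)" by (simp add: algebra_simps)
  then show ?thesis using norm_triangle_ineq[of "(a - c) * b" "c * (b - d)"] by (simp only: norm_mult)
qed

lemma galerkin_form_Lipschitz:
  assumes K: "finite K" "k \<in> K" "\<bar>real_of_int k\<bar> \<le> n"
    and p: "\<And>j. j \<notin> K \<Longrightarrow> p j = 0" "(\<Sum>j\<in>K. cmod (p j)) \<le> R"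
    and q: "\<And>j. j \<notin> K \<Longrightarrow> q j = 0" "(\<Sum>j\<in>K. cmod (q j)) \<le> R"
  shows "cmod (galerkin_form K t p k - galerkin_form K t q k) \<le> n * R * (\<Sum>j\<in>K. cmod (p j - q j))"
proof -
  define d where "d = (\<Sum>j\<in>K. cmod (p j - q j))"
  have d: "cmod (p j - q j) \<le> d" for j
  proof (cases "j \<in> K")
    case True
    then show ?thesis unfolding d_def using K(1) by (intro member_le_sum) auto
  next
    case False
    then show ?thesis using p(1) q(1) by (simp add: d_def sum_nonneg)
  qed
  have pR: "cmod (p j) \<le> R" for j
  proof (cases "j \<in> K")
    case True
    then have "cmod (p j) \<le> (\<Sum>j\<in>K. cmod (p j))" using K(1) by (intro member_le_sum) auto
    then show ?thesis using p(2) by simp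
  next
    case False
    have "0 \<le> (\<Sum>j\<in>K. cmod (p j))" by (simp add: sum_nonneg)
    then show ?thesis using False p by simp
  qed
  have R: "0 \<le> R" by (rule order_trans[OF norm_ge_zero pR[of k]])
  have d0: "0 \<le> d" by (simp add: d_def sum_nonneg)
  have diff: "galerkin_form K t p k - galerkin_form K t q k = (1/2) * \<i> * of_int k *
    (\<Sum>j\<in>K. phase (3 * real_of_int (k * j * (k - j))) t * (p j * p (k - j) - q j * q (k - j)))"
    by (simp only: galerkin_form_def right_diff_distrib[symmetric] sum_subtractf[symmetric])
  have "cmod (galerkin_form K t p k - galerkin_form K t q k) = \<bar>real_of_int k\<bar> / 2 * cmod (\<Sum>j\<in>K. phase (3 * real_of_int (k * j * (k - j))) t * (p j * p (k - j) - q j * q (k - j)))"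
    unfolding diff by (subst norm_mult) (simp add: norm_mult)
  also have "\<dots> \<le> n / 2 * (2 * (R * d))"
  proof (intro mult_mono)
    have "cmod (phase \<phi> t * (p j * p (k - j) - q j * q (k - j))) \<le> cmod (p j - q j) * R + cmod (q j) * d" for \<phi> j
    proof -
      have "cmod (p j * p (k - j) - q j * q (k - j)) \<le> cmod (p j - q j) * cmod (p (k - j)) + cmod (q j) * cmod (p (k - j) - q (k - j))"
        by (rule cmod_mult_diff)
      also have "\<dots> \<le> cmod (p j - q j) * R + cmod (q j) * d"
        by (rule add_mono[OF mult_left_mono[OF pR] mult_left_mono[OF d]]) simp_all
      finally show ?thesis by (simp only: norm_mult norm_phase mult_1)
    qed
    then have "cmod (\<Sum>j\<in>K. phase (3 * real_of_int (k * j * (k - j))) t * (p j * p (k - j) - q j * q (k - j)))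
      \<le> (\<Sum>j\<in>K. cmod (p j - q j) * R + cmod (q j) * d)"
      by (rule sum_norm_le)
    also have "\<dots> = d * R + (\<Sum>j\<in>K. cmod (q j)) * d"
      by (simp only: sum.distrib sum_distrib_right[symmetric] d_def[symmetric])
    also have "\<dots> \<le> d * R + R * d" by (rule add_left_mono[OF mult_right_mono[OF q(2) d0]])
    also have "\<dots> = 2 * (R * d)" by simp
    finally show "cmod (\<Sum>j\<in>K. phase (3 * real_of_int (k * j * (k - j))) t * (p j * p (k - j) - q j * q (k - j))) \<le> 2 * (R * d)" .
    show "\<bar>real_of_int k\<bar> / 2 \<le> n / 2" "0 \<le> n / 2" using K(3) by simp_all
  qed simp
  also have "\<dots> = n * R * d" by simp
  finally show ?thesis by (simp only: d_def)
qed

lemma galerkin_form_cnj: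
  assumes "\<And>j. p (- j) = cnj (p j)" and sym: "\<And>j. - j \<in> K \<longleftrightarrow> j \<in> K"
  shows "galerkin_form K t p (- k) = cnj (galerkin_form K t p k)"
proof -
  have cp: "cnj (phase \<phi> t) = phase (- \<phi>) t" for \<phi> by (simp add: phase_def exp_cnj)
  have "(\<Sum>j\<in>K. phase (3 * real_of_int (- k * j * (- k - j))) t * (p j * p (- k - j)))
    = (\<Sum>j\<in>K. phase (- (3 * real_of_int (k * j * (k - j)))) t * (cnj (p j) * cnj (p (k - j))))"
  proof (rule sum.reindex_bij_witness[where i=uminus and j=uminus])
    fix j
    have "p (- k - - j) = cnj (p (k - j))" using assms(1)[of "k - j"] by simp
    moreover have "3 * real_of_int (- k * - j * (- k - - j)) = - (3 * real_of_int (k * j * (k - j)))"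
      by (simp add: algebra_simps)
    ultimately have "phase (3 * real_of_int (- k * - j * (- k - - j))) t * (p (- j) * p (- k - - j))
      = phase (- (3 * real_of_int (k * j * (k - j)))) t * (cnj (p j) * cnj (p (k - j)))"
      by (simp only: assms(1))
    moreover note * = this
    show "phase (- (3 * real_of_int (k * - j * (k - - j)))) t * (cnj (p (- j)) * cnj (p (k - - j))) =
      phase (3 * real_of_int (- k * j * (- k - j))) t * (p j * p (- k - j))"
    proof -
      have "p (- k - j) = cnj (p (k + j))" using assms(1)[of "k + j"] by simp
      moreover have "- (3 * real_of_int (k * - j * (k - - j))) = 3 * real_of_int (- k * j * (- k - j))"
        by (simp add: algebra_simps)
      ultimately show ?thesis by (simp only: assms(1) complex_cnj_cnj diff_minus_eq_add)
    qed
  qed (auto simp: sym)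
  then show ?thesis unfolding galerkin_form_def by (simp add: cp)
qed

text \<open>Freezing a path outside \<open>[0, T]\<close> makes its continuity, measurability and bounds global.\<close>

definition clamp_path :: "real \<Rightarrow> (real \<Rightarrow> int \<Rightarrow> complex) \<Rightarrow> real \<Rightarrow> int \<Rightarrow> complex"
  where "clamp_path T x t = x (max 0 (min T t))"

lemma clamp_path_inside [simp]: "t \<in> {0..T} \<Longrightarrow> clamp_path T x t = x t"
  by (auto simp: clamp_path_def max_def min_def)

lemma clamp_path_bounded:
  assumes T: "0 \<le> T" and cont: "\<And>k. continuous_on {0..T} (\<lambda>t. x t k)"
    and zero: "\<And>t. t \<in> {0..T} \<Longrightarrow> x t 0 = 0"
    and sq: "\<And>t. t \<in> {0..T} \<Longrightarrow> sqsum (\<lambda>k. enorm (x t k)) \<le> ennreal M" and M: "0 \<le> M"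
  shows "bounded_path (clamp_path T x) M"
proof
  have mem: "max 0 (min T t) \<in> {0..T}" for t using T by auto
  fix k t
  have "continuous_on UNIV (\<lambda>t. max 0 (min T t))" by (intro continuous_intros)
  then show "continuous_on UNIV (\<lambda>t. clamp_path T x t k)"
    unfolding clamp_path_def by (rule continuous_on_compose2[OF cont]) (use mem in blast)
  show "clamp_path T x t 0 = 0" "sqsum (\<lambda>k. enorm (clamp_path T x t k)) \<le> ennreal M"
    unfolding clamp_path_def by (rule zero[OF mem], rule sq[OF mem])
qed (rule M)

lemma kdv_rhs_cong: "v \<tau> = w \<tau> \<Longrightarrow> kdv_rhs v k \<tau> = kdv_rhs w k \<tau>"
  by (simp add: kdv_rhs_def)

lemma sqsum_finite_support:
  assumes "finite K" "\<And>k. k \<notin> K \<Longrightarrow> x k = 0"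
  shows "sqsum (\<lambda>k. enorm (x k)) = ennreal (\<Sum>k\<in>K. (cmod (x k))\<^sup>2)"
proof (rule antisym)
  show "sqsum (\<lambda>k. enorm (x k)) \<le> ennreal (\<Sum>k\<in>K. (cmod (x k))\<^sup>2)"
    unfolding sqsum_def
  proof (rule csum_le_const)
    fix F :: "int set" assume F: "finite F"
    have "(\<Sum>k\<in>F. (cmod (x k))\<^sup>2) = (\<Sum>k\<in>F \<inter> K. (cmod (x k))\<^sup>2)"
      using F assms(2) by (intro sum.mono_neutral_right) auto
    also have "\<dots> \<le> (\<Sum>k\<in>K. (cmod (x k))\<^sup>2)"
      using assms(1) by (intro sum_mono2) auto
    finally show "(\<Sum>k\<in>F. (enorm (x k))\<^sup>2) \<le> ennreal (\<Sum>k\<in>K. (cmod (x k))\<^sup>2)"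
      by (simp add: ennreal_power sum_ennreal ennreal_leI)
  qed
  show "ennreal (\<Sum>k\<in>K. (cmod (x k))\<^sup>2) \<le> sqsum (\<lambda>k. enorm (x k))"
    using csum_finite_le[OF assms(1), of "\<lambda>k. (enorm (x k))\<^sup>2"]
    by (simp add: sqsum_def ennreal_power sum_ennreal)
qed

text \<open>Conservation of the l2 norm. After k is replaced by -a, the sum is over triads a + b + c
  = 0, and the phase 3 a b (a + b) = -3 a b c is symmetric in them, so
  \<open>cubic_cancellation\<close> applies.\<close>

lemma galerkin_energy:
  assumes K: "finite K" and symK: "\<And>j. - j \<in> K \<longleftrightarrow> j \<in> K"
    and p: "\<And>j. p (- j) = cnj (p j)" "\<And>j. j \<notin> K \<Longrightarrow> p j = 0"
  shows "(\<Sum>k\<in>K. p (- k) * galerkin_form K t p k) = 0"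
proof -
  define f where "f a b = phase (3 * real_of_int (a * b * (a + b))) t * (p a * p b * p (- a - b))" for a b
  have "(\<Sum>k\<in>K. p (- k) * galerkin_form K t p k)
    = (\<Sum>a\<in>K. p a * galerkin_form K t p (- a))"
    by (rule sum.reindex_bij_witness[where i=uminus and j=uminus]) (auto simp: symK)
  also have "\<dots> = (\<Sum>a\<in>K. (- (1/2) * \<i>) * (\<Sum>b\<in>K. of_int a * f a b))"
  proof (rule sum.cong[OF refl])
    fix a
    have "phase (3 * real_of_int (- a * b * (- a - b))) t * (p b * p (- a - b)) * p a = f a b" for b
    proof -
      have "3 * real_of_int (- a * b * (- a - b)) = 3 * real_of_int (a * b * (a + b))"
        by (simp add: algebra_simps)
      then show ?thesis unfolding f_def by (simp only: mult_ac)
    qed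
    then have e: "p a * (\<Sum>b\<in>K. phase (3 * real_of_int (- a * b * (- a - b))) t * (p b * p (- a - b))) = (\<Sum>b\<in>K. f a b)"
      by (simp only: mult.commute[of "p a"] sum_distrib_right)
    have "p a * galerkin_form K t p (- a) = (- (1/2) * \<i>) * (of_int a *
       (p a * (\<Sum>b\<in>K. phase (3 * real_of_int (- a * b * (- a - b))) t * (p b * p (- a - b)))))"
      unfolding galerkin_form_def by simp
    then show "p a * galerkin_form K t p (- a) = (- (1/2) * \<i>) * (\<Sum>b\<in>K. of_int a * f a b)"
      unfolding e by (simp only: sum_distrib_left)
  qed
  also have "\<dots> = (- (1/2) * \<i>) * (\<Sum>a\<in>K. \<Sum>b\<in>K. of_int a * f a b)"
    by (simp only: sum_distrib_left)
  also have "(\<Sum>a\<in>K. \<Sum>b\<in>K. of_int a * f a b) = 0"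
  proof (rule cubic_cancellation[OF K])
    fix a b :: int
    have e1: "- a - b = - b - a" and e2: "a * b * (a + b) = b * a * (b + a)"
      by (simp_all add: algebra_simps)
    show "f a b = f b a" unfolding f_def e1 e2 mult.commute[of "p a" "p b"] ..
    have "p (- (- a - b) - b) = p a" by simp
    moreover have "(- a - b) * b * (- a - b + b) = a * b * (a + b)" by (simp add: algebra_simps)
    ultimately show "f a b = f (- a - b) b" unfolding f_def by (simp only: mult_ac)
    show "f a b = 0" if "- a - b \<notin> K" using p(2)[OF that] by (simp add: f_def)
  qed
  finally show ?thesis by simp
qed

text \<open>The vector field is made globally Lipschitz by the radial cut-off \<open>\<rho>\<close>. Rescaling by a real factor does
  not affect the conservation of energy, which in turn shows that the cut-off is never active.\<close>

lemma galerkin_solution: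
  fixes a :: "int \<Rightarrow> complex"
  assumes T: "0 \<le> T" and a: "a 0 = 0" "\<And>k. a (- k) = cnj (a k)" "\<And>k. int n < \<bar>k\<bar> \<Longrightarrow> a k = 0"
    and M: "(\<Sum>k\<in>{- int n..int n}. (cmod (a k))\<^sup>2) \<le> M"
  shows "\<exists>v. strong_solution T (\<lambda>k. if \<bar>k\<bar> \<le> int n then 1 else 0) M v \<and> v 0 = a \<and>
    (\<forall>t k. v t (- k) = cnj (v t k)) \<and> (\<forall>t k. int n < \<bar>k\<bar> \<longrightarrow> v t k = 0)"
proof -
  define K where "K = {- int n..int n}"
  have K: "finite K" and symK: "- j \<in> K \<longleftrightarrow> j \<in> K" for j by (auto simp: K_def)
  have M0: "0 \<le> M" by (rule order_trans[OF _ M]) (simp add: sum_nonneg)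
  \<comment> \<open>Energy at most M bounds each mode by sqrt M, so the l1 norm of the solution
    stays below R and the cut-off factor is 1 on it.\<close>
  define R where "R = real (card K) * sqrt M + 1"
  have R: "0 < R" using M0 by (simp add: R_def add_nonneg_pos)
  define N where "N x = (\<Sum>k\<in>K. cmod (x k))" for x :: "int \<Rightarrow> complex"
  define \<rho> where "\<rho> x = R / max R (N x)" for x
  define p where "p x k = (if k \<in> K then of_real (\<rho> x) * x k else 0)" for x k
  define F where "F t x k = galerkin_form K t (p x) k" for t x k
  \<comment> \<open>Prescribing the negative modes as conjugates of the positive ones builds the
    reality condition into the system. Once the solution is known to be real, G agrees with F along
    it.\<close>
  define G where "G t x k = (if k \<notin> K \<or> k = 0 then 0 else if 0 < k then F t x k else cnj (F t x (- k)))" for t x k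
  define C where "C = real n * R * 2"
  have C0: "0 \<le> C" using R by (simp add: C_def)
  have p_sum: "(\<Sum>k\<in>K. cmod (p x k)) \<le> R" for x
    using radial_cutoff_Lipschitz(1)[OF K R, of x] by (simp add: p_def \<rho>_def N_def)
  have p_lip: "(\<Sum>k\<in>K. cmod (p x k - p y k)) \<le> 2 * (\<Sum>k\<in>K. cmod (x k - y k))" for x y
    using radial_cutoff_Lipschitz(2)[OF K R, of x y] by (simp add: p_def \<rho>_def N_def)
  have F_lip: "cmod (F t x k - F t y k) \<le> C * (\<Sum>k\<in>K. cmod (x k - y k))" if k: "k \<in> K" for t x y k
  proof -
    have kn: "\<bar>real_of_int k\<bar> \<le> real n" using k by (auto simp: K_def)
    have "cmod (F t x k - F t y k) \<le> real n * R * (\<Sum>j\<in>K. cmod (p x j - p y j))"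
      unfolding F_def by (rule galerkin_form_Lipschitz[OF K k kn _ p_sum _ p_sum]) (simp_all add: p_def)
    also have "\<dots> \<le> real n * R * (2 * (\<Sum>k\<in>K. cmod (x k - y k)))"
      using R by (intro mult_left_mono p_lip) auto
    finally show ?thesis by (simp add: C_def mult.assoc)
  qed
  have G_lip: "cmod (G t x k - G t y k) \<le> C * (\<Sum>k\<in>K. cmod (x k - y k))" for t x y k
  proof -
    have nn: "0 \<le> C * (\<Sum>k\<in>K. cmod (x k - y k))" using C0 by (simp add: sum_nonneg)
    consider "k \<notin> K \<or> k = 0" | "k \<in> K" "0 < k" | "k \<in> K" "k < 0" by linarith
    then show ?thesis
    proof cases
      case 3
      then have "G t x k - G t y k = cnj (F t x (- k) - F t y (- k))" by (simp add: G_def)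
      then have "cmod (G t x k - G t y k) = cmod (F t x (- k) - F t y (- k))" by (simp only: complex_mod_cnj)
      then show ?thesis using F_lip[of "- k" t x y] 3 symK by simp
    qed (use nn F_lip in \<open>auto simp: G_def\<close>)
  qed
  define \<Lambda> where "\<Lambda> = real (card K) * C + 1"
  have \<Lambda>: "0 < \<Lambda>" using C0 by (simp add: \<Lambda>_def add_nonneg_pos)
  have lip: "(\<Sum>k\<in>K. cmod (G t x k - G t y k)) \<le> \<Lambda> * (\<Sum>k\<in>K. cmod (x k - y k))" for t x y
  proof -
    have "(\<Sum>k\<in>K. cmod (G t x k - G t y k)) \<le> (\<Sum>k\<in>K. C * (\<Sum>k\<in>K. cmod (x k - y k)))"
      by (rule sum_mono) (rule G_lip)
    also have "\<dots> = (real (card K) * C) * (\<Sum>k\<in>K. cmod (x k - y k))" by simp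
    also have "\<dots> \<le> \<Lambda> * (\<Sum>k\<in>K. cmod (x k - y k))"
      by (rule mult_right_mono) (simp_all add: \<Lambda>_def sum_nonneg)
    finally show ?thesis .
  qed
  have contp: "continuous_on {0..T} (\<lambda>t. p (x t) k)" if "\<And>k. continuous_on {0..T} (\<lambda>t. x t k)" for x k
  proof (cases "k \<in> K")
    case True
    have "continuous_on {0..T} (\<lambda>t. \<rho> (x t))"
      unfolding \<rho>_def N_def using R
      by (intro continuous_on_divide continuous_on_max continuous_on_const continuous_on_sum continuous_on_norm that) auto
    then show ?thesis
      using True by (simp add: p_def) (intro continuous_on_mult continuous_on_of_real that)
  qed (simp add: p_def)
  have contF: "continuous_on {0..T} (\<lambda>t. F t (x t) k)" if "\<And>k. continuous_on {0..T} (\<lambda>t. x t k)" for x k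
    unfolding F_def galerkin_form_def
    by (intro continuous_on_mult continuous_on_const continuous_on_sum continuous_on_phase contp that)
  have contG: "continuous_on {0..T} (\<lambda>t. G t (x t) k)" if "\<And>k. continuous_on {0..T} (\<lambda>t. x t k)" for x k
  proof -
    consider "k \<notin> K \<or> k = 0" | "k \<in> K" "0 < k" | "k \<in> K" "k < 0" by linarith
    then show ?thesis
    proof cases
      case 1
      then have e: "G t y k = 0" for t y by (simp add: G_def)
      show ?thesis unfolding e by (rule continuous_on_const)
    next
      case 2
      then have e: "G t y k = F t y k" for t y by (simp add: G_def)
      show ?thesis unfolding e by (rule contF[OF that])
    next
      case 3
      then have e: "G t y k = cnj (F t y (- k))" for t y by (simp add: G_def)
      show ?thesis unfolding e by (rule continuous_on_cnj[OF contF[OF that]])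
    qed
  qed
  have G_supp: "G t x k = 0" if "k \<notin> K" for t x k using that by (simp add: G_def)
  from picard_finite_system[where a=a, OF K T \<Lambda> contG lip G_supp]
  obtain x where x: "(\<forall>k. continuous_on {0..T} (\<lambda>t. x t k)) \<and>
    (\<forall>t\<in>{0..T}. \<forall>k. x t k = a k + integral {0..t} (\<lambda>\<tau>. G \<tau> (x \<tau>) k))"
    by (rule exE)
  note contx = x[THEN conjunct1, rule_format] and eqx = x[THEN conjunct2, rule_format]
  have G_cnj: "G t y (- k) = cnj (G t y k)" for t y k
    using symK by (auto simp: G_def)
  have x0: "x 0 = a" using eqx[of 0] T by (auto simp: fun_eq_iff)
  have x_cnj: "x t (- k) = cnj (x t k)" if t: "t \<in> {0..T}" for t k
  proof -
    have "continuous_on {0..t} (\<lambda>\<tau>. G \<tau> (x \<tau>) k)"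
      using t by (intro continuous_on_subset[OF contG[OF contx]]) auto
    then have "integral {0..t} (cnj \<circ> (\<lambda>\<tau>. G \<tau> (x \<tau>) k)) = cnj (integral {0..t} (\<lambda>\<tau>. G \<tau> (x \<tau>) k))"
      by (intro integral_linear integrable_continuous_real bounded_linear_cnj)
    then show ?thesis
      unfolding eqx[OF t, of "- k"] eqx[OF t, of k] by (simp add: G_cnj o_def a(2))
  qed
  have x_supp: "x t k = 0" if "t \<in> {0..T}" "k \<notin> K \<or> k = 0" for t k
  proof -
    have "a k = 0" using that(2) a(1) a(3)[of k] by (auto simp: K_def)
    then show ?thesis using eqx[OF that(1), of k] that(2) by (simp add: G_def)
  qed
  have p_cnj: "p (x t) (- k) = cnj (p (x t) k)" if "t \<in> {0..T}" for t k
    using x_cnj[OF that] symK by (simp add: p_def)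
  have GF: "G t (x t) k = F t (x t) k" if t: "t \<in> {0..T}" and k: "k \<in> K" for t k
  proof -
    have "F t (x t) (- k) = cnj (F t (x t) k)"
      unfolding F_def by (rule galerkin_form_cnj[where p="p (x t)", OF p_cnj[OF t] symK])
    moreover have "F t (x t) 0 = 0" by (simp add: F_def galerkin_form_def)
    ultimately show ?thesis using k by (auto simp: G_def)
  qed
  have deriv: "((\<lambda>t. x t k) has_vector_derivative G t (x t) k) (at t within {0..T})" if t: "t \<in> {0..T}" for t k
  proof -
    have "((\<lambda>t. a k + integral {0..t} (\<lambda>\<tau>. G \<tau> (x \<tau>) k)) has_vector_derivative 0 + G t (x t) k) (at t within {0..T})"
      by (intro has_vector_derivative_add has_vector_derivative_const integral_has_vector_derivative contG contx t)
    then have "((\<lambda>t. a k + integral {0..t} (\<lambda>\<tau>. G \<tau> (x \<tau>) k)) has_vector_derivative G t (x t) k) (at t within {0..T})"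
      by simp
    then show ?thesis
      by (rule has_vector_derivative_transform[OF t, rotated]) (rule eqx)
  qed
  \<comment> \<open>Written as a product of modes, the energy is differentiated by the product rule;
    the reality condition identifies it with the sum of squares.\<close>
  define E where "E t = (\<Sum>k\<in>K. x t k * x t (- k))" for t
  have E': "(E has_vector_derivative 0) (at t within {0..T})" if t: "t \<in> {0..T}" for t
  proof -
    have "(E has_vector_derivative (\<Sum>k\<in>K. x t k * G t (x t) (- k) + G t (x t) k * x t (- k))) (at t within {0..T})"
      unfolding E_def[abs_def]
      by (intro has_vector_derivative_sum has_vector_derivative_mult deriv t)
    moreover have "(\<Sum>k\<in>K. x t k * G t (x t) (- k) + G t (x t) k * x t (- k)) = 0"
    proof -
      have "(\<Sum>k\<in>K. x t k * G t (x t) (- k)) = (\<Sum>k\<in>K. x t (- k) * G t (x t) k)"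
        by (rule sum.reindex_bij_witness[where i=uminus and j=uminus]) (auto simp: symK)
      moreover have "(\<Sum>k\<in>K. x t (- k) * G t (x t) k) = 0"
      proof -
        have "max R (N (x t)) > 0" using R by simp
        then have \<rho>: "\<rho> (x t) \<noteq> 0" using R by (simp add: \<rho>_def)
        have "of_real (\<rho> (x t)) * (\<Sum>k\<in>K. x t (- k) * G t (x t) k) = (\<Sum>k\<in>K. p (x t) (- k) * galerkin_form K t (p (x t)) k)"
          unfolding sum_distrib_left
        proof (rule sum.cong[OF refl])
          fix k assume k: "k \<in> K"
          then show "of_real (\<rho> (x t)) * (x t (- k) * G t (x t) k) = p (x t) (- k) * galerkin_form K t (p (x t)) k"
            using GF[OF t k] symK by (simp add: p_def F_def)
        qed
        also have "\<dots> = 0"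
          by (rule galerkin_energy[where p="p (x t)", OF K symK p_cnj[OF t]]) (simp add: p_def)
        finally show ?thesis using \<rho> by simp
      qed
      ultimately show ?thesis by (simp add: sum.distrib mult.commute)
    qed
    ultimately show ?thesis by simp
  qed
  obtain e where e: "\<And>t. t \<in> {0..T} \<Longrightarrow> E t = e"
    using has_vector_derivative_zero_constant[of "{0..T}" E] E' by auto
  have E_eq: "E t = of_real (\<Sum>k\<in>K. (cmod (x t k))\<^sup>2)" if t: "t \<in> {0..T}" for t
    unfolding E_def of_real_sum x_cnj[OF t] by (simp only: complex_norm_square)
  have energy: "(\<Sum>k\<in>K. (cmod (x t k))\<^sup>2) \<le> M" if t: "t \<in> {0..T}" for t
  proof -
    have "E t = E 0" using e[OF t] e[of 0] T by simp
    then have "(\<Sum>k\<in>K. (cmod (x t k))\<^sup>2) = (\<Sum>k\<in>K. (cmod (x 0 k))\<^sup>2)"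
      using E_eq[OF t] E_eq[of 0] T by (metis atLeastAtMost_iff of_real_eq_iff order_refl)
    then show ?thesis using M by (simp add: x0 K_def)
  qed
  have \<rho>1: "\<rho> (x t) = 1" if t: "t \<in> {0..T}" for t
  proof -
    have "cmod (x t k) \<le> sqrt M" if "k \<in> K" for k
    proof -
      have "(cmod (x t k))\<^sup>2 \<le> (\<Sum>k\<in>K. (cmod (x t k))\<^sup>2)" using K that by (intro member_le_sum) auto
      then show ?thesis using energy[OF t] by (intro real_le_rsqrt) linarith
    qed
    then have "N (x t) \<le> (\<Sum>k\<in>K. sqrt M)" unfolding N_def by (rule sum_mono)
    then have "N (x t) \<le> R" by (simp add: R_def)
    then show ?thesis using R by (simp add: \<rho>_def)
  qed
  have px: "p (x t) = x t" if t: "t \<in> {0..T}" for t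
    using x_supp[OF t] by (auto simp: p_def fun_eq_iff \<rho>1[OF t])
  define v where "v = clamp_path T x"
  have mem: "max 0 (min T t) \<in> {0..T}" for t using T by auto
  have sq: "sqsum (\<lambda>k. enorm (x t k)) \<le> ennreal M" if t: "t \<in> {0..T}" for t
    using x_supp[OF t] energy[OF t] by (subst sqsum_finite_support[OF K]) (auto intro: ennreal_leI)
  have bp: "bounded_path v M"
    unfolding v_def by (rule clamp_path_bounded[OF T contx _ sq M0]) (simp add: x_supp)
  interpret bounded_path v M by (rule bp)
  define \<theta> :: "int \<Rightarrow> real" where "\<theta> k = (if \<bar>k\<bar> \<le> int n then 1 else 0)" for k
  define f where "f k \<tau> = (1/2) * \<i> * of_int k * of_real (\<theta> k) * kdv_rhs v k \<tau>" for k \<tau>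
  have fG: "f k \<tau> = G \<tau> (x \<tau>) k" if \<tau>: "\<tau> \<in> {0..T}" for k \<tau>
  proof (cases "k \<in> K")
    case True
    have v\<tau>: "v \<tau> = x \<tau>" using \<tau> by (simp add: v_def)
    have "(kdv_term v k \<tau> has_sum (\<Sum>j\<in>K. kdv_term v k \<tau> j)) UNIV"
      using K by (rule has_sum_finite_neutralI) (auto simp: kdv_term_def v\<tau> x_supp[OF \<tau>])
    then have "kdv_rhs v k \<tau> = (\<Sum>j\<in>K. kdv_term v k \<tau> j)"
      using kdv_rhs_has_sum has_sum_unique by blast
    moreover have "\<theta> k = 1" using True by (auto simp: \<theta>_def K_def)
    ultimately show ?thesis
      unfolding f_def GF[OF \<tau> True] F_def galerkin_form_def px[OF \<tau>] kdv_term_def v\<tau> by simp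
  next
    case False
    then have "\<theta> k = 0" by (auto simp: \<theta>_def K_def)
    then show ?thesis using False by (simp add: f_def G_def)
  qed
  have eqv: "v t k = v 0 k + (LINT \<tau>:{0..t}|lborel. f k \<tau>)" if t: "t \<in> {0..T}" for t k
  proof -
    have "f k \<in> borel_measurable borel" unfolding f_def[abs_def] by measurable
    moreover have "bounded (range (f k))"
      unfolding f_def[abs_def] by (intro bounded_range_mult bounded_kdv_rhs bounded_range_const)
    ultimately have "set_integrable lborel {0..t} (f k)" by (rule bounded_set_integrable)
    then have "(LINT \<tau>:{0..t}|lborel. f k \<tau>) = integral {0..t} (f k)"
      by (rule set_borel_integral_eq_integral(2))
    also have "\<dots> = integral {0..t} (\<lambda>\<tau>. G \<tau> (x \<tau>) k)"
      using t by (intro Henstock_Kurzweil_Integration.integral_cong fG) auto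
    finally show ?thesis
      using eqx[OF t, of k] t x0 T by (simp add: v_def)
  qed
  show ?thesis
  proof (intro exI[of _ v] conjI allI impI)
    show "strong_solution T (\<lambda>k. if \<bar>k\<bar> \<le> int n then 1 else 0) M v"
      unfolding strong_solution_def
    proof (intro conjI allI ballI bp)
      show "\<bar>if \<bar>k\<bar> \<le> int n then 1 else 0 :: real\<bar> \<le> 1" for k by simp
      show "v t k = v 0 k + (LINT \<tau>:{0..t}|lborel. (1/2) * \<i> * of_int k * of_real (if \<bar>k\<bar> \<le> int n then 1 else 0) * kdv_rhs v k \<tau>)"
        if "t \<in> {0..T}" for t k
        using eqv[OF that, of k] unfolding f_def \<theta>_def .
    qed
    show "v 0 = a" using T by (simp add: v_def x0)
    show "v t (- k) = cnj (v t k)" for t k unfolding v_def clamp_path_def by (rule x_cnj[OF mem])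
    show "v t k = 0" if "int n < \<bar>k\<bar>" for t k
      unfolding v_def clamp_path_def by (rule x_supp[OF mem]) (use that in \<open>auto simp: K_def\<close>)
  qed
qed

section \<open>Well-posedness\<close>

lemma hsq_tail:
  assumes "s \<le> s'" "0 < N"
  shows "hsq s f \<le> (\<Sum>k\<in>{- int N..int N}. (wt s k * enorm (f k))\<^sup>2) + ennreal (real N powr (- (2 * (s' - s)))) * hsq s' f"
proof -
  define b where "b = ennreal (real N powr (- (2 * (s' - s))))"
  have "(wt s k * enorm (f k))\<^sup>2 \<le> (wt s k * enorm (f k))\<^sup>2 * indicator {- int N..int N} k + b * (wt s' k * enorm (f k))\<^sup>2" for k
  proof (cases "k \<in> {- int N..int N}")
    case True
    then show ?thesis by (simp add: indicator_def)
  next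
    case False
    let ?k = "\<bar>real_of_int k\<bar>"
    have k: "real N \<le> ?k" "0 < ?k" using False assms(2) by auto
    have "?k powr s = ?k powr (- (s' - s)) * ?k powr s'" by (simp flip: powr_add)
    also have "\<dots> \<le> real N powr (- (s' - s)) * ?k powr s'"
      using k assms by (intro mult_right_mono powr_mono2') auto
    finally have "wt s k \<le> ennreal (real N powr (- (s' - s)) * ?k powr s')"
      unfolding wt_def by (rule ennreal_leI)
    also have "\<dots> = ennreal (real N powr (- (s' - s))) * wt s' k"
      unfolding wt_def by (rule ennreal_mult) auto
    finally have "(wt s k * enorm (f k))\<^sup>2 \<le> (ennreal (real N powr (- (s' - s))) * wt s' k * enorm (f k))\<^sup>2"
      by (intro power_mono mult_right_mono) auto
    also have "\<dots> = (ennreal (real N powr (- (s' - s))))\<^sup>2 * (wt s' k * enorm (f k))\<^sup>2"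
      by (simp only: power_mult_distrib mult.assoc)
    also have "(ennreal (real N powr (- (s' - s))))\<^sup>2 = b"
      unfolding b_def by (subst ennreal_power) (simp_all add: power2_eq_square flip: powr_add)
    finally show ?thesis using False by (simp add: indicator_def)
  qed
  then have "hsq s f \<le> (\<Sum>\<^sup>+k. (wt s k * enorm (f k))\<^sup>2 * indicator {- int N..int N} k + b * (wt s' k * enorm (f k))\<^sup>2)"
    unfolding hsq_def sqsum_def by (rule csum_mono)
  also have "\<dots> = (\<Sum>\<^sup>+k. (wt s k * enorm (f k))\<^sup>2 * indicator {- int N..int N} k) + b * hsq s' f"
    by (simp only: csum_add csum_cmult hsq_def sqsum_def)
  also have "(\<Sum>\<^sup>+k. (wt s k * enorm (f k))\<^sup>2 * indicator {- int N..int N} k) = (\<Sum>k\<in>{- int N..int N}. (wt s k * enorm (f k))\<^sup>2)"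
    by (subst nn_integral_indicator_finite) (auto simp: one_ennreal_def[symmetric])
  finally show ?thesis by (simp only: b_def)
qed

lemma wt_enorm_sq: "ennreal ((\<bar>real_of_int k\<bar> powr s * cmod x)\<^sup>2) = (wt s k * enorm x)\<^sup>2"
  unfolding wt_def by (subst ennreal_mult[symmetric]; simp add: ennreal_power)

text \<open>The compact embedding of H^s' into H^s for s < s': beyond N the norm is small uniformly
  by the bound in H^s', and below N only finitely many modes converge.\<close>

lemma hsq_tendsto_0:
  assumes "s < s'"
    and lim: "\<And>k. ((\<lambda>x. f x k) \<longlongrightarrow> 0) F"
    and bdd: "\<forall>\<^sub>F x in F. hsq s' (f x) \<le> ennreal B" and B: "0 \<le> B"
  shows "((\<lambda>x. hsq s (f x)) \<longlongrightarrow> 0) F"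
proof (rule order_tendstoI)
  fix a :: ennreal assume a: "0 < a"
  obtain e where e: "0 < e" "ennreal e < a"
  proof -
    obtain c where "0 < c" "c < a" using dense[OF a] by blast
    then show ?thesis using that[of "enn2real c"] by (metis enn2real_positive_iff ennreal_enn2real less_trans top.not_eq_extremum)
  qed
  have "((\<lambda>N. real N powr (- (2 * (s' - s))) * B) \<longlongrightarrow> 0 * B) sequentially"
    using assms(1) by (intro tendsto_mult tendsto_const tendsto_neg_powr filterlim_real_sequentially) auto
  then have "\<forall>\<^sub>F N in sequentially. real N powr (- (2 * (s' - s))) * B < e / 2"
    using e(1) by (intro order_tendstoD) auto
  then obtain N0 where "\<forall>N\<ge>N0. real N powr (- (2 * (s' - s))) * B < e / 2"
    unfolding eventually_sequentially by blast
  then obtain N where N: "real N powr (- (2 * (s' - s))) * B < e / 2" "0 < N"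
    by (metis le_add1 le_add2 less_one less_le_trans zero_less_one)
  have "((\<lambda>x. \<Sum>k\<in>{- int N..int N}. (wt s k * enorm (f x k))\<^sup>2) \<longlongrightarrow> (\<Sum>k\<in>{- int N..int N}. 0)) F"
  proof (rule tendsto_sum)
    fix k
    have "((\<lambda>x. ennreal ((\<bar>real_of_int k\<bar> powr s * cmod (f x k))\<^sup>2)) \<longlongrightarrow> ennreal ((\<bar>real_of_int k\<bar> powr s * cmod 0)\<^sup>2)) F"
      by (intro tendsto_ennrealI tendsto_power tendsto_mult tendsto_const tendsto_norm lim)
    then show "((\<lambda>x. (wt s k * enorm (f x k))\<^sup>2) \<longlongrightarrow> 0) F"
      unfolding wt_enorm_sq by simp
  qed
  then have "\<forall>\<^sub>F x in F. (\<Sum>k\<in>{- int N..int N}. (wt s k * enorm (f x k))\<^sup>2) < ennreal (e / 2)"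
    using e(1) by (intro order_tendstoD) auto
  with bdd show "\<forall>\<^sub>F x in F. hsq s (f x) < a"
  proof eventually_elim
    case (elim x)
    have "hsq s (f x) \<le> (\<Sum>k\<in>{- int N..int N}. (wt s k * enorm (f x k))\<^sup>2) + ennreal (real N powr (- (2 * (s' - s)))) * hsq s' (f x)"
      using assms(1) N(2) by (intro hsq_tail) auto
    also have "\<dots> \<le> ennreal (e / 2) + ennreal (real N powr (- (2 * (s' - s)))) * ennreal B"
      using elim by (intro add_mono mult_left_mono) auto
    also have "\<dots> = ennreal (e / 2 + real N powr (- (2 * (s' - s))) * B)"
      using e(1) B by (simp add: ennreal_mult)
    also have "\<dots> \<le> ennreal e" using N(1) by (intro ennreal_leI) auto
    also have "\<dots> < a" by (rule e(2))
    finally show ?case .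
  qed
qed auto

text \<open>The Fatou property, read off from finite partial sums.\<close>

lemma hsq_lower_semicontinuous:
  assumes lim: "\<And>k. (\<lambda>n. f n k) \<longlonglongrightarrow> g k" and bdd: "\<And>n. hsq s (f n) \<le> C"
  shows "hsq s g \<le> C"
  unfolding hsq_def sqsum_def
proof (rule csum_le_const)
  fix F :: "int set" assume F: "finite F"
  have "(\<lambda>n. \<Sum>k\<in>F. (wt s k * enorm (f n k))\<^sup>2) \<longlonglongrightarrow> (\<Sum>k\<in>F. (wt s k * enorm (g k))\<^sup>2)"
  proof (rule tendsto_sum)
    fix k
    have "(\<lambda>n. ennreal ((\<bar>real_of_int k\<bar> powr s * cmod (f n k))\<^sup>2)) \<longlonglongrightarrow> ennreal ((\<bar>real_of_int k\<bar> powr s * cmod (g k))\<^sup>2)"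
      by (intro tendsto_ennrealI tendsto_power tendsto_mult tendsto_const tendsto_norm lim)
    then show "(\<lambda>n. (wt s k * enorm (f n k))\<^sup>2) \<longlonglongrightarrow> (wt s k * enorm (g k))\<^sup>2"
      unfolding wt_enorm_sq .
  qed
  moreover have "(\<Sum>k\<in>F. (wt s k * enorm (f n k))\<^sup>2) \<le> C" for n
    using csum_finite_le[OF F] bdd[of n] unfolding hsq_def sqsum_def by (rule order_trans)
  ultimately show "(\<Sum>k\<in>F. (wt s k * enorm (g k))\<^sup>2) \<le> C"
    by (intro Lim_bounded[where M=0]) auto
qed

section \<open>Solutions in the sense of the definition and strong solutions\<close>

lemma integral_point: "(LINT x:{0..0::real}|lborel. f x) = (0 :: complex)"
  unfolding set_lebesgue_integral_def
proof (rule integral_eq_zero_AE)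
  show "AE x in lborel. indicator {0..0::real} x *\<^sub>R f x = 0"
    using AE_lborel_singleton[of 0] by eventually_elim (auto simp: indicator_def)
qed

lemma AE_interval_witness:
  fixes a b :: real
  assumes "AE x in lborel. P x" "a < b"
  obtains x where "x \<in> {a<..<b}" "P x"
proof (rule ccontr)
  assume "\<not> thesis"
  then have "\<And>x. P x \<Longrightarrow> x \<notin> {a<..<b}" using that by blast
  with assms(1) have "AE x in lborel. x \<notin> {a<..<b}" by (auto elim: eventually_mono)
  moreover have e: "{a<..<b} = {x. a < x \<and> x < b}" by auto
  ultimately have "emeasure lborel {a<..<b} = 0" by (subst (asm) AE_iff_measurable[OF _ refl]) (auto simp: e)
  then show False using assms(2) by simp
qed

text \<open>The definition bounds the norm for almost every time only. The integral equation makes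
  each mode continuous, so finite partial sums of squares satisfy the bound at every time, and then
  the full sum does.\<close>

lemma kdv_solution_strong:
  assumes T: "0 < T" and sol: "kdv_solution T v0 v" and v00: "v0 0 = 0"
  obtains M where "strong_solution T (\<lambda>_. 1) M (clamp_path T v)" "v 0 = v0"
proof -
  have H: "\<And>t. t \<in> {0..T} \<Longrightarrow> v t \<in> Hdot 0"
    using sol unfolding kdv_solution_def by blast
  obtain M where M: "AE t in lborel. t \<in> {0..T} \<longrightarrow> hs_norm 0 (v t) \<le> M"
    using sol unfolding kdv_solution_def by blast
  have int: "set_integrable lborel {0..t} (kdv_rhs v k)"
    and eq: "v t k - v0 k = (1/2) * \<i> * of_int k * (LINT \<tau>:{0..t}|lborel. kdv_rhs v k \<tau>)"
    if "k \<noteq> 0" "t \<in> {0..T}" for k t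
    using sol that unfolding kdv_solution_def by blast+
  have zero: "v t 0 = 0" if "t \<in> {0..T}" for t using H[OF that] by (simp add: Hdot_iff)
  have v0: "v 0 = v0"
  proof
    fix k show "v 0 k = v0 k"
    proof (cases "k = 0")
      case False
      then show ?thesis using eq[OF False, of 0] T integral_point[of "kdv_rhs v k"] by simp
    qed (use zero[of 0] v00 T in simp)
  qed
  have cont: "continuous_on {0..T} (\<lambda>t. v t k)" for k
  proof (cases "k = 0")
    case True
    have "continuous_on {0..T} (\<lambda>t. 0 :: complex)" by simp
    then show ?thesis by (rule continuous_on_eq) (simp add: True zero)
  next
    case False
    have "kdv_rhs v k integrable_on {0..T}"
      using T by (intro set_borel_integral_eq_integral(1) int False) auto
    then have "continuous_on {0..T} (\<lambda>t. v0 k + (1/2) * \<i> * of_int k * integral {0..t} (kdv_rhs v k))"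
      by (intro continuous_on_add continuous_on_mult continuous_on_const indefinite_integral_continuous_1)
    then show ?thesis
    proof (rule continuous_on_eq)
      fix t assume t: "t \<in> {0..T}"
      show "v0 k + (1/2) * \<i> * of_int k * integral {0..t} (kdv_rhs v k) = v t k"
        using eq[OF False t, unfolded diff_eq_eq] unfolding set_borel_integral_eq_integral(2)[OF int[OF False t]]
        by (simp only: add.commute)
    qed
  qed
  have fin: "(\<Sum>k\<in>F. (cmod (v t k))\<^sup>2) \<le> M\<^sup>2" if F: "finite F" and t: "t \<in> {0..T}" for F t
  proof (rule ccontr)
    assume neg: "\<not> ?thesis"
    define g where "g s = (\<Sum>k\<in>F. (cmod (v s k))\<^sup>2)" for s
    have gt: "M\<^sup>2 < g t" using neg by (simp add: g_def)
    have "continuous_on {0..T} g"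
      unfolding g_def by (intro continuous_on_sum continuous_on_power continuous_on_norm cont)
    then have "(g \<longlongrightarrow> g t) (at t within {0..T})" using t by (simp add: continuous_on_def)
    then have "\<forall>\<^sub>F s in at t within {0..T}. M\<^sup>2 < g s" using gt by (rule order_tendstoD)
    then obtain d where d: "0 < d" "\<And>s. s \<in> {0..T} \<Longrightarrow> s \<noteq> t \<Longrightarrow> dist s t < d \<Longrightarrow> M\<^sup>2 < g s"
      unfolding eventually_at by blast
    \<comment> \<open>Cut to the interior of [0, T], the neighbourhood of t is a nonempty open
      interval even at the endpoints, so it contains a time at which the almost everywhere bound
      holds.\<close>
    have "max 0 (t - d) < min T (t + d)" using t T d(1) by auto
    from AE_interval_witness[OF M this]
    obtain s where s: "s \<in> {max 0 (t - d)<..<min T (t + d)}" "s \<in> {0..T} \<longrightarrow> hs_norm 0 (v s) \<le> M"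
      by blast
    have sT: "s \<in> {0..T}" and "dist s t < d" using s(1) by (auto simp: dist_real_def)
    then have "M\<^sup>2 < g s" using d(2)[OF sT] gt by (cases "s = t") auto
    also have "g s \<le> M\<^sup>2"
    proof -
      have "ennreal (g s) = (\<Sum>k\<in>F. (enorm (v s k))\<^sup>2)" by (simp add: g_def ennreal_power sum_ennreal)
      also have "\<dots> \<le> sqsum (\<lambda>k. enorm (v s k))" unfolding sqsum_def by (rule csum_finite_le[OF F])
      also have "\<dots> = hsq 0 (v s)" using zero[OF sT] by (simp add: hsq_zero_exponent)
      also have "\<dots> = ennreal ((hs_norm 0 (v s))\<^sup>2)"
        using H[OF sT] by (intro hsq_hs_norm) (simp add: Hdot_iff)
      finally have "g s \<le> (hs_norm 0 (v s))\<^sup>2" by (simp add: ennreal_le_iff)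
      also have "\<dots> \<le> M\<^sup>2" using s(2) sT hs_norm_nonneg by (intro power_mono) auto
      finally show ?thesis .
    qed
    finally show False by simp
  qed
  have bp: "bounded_path (clamp_path T v) (M\<^sup>2)"
  proof (rule clamp_path_bounded[where x=v, OF _ cont zero])
    fix t assume t: "t \<in> {0..T}"
    show "sqsum (\<lambda>k. enorm (v t k)) \<le> ennreal (M\<^sup>2)"
      unfolding sqsum_def
    proof (rule csum_le_const)
      fix F :: "int set" assume F: "finite F"
      show "(\<Sum>k\<in>F. (enorm (v t k))\<^sup>2) \<le> ennreal (M\<^sup>2)"
        using ennreal_leI[OF fin[OF F t]] by (simp add: ennreal_power sum_ennreal)
    qed
  qed (use T in auto)
  have "strong_solution T (\<lambda>_. 1) (M\<^sup>2) (clamp_path T v)"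
    unfolding strong_solution_def
  proof (intro conjI allI ballI bp)
    fix k t assume t: "t \<in> {0..T}"
    have z: "(0::real) \<in> {0..T}" using T by auto
    have "(LINT \<tau>:{0..t}|lborel. 1 / 2 * \<i> * of_int k * of_real 1 * kdv_rhs (clamp_path T v) k \<tau>)
      = (LINT \<tau>:{0..t}|lborel. 1 / 2 * \<i> * of_int k * kdv_rhs v k \<tau>)"
    proof (rule set_lebesgue_integral_cong)
      show "\<forall>\<tau>. \<tau> \<in> {0..t} \<longrightarrow> 1 / 2 * \<i> * of_int k * of_real 1 * kdv_rhs (clamp_path T v) k \<tau> = 1 / 2 * \<i> * of_int k * kdv_rhs v k \<tau>"
      proof (intro allI impI)
        fix \<tau> assume "\<tau> \<in> {0..t}"
        then have "clamp_path T v \<tau> = v \<tau>" using t by (intro clamp_path_inside) auto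
        then have "kdv_rhs (clamp_path T v) k \<tau> = kdv_rhs v k \<tau>" by (rule kdv_rhs_cong)
        then show "1 / 2 * \<i> * of_int k * of_real 1 * kdv_rhs (clamp_path T v) k \<tau> = 1 / 2 * \<i> * of_int k * kdv_rhs v k \<tau>"
          by simp
      qed
    qed simp
    also have "\<dots> = 1 / 2 * \<i> * of_int k * (LINT \<tau>:{0..t}|lborel. kdv_rhs v k \<tau>)"
      by (rule set_integral_mult_right)
    also have "\<dots> = v t k - v0 k"
      using eq[of k t] t zero[OF t] v00 by (cases "k = 0") auto
    finally have e: "(LINT \<tau>:{0..t}|lborel. 1 / 2 * \<i> * of_int k * of_real 1 * kdv_rhs (clamp_path T v) k \<tau>) = v t k - v0 k" .
    show "clamp_path T v t k = clamp_path T v 0 k + (LINT \<tau>:{0..t}|lborel. 1 / 2 * \<i> * of_int k * of_real 1 * kdv_rhs (clamp_path T v) k \<tau>)"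
      unfolding clamp_path_inside[OF t] clamp_path_inside[OF z] v0 e by simp
  qed simp
  then show ?thesis using v0 by (rule that)
qed

lemma strong_solution_kdv:
  assumes sol: "strong_solution T (\<lambda>_. 1) M v" and real: "\<And>t k. v t (- k) = cnj (v t k)"
  shows "kdv_solution T (v 0) v"
proof -
  interpret bounded_path v M by (rule strong_solutionD[OF sol])
  have h: "hsq 0 (v t) \<le> ennreal M" for t using sq_bound by (simp add: hsq_zero_exponent)
  have H: "v t \<in> Hdot 0" for t
    unfolding Hdot_iff using zero real h[of t] by (auto intro: le_less_trans ennreal_less_top)
  have nrm: "hs_norm 0 (v t) \<le> sqrt M" for t
    using h[of t] M_nonneg by (intro hs_norm_leI) auto
  have int: "set_integrable lborel {0..t} (kdv_rhs v k)" for t k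
    by (intro bounded_set_integrable kdv_rhs_measurable bounded_kdv_rhs)
  have eq: "v t k - v 0 k = (1/2) * \<i> * of_int k * (LINT \<tau>:{0..t}|lborel. kdv_rhs v k \<tau>)" if "t \<in> {0..T}" for t k
  proof -
    have "v t k - v 0 k = (LINT \<tau>:{0..t}|lborel. 1 / 2 * \<i> * of_int k * of_real 1 * kdv_rhs v k \<tau>)"
      using strong_solutionD(3)[OF sol that, of k] by (simp only: add_diff_cancel_left')
    then show ?thesis by (simp only: set_integral_mult_right of_real_1 mult_1_right)
  qed
  show ?thesis
    unfolding kdv_solution_def using H nrm int eq by (intro conjI ballI allI impI exI[of _ "sqrt M"] AE_I2)
qed

text \<open>Equicontinuity of each mode: the constant depends on k and M but not on \<theta>, hence
  not on the order of a Galerkin truncation.\<close>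

lemma strong_solution_Lipschitz_in_time:
  assumes sol: "strong_solution T \<theta> M v" and t: "0 \<le> t" "t \<le> t'" "t' \<le> T"
  shows "cmod (v t' k - v t k) \<le> \<bar>real_of_int k\<bar> * M * (t' - t)"
proof -
  interpret bounded_path v M by (rule strong_solutionD[OF sol])
  define f where "f \<tau> = (1/2) * \<i> * of_int k * of_real (\<theta> k) * kdv_rhs v k \<tau>" for \<tau>
  have si: "set_integrable lborel {0..s} f" for s
    unfolding f_def[abs_def]
    by (intro bounded_set_integrable bounded_range_mult bounded_range_const bounded_kdv_rhs) measurable
  have e: "v s k = v 0 k + integral {0..s} f" if "s \<in> {0..T}" for s
    using strong_solutionD(3)[OF sol that, of k, folded f_def] set_borel_integral_eq_integral(2)[OF si] by simp
  have io: "f integrable_on {0..t'}" by (rule set_borel_integral_eq_integral(1)[OF si])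
  have "integral {0..t} f + integral {t..t'} f = integral {0..t'} f"
    using t io by (intro Henstock_Kurzweil_Integration.integral_combine) auto
  then have "v t' k - v t k = integral {t..t'} f"
    using e[of t'] e[of t] t by (simp add: algebra_simps)
  moreover have "norm (integral {t..t'} f) \<le> (\<bar>real_of_int k\<bar> * M) * measure lborel {t..t'}"
  proof (rule has_integral_bound_real[where S="{}"])
    show "0 \<le> \<bar>real_of_int k\<bar> * M" using M_nonneg by simp
    show "(f has_integral integral {t..t'} f) {t..t'}"
      using t by (intro integrable_integral integrable_on_subinterval[OF io]) auto
    show "norm (f x) \<le> \<bar>real_of_int k\<bar> * M" for x
    proof -
      have "norm (f x) = \<bar>real_of_int k\<bar> / 2 * \<bar>\<theta> k\<bar> * cmod (kdv_rhs v k x)"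
        unfolding f_def by (simp only: norm_mult) simp
      also have "\<dots> \<le> \<bar>real_of_int k\<bar> * 1 * M"
        by (intro mult_mono strong_solutionD(2)[OF sol] norm_kdv_rhs) auto
      finally show "norm (f x) \<le> \<bar>real_of_int k\<bar> * M" by simp
    qed
  qed simp
  ultimately show ?thesis using t by simp
qed

section \<open>Passage to the limit in the Galerkin approximations\<close>

definition truncation :: "nat \<Rightarrow> (int \<Rightarrow> complex) \<Rightarrow> int \<Rightarrow> complex"
  where "truncation n a k = (if \<bar>k\<bar> \<le> int n then a k else 0)"

lemma hsq_cong_le: "(\<And>k. cmod (f k) \<le> cmod (g k)) \<Longrightarrow> hsq s f \<le> hsq s g"
  unfolding hsq_def by (intro sqsum_mono mult_left_mono ennreal_leI) auto

lemma hsq_truncation_le: "hsq s (truncation n a) \<le> hsq s a"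
  by (rule hsq_cong_le) (simp add: truncation_def)

lemma hsq_finite_support:
  assumes "s \<le> 1" "f 0 = 0" "\<And>k. int n < \<bar>k\<bar> \<Longrightarrow> f k = 0"
  shows "hsq s f \<le> ennreal ((real n)\<^sup>2) * hsq 0 f"
proof -
  have "wt s k * enorm (f k) \<le> ennreal (real n) * (wt 0 k * enorm (f k))" for k
  proof (cases "k = 0 \<or> int n < \<bar>k\<bar>")
    case True
    then show ?thesis using assms(2,3) by auto
  next
    case False
    have "wt s k \<le> wt 1 k" using assms(1) by (rule wt_mono)
    also have "\<dots> \<le> ennreal (real n)" unfolding wt_def using False by (intro ennreal_leI) auto
    finally show ?thesis using False by (simp add: wt_zero_exponent mult_right_mono)
  qed
  then have "hsq s f \<le> sqsum (\<lambda>k. ennreal (real n) * (wt 0 k * enorm (f k)))"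
    unfolding hsq_def by (rule sqsum_mono)
  also have "\<dots> = ennreal ((real n)\<^sup>2) * hsq 0 f"
    unfolding sqsum_cmult hsq_def by (simp add: ennreal_power)
  finally show ?thesis .
qed

lemma truncation_tendsto:
  assumes "hsq s a < top"
  shows "(\<lambda>n. hsq s (\<lambda>k. a k - truncation n a k)) \<longlonglongrightarrow> 0"
proof -
  have "(\<lambda>n. \<Sum>\<^sup>+k. (wt s k * enorm (a k - truncation n a k))\<^sup>2) \<longlonglongrightarrow> (\<Sum>\<^sup>+k::int. 0)"
  proof (rule nn_integral_dominated_convergence[where w="\<lambda>k. (wt s k * enorm (a k))\<^sup>2"])
    show "AE k in count_space UNIV. (wt s k * enorm (a k - truncation n a k))\<^sup>2 \<le> (wt s k * enorm (a k))\<^sup>2" for n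
      by (intro AE_I2 power_mono mult_left_mono ennreal_leI) (auto simp: truncation_def)
    show "(\<Sum>\<^sup>+k. (wt s k * enorm (a k))\<^sup>2) < \<infinity>" using assms by (simp add: hsq_def sqsum_def)
    show "AE k in count_space UNIV. (\<lambda>n. (wt s k * enorm (a k - truncation n a k))\<^sup>2) \<longlonglongrightarrow> 0"
    proof (rule AE_I2)
      fix k
      have "\<forall>\<^sub>F n in sequentially. (wt s k * enorm (a k - truncation n a k))\<^sup>2 = 0"
        using eventually_ge_at_top[of "nat \<bar>k\<bar>"] by eventually_elim (auto simp: truncation_def)
      then show "(\<lambda>n. (wt s k * enorm (a k - truncation n a k))\<^sup>2) \<longlonglongrightarrow> 0" by (rule tendsto_eventually)
    qed
  qed auto
  then show ?thesis by (simp add: hsq_def sqsum_def)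
qed

text \<open>The half of Arzela-Ascoli that follows the choice of a subsequence: equi-Lipschitz
  functions converging at the rational times converge everywhere.\<close>

lemma Cauchy_from_dense:
  fixes f :: "nat \<Rightarrow> real \<Rightarrow> complex"
  assumes T: "0 < T" and L: "0 \<le> L"
    and lip: "\<And>n t t'. t \<in> {0..T} \<Longrightarrow> t' \<in> {0..T} \<Longrightarrow> cmod (f n t - f n t') \<le> L * \<bar>t - t'\<bar>"
    and conv: "\<And>q. q \<in> {0..T} \<Longrightarrow> q \<in> \<rat> \<Longrightarrow> convergent (\<lambda>n. f n q)"
    and t: "t \<in> {0..T}"
  shows "convergent (\<lambda>n. f n t)"
proof -
  have "Cauchy (\<lambda>n. f n t)"
  proof (rule CauchyI)
    fix e :: real assume e: "0 < e"
    define d where "d = e / (3 * (L + 1))"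
    have d: "0 < d" "L * d < e / 3" using e L by (auto simp: d_def field_simps)
    have "max 0 (t - d) < min T (t + d)" using t T d by auto
    then obtain q where q: "q \<in> \<rat>" "max 0 (t - d) < q" "q < min T (t + d)"
      using Rats_dense_in_real by blast
    have qT: "q \<in> {0..T}" and qd: "\<bar>t - q\<bar> \<le> d" using q by auto
    have "Cauchy (\<lambda>n. f n q)" using conv[OF qT q(1)] by (rule convergent_Cauchy)
    then obtain m where m: "\<And>i j. m \<le> i \<Longrightarrow> m \<le> j \<Longrightarrow> cmod (f i q - f j q) < e / 3"
      using CauchyD[of "\<lambda>n. f n q" "e / 3"] e by auto
    have near: "cmod (f i t - f i q) < e / 3" for i
    proof -
      have "cmod (f i t - f i q) \<le> L * \<bar>t - q\<bar>" by (rule lip[OF t qT])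
      also have "\<dots> \<le> L * d" using qd L by (rule mult_left_mono)
      finally show ?thesis using d(2) by linarith
    qed
    have "cmod (f i t - f j t) < e" if "m \<le> i" "m \<le> j" for i j
    proof -
      have "cmod (f i t - f j t) \<le> cmod (f i t - f i q) + cmod (f i q - f j q) + cmod (f j t - f j q)"
        by norm
      then show ?thesis using near[of i] near[of j] m[OF that] by linarith
    qed
    then show "\<exists>m. \<forall>i\<ge>m. \<forall>j\<ge>m. cmod (f i t - f j t) < e" by blast
  qed
  then show ?thesis by (rule Cauchy_convergent)
qed

text \<open>The nonlinearity is continuous in l2 at each frequency; convergence mode by mode would
  not control its infinite quadratic sum. The constant is 2 * 2 times the bound 4 M for u.\<close>

lemma kdv_rhs_diff_sq:
  assumes "bounded_path v M" "bounded_path v' M"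
  shows "(enorm (kdv_rhs v k \<tau> - kdv_rhs v' k \<tau>))\<^sup>2 \<le> ennreal (16 * M) * sqsum (\<lambda>k. enorm (v \<tau> k - v' \<tau> k))"
proof -
  interpret v: bounded_path v M by fact
  interpret v': bounded_path v' M by fact
  interpret path_pair v v' M ..
  have u: "sqsum (u \<tau>) \<le> ennreal (4 * M)"
  proof -
    have "sqsum (u \<tau>) \<le> 2 * (sqsum (\<lambda>k. enorm (v \<tau> k)) + sqsum (\<lambda>k. enorm (v' \<tau> k)))"
      unfolding u_def by (rule sqsum_add2)
    also have "\<dots> \<le> 2 * (ennreal M + ennreal M)" by (intro mult_left_mono add_mono v.sq_bound v'.sq_bound) auto
    also have "\<dots> = ennreal (4 * M)" using v.M_nonneg by (simp add: ennreal_real_ops)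
    finally show ?thesis .
  qed
  have "(enorm (kdv_rhs v k \<tau> - kdv_rhs v' k \<tau>))\<^sup>2 \<le> (pf.Zc \<tau> k)\<^sup>2"
    by (intro power_mono kdv_rhs_diff_le_Zc) simp
  also have "\<dots> \<le> 2 * ((conv (z \<tau>) (u \<tau>) k)\<^sup>2 + (conv (u \<tau>) (z \<tau>) k)\<^sup>2)"
    unfolding pf.Zc_def by (rule ennreal_sum2_sq)
  also have "\<dots> \<le> 2 * (sqsum (z \<tau>) * sqsum (u \<tau>) + sqsum (u \<tau>) * sqsum (z \<tau>))"
    unfolding conv_def by (intro mult_left_mono add_mono convolution_Cauchy_Schwarz) auto
  also have "\<dots> = (2 * 2) * (sqsum (u \<tau>) * sqsum (z \<tau>))"
    by (simp only: mult_2 distrib_left distrib_right mult.commute[of "sqsum (z \<tau>)"] mult.assoc mult_1 one_add_one[symmetric])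
  also have "\<dots> \<le> (2 * 2) * (ennreal (4 * M) * sqsum (z \<tau>))"
    by (intro mult_left_mono mult_right_mono u) auto
  also have "\<dots> = ennreal (16 * M) * sqsum (z \<tau>)"
    unfolding mult.assoc[symmetric] using v.M_nonneg by (simp add: ennreal_real_ops)
  finally show ?thesis by (simp only: z_def[abs_def])
qed

text \<open>Strong convergence at each time yields pointwise convergence of the integrands, and the
  common bound |k| M allows dominated convergence.\<close>

lemma strong_solution_limit:
  fixes V :: "nat \<Rightarrow> real \<Rightarrow> int \<Rightarrow> complex"
  assumes sol: "\<And>n. strong_solution T (\<theta> n) M (V n)" and bv: "bounded_path v M"
    and th: "\<And>k. \<forall>\<^sub>F n in sequentially. \<theta> n k = 1"
    and lim: "\<And>t k. t \<in> {0..T} \<Longrightarrow> (\<lambda>n. V n t k) \<longlonglongrightarrow> v t k"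
    and l2: "\<And>t. t \<in> {0..T} \<Longrightarrow> (\<lambda>n. sqsum (\<lambda>k. enorm (V n t k - v t k))) \<longlonglongrightarrow> 0"
  shows "strong_solution T (\<lambda>_. 1) M v"
  unfolding strong_solution_def
proof (intro conjI allI ballI bv)
  fix k t assume t: "t \<in> {0..T}"
  have bV: "bounded_path (V n) M" for n by (rule strong_solutionD[OF sol])
  interpret v: bounded_path v M by (rule bv)
  define f where "f n \<tau> = (1/2) * \<i> * of_int k * of_real (\<theta> n k) * kdv_rhs (V n) k \<tau>" for n \<tau>
  define g where "g \<tau> = (1/2) * \<i> * of_int k * of_real 1 * kdv_rhs v k \<tau>" for \<tau>
  have rhs: "(\<lambda>n. kdv_rhs (V n) k \<tau>) \<longlonglongrightarrow> kdv_rhs v k \<tau>" if \<tau>: "\<tau> \<in> {0..T}" for \<tau>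
  proof -
    have "(\<lambda>n. ennreal (16 * M) * sqsum (\<lambda>k. enorm (V n \<tau> k - v \<tau> k))) \<longlonglongrightarrow> ennreal (16 * M) * 0"
      by (rule ennreal_tendsto_cmult[OF _ l2[OF \<tau>]]) simp
    then have h0: "(\<lambda>n. ennreal (16 * M) * sqsum (\<lambda>k. enorm (V n \<tau> k - v \<tau> k))) \<longlonglongrightarrow> 0"
      by (simp only: mult_zero_right)
    have "(\<lambda>n. (enorm (kdv_rhs (V n) k \<tau> - kdv_rhs v k \<tau>))\<^sup>2) \<longlonglongrightarrow> 0"
    proof (rule tendsto_sandwich[OF _ _ tendsto_const h0])
      show "\<forall>\<^sub>F n in sequentially. (enorm (kdv_rhs (V n) k \<tau> - kdv_rhs v k \<tau>))\<^sup>2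
          \<le> ennreal (16 * M) * sqsum (\<lambda>k. enorm (V n \<tau> k - v \<tau> k))"
        by (rule always_eventually[OF allI[OF kdv_rhs_diff_sq[OF bV bv]]])
    qed simp
    then have "(\<lambda>n. ennreal ((cmod (kdv_rhs (V n) k \<tau> - kdv_rhs v k \<tau>))\<^sup>2)) \<longlonglongrightarrow> ennreal 0"
      by (simp add: ennreal_power)
    then have "(\<lambda>n. (cmod (kdv_rhs (V n) k \<tau> - kdv_rhs v k \<tau>))\<^sup>2) \<longlonglongrightarrow> 0"
      by (subst (asm) tendsto_ennreal_iff) auto
    then have "(\<lambda>n. cmod (kdv_rhs (V n) k \<tau> - kdv_rhs v k \<tau>)) \<longlonglongrightarrow> 0"
      by (subst (asm) power_tendsto_0_iff) auto
    then show ?thesis by (rule LIM_zero_cancel[OF tendsto_norm_zero_cancel])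
  qed
  have mf: "f n \<in> borel_measurable borel" for n
  proof -
    interpret V: bounded_path "V n" M by (rule bV)
    show ?thesis unfolding f_def[abs_def] by measurable
  qed
  have "(\<lambda>n. LINT \<tau>|lborel. indicator {0..t} \<tau> *\<^sub>R f n \<tau>) \<longlonglongrightarrow> (LINT \<tau>|lborel. indicator {0..t} \<tau> *\<^sub>R g \<tau>)"
  proof (rule integral_dominated_convergence[where w="\<lambda>\<tau>. indicator {0..t} \<tau> * (\<bar>real_of_int k\<bar> * M)"])
    show "(\<lambda>\<tau>. indicator {0..t} \<tau> *\<^sub>R g \<tau>) \<in> borel_measurable lborel"
      unfolding g_def by measurable
    show "(\<lambda>\<tau>. indicator {0..t} \<tau> *\<^sub>R f n \<tau>) \<in> borel_measurable lborel" for n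
      using mf[of n] by measurable
    show "integrable lborel (\<lambda>\<tau>. indicator {0..t} \<tau> * (\<bar>real_of_int k\<bar> * M))"
      by (intro integrable_mult_left) (auto simp: emeasure_lborel_Icc_eq)
    show "AE \<tau> in lborel. (\<lambda>n. indicator {0..t} \<tau> *\<^sub>R f n \<tau>) \<longlonglongrightarrow> indicator {0..t} \<tau> *\<^sub>R g \<tau>"
    proof (rule AE_I2)
      fix \<tau>
      show "(\<lambda>n. indicator {0..t} \<tau> *\<^sub>R f n \<tau>) \<longlonglongrightarrow> indicator {0..t} \<tau> *\<^sub>R g \<tau>"
      proof (cases "\<tau> \<in> {0..t}")
        case True
        then have \<tau>: "\<tau> \<in> {0..T}" using t by auto
        have th1: "(\<lambda>n. \<theta> n k) \<longlonglongrightarrow> 1" by (rule tendsto_eventually[OF th])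
        have "(\<lambda>n. f n \<tau>) \<longlonglongrightarrow> g \<tau>"
          unfolding f_def g_def by (intro tendsto_mult tendsto_const tendsto_of_real th1 rhs[OF \<tau>])
        then show ?thesis by (rule tendsto_scaleR[OF tendsto_const])
      qed simp
    qed
    show "AE \<tau> in lborel. norm (indicator {0..t} \<tau> *\<^sub>R f n \<tau>) \<le> indicator {0..t} \<tau> * (\<bar>real_of_int k\<bar> * M)" for n
    proof (rule AE_I2)
      fix \<tau>
      have "cmod (f n \<tau>) = \<bar>real_of_int k\<bar> / 2 * \<bar>\<theta> n k\<bar> * cmod (kdv_rhs (V n) k \<tau>)"
        unfolding f_def by (simp only: norm_mult) simp
      also have "\<dots> \<le> \<bar>real_of_int k\<bar> * 1 * M"
        by (intro mult_mono strong_solutionD(2)[OF sol] bounded_path.norm_kdv_rhs[OF bV]) auto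
      finally show "norm (indicator {0..t} \<tau> *\<^sub>R f n \<tau>) \<le> indicator {0..t} \<tau> * (\<bar>real_of_int k\<bar> * M)"
        by (simp add: indicator_def)
    qed
  qed
  then have "(\<lambda>n. V n 0 k + (LINT \<tau>:{0..t}|lborel. f n \<tau>)) \<longlonglongrightarrow> v 0 k + (LINT \<tau>:{0..t}|lborel. g \<tau>)"
    unfolding set_lebesgue_integral_def using t by (intro tendsto_add lim) auto
  moreover have "V n 0 k + (LINT \<tau>:{0..t}|lborel. f n \<tau>) = V n t k" for n
    unfolding f_def by (rule strong_solutionD(3)[OF sol t, symmetric])
  ultimately have "(\<lambda>n. V n t k) \<longlonglongrightarrow> v 0 k + (LINT \<tau>:{0..t}|lborel. g \<tau>)" by (simp only:)
  then have "v t k = v 0 k + (LINT \<tau>:{0..t}|lborel. g \<tau>)" by (rule LIMSEQ_unique[OF lim[OF t]])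
  then show "v t k = v 0 k + (LINT \<tau>:{0..t}|lborel. (1/2) * \<i> * of_int k * of_real 1 * kdv_rhs v k \<tau>)"
    unfolding g_def .
qed simp

lemma galerkin_sequence:
  assumes T: "0 < T" and \<sigma>: "0 \<le> \<sigma>" "\<sigma> \<le> 1" and v0: "v0 \<in> Hdot \<sigma>" and M: "hsq 0 v0 \<le> ennreal M" "0 \<le> M"
  shows "\<exists>V. strong_solution T (\<lambda>k. if \<bar>k\<bar> \<le> int n then 1 else 0) M V \<and> V 0 = truncation n v0 \<and>
    (\<forall>t k. V t (- k) = cnj (V t k)) \<and>
    (\<forall>t\<in>{0..T}. hsq \<sigma> (V t) \<le> ennreal (growth_const M T) * hsq \<sigma> v0)"
proof -
  have v00: "v0 0 = 0" and vc: "\<And>k. v0 (- k) = cnj (v0 k)" using v0 by (auto simp: Hdot_iff)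
  let ?a = "truncation n v0"
  have sum: "(\<Sum>k\<in>{- int n..int n}. (cmod (?a k))\<^sup>2) \<le> M"
  proof -
    have "ennreal (\<Sum>k\<in>{- int n..int n}. (cmod (?a k))\<^sup>2) = sqsum (\<lambda>k. enorm (?a k))"
      by (rule sqsum_finite_support[symmetric]) (auto simp: truncation_def)
    also have "\<dots> = hsq 0 ?a" by (rule hsq_zero_exponent[symmetric]) (simp add: truncation_def v00)
    also have "\<dots> \<le> hsq 0 v0" by (rule hsq_truncation_le)
    also have "\<dots> \<le> ennreal M" by (rule M(1))
    finally show ?thesis using M(2) by (simp add: ennreal_le_iff)
  qed
  have a: "?a 0 = 0" "?a (- k) = cnj (?a k)" "int n < \<bar>k\<bar> \<Longrightarrow> ?a k = 0" for k
    by (simp_all add: truncation_def v00 vc)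
  from galerkin_solution[OF less_imp_le[OF T] a sum]
  obtain V where V': "strong_solution T (\<lambda>k. if \<bar>k\<bar> \<le> int n then 1 else 0) M V \<and> V 0 = ?a \<and>
    (\<forall>t k. V t (- k) = cnj (V t k)) \<and> (\<forall>t k. int n < \<bar>k\<bar> \<longrightarrow> V t k = 0)"
    by (rule exE)
  have V: "strong_solution T (\<lambda>k. if \<bar>k\<bar> \<le> int n then 1 else 0) M V" "V 0 = ?a"
    "V t (- k) = cnj (V t k)" "int n < \<bar>k\<bar> \<Longrightarrow> V t k = 0" for t k
    using V' by simp_all
  interpret V: bounded_path V M by (rule strong_solutionD[OF V(1)])
  \<comment> \<open>This bound depends on n, but it only supplies the finiteness asked for by
    \<open>a_priori_bound\<close>, whose constant does not involve it.\<close>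
  have fin: "hsq \<sigma> (V t) \<le> ennreal ((real n)\<^sup>2 * M)" for t
  proof -
    have "hsq \<sigma> (V t) \<le> ennreal ((real n)\<^sup>2) * hsq 0 (V t)"
      by (rule hsq_finite_support[where f="V t", OF \<sigma>(2) V.zero V(4)])
    also have "\<dots> \<le> ennreal ((real n)\<^sup>2) * ennreal M"
      using V.sq_bound[of t] by (intro mult_left_mono) (simp_all add: hsq_zero_exponent)
    finally show ?thesis using M(2) by (simp add: ennreal_mult)
  qed
  have "hsq \<sigma> (V t) \<le> ennreal (growth_const M T) * hsq \<sigma> v0" if t: "t \<in> {0..T}" for t
  proof -
    have "hsq \<sigma> (V t) \<le> ennreal (growth_const M T) * hsq \<sigma> (V 0)"
      by (rule a_priori_bound[OF V(1) \<sigma> _ fin t]) (use M(2) in simp)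
    also have "\<dots> \<le> ennreal (growth_const M T) * hsq \<sigma> v0"
      unfolding V(2) by (intro mult_left_mono hsq_truncation_le) simp
    finally show ?thesis .
  qed
  then show ?thesis using V(1-3) by (intro exI[of _ V] conjI allI ballI)
qed

lemma kdv_existence:
  assumes T: "0 < T" and \<sigma>: "0 < \<sigma>" "\<sigma> \<le> 1" and v0: "v0 \<in> Hdot \<sigma>" and M: "hsq 0 v0 \<le> ennreal M" "0 \<le> M"
  obtains v where "strong_solution T (\<lambda>_. 1) M v" "v 0 = v0" "\<And>t k. v t (- k) = cnj (v t k)"
    "\<And>t. t \<in> {0..T} \<Longrightarrow> hsq \<sigma> (v t) \<le> ennreal (growth_const M T) * hsq \<sigma> v0"
proof -
  define \<theta> :: "nat \<Rightarrow> int \<Rightarrow> real" where "\<theta> n k = (if \<bar>k\<bar> \<le> int n then 1 else 0)" for n k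
  define B where "B = growth_const M T * enn2real (hsq \<sigma> v0)"
  have B0: "0 \<le> B" using growth_const_nonneg by (simp add: B_def)
  have B: "ennreal (growth_const M T) * hsq \<sigma> v0 = ennreal B"
    using v0 growth_const_nonneg by (simp add: B_def Hdot_iff ennreal_mult)
  have "\<forall>n. \<exists>V. strong_solution T (\<theta> n) M V \<and> V 0 = truncation n v0 \<and>
    (\<forall>t k. V t (- k) = cnj (V t k)) \<and> (\<forall>t\<in>{0..T}. hsq \<sigma> (V t) \<le> ennreal B)"
    unfolding \<theta>_def B[symmetric] using galerkin_sequence[OF T _ \<sigma>(2) v0 M] \<sigma>(1) by auto
  from choice[OF this] obtain V where V: "\<forall>n. strong_solution T (\<theta> n) M (V n) \<and> V n 0 = truncation n v0 \<and>
    (\<forall>t k. V n t (- k) = cnj (V n t k)) \<and> (\<forall>t\<in>{0..T}. hsq \<sigma> (V n t) \<le> ennreal B)"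
    by (rule exE)
  have sol: "strong_solution T (\<theta> n) M (V n)" and V0: "V n 0 = truncation n v0"
    and Vc: "V n t (- k) = cnj (V n t k)" and VB: "t \<in> {0..T} \<Longrightarrow> hsq \<sigma> (V n t) \<le> ennreal B" for n t k
    using V[rule_format, of n] by simp_all
  have bp: "bounded_path (V n) M" for n by (rule strong_solutionD[OF sol])
  \<comment> \<open>Rational times and frequencies together are countable, so one diagonal
    subsequence serves all of them.\<close>
  define S where "S = (\<rat> \<inter> {0..T}) \<times> (UNIV :: int set)"
  have "countable S" unfolding S_def by (intro countable_SIGMA countable_Int1 countable_rat) auto
  note cS = this
  obtain r where r: "strict_mono (r :: nat \<Rightarrow> nat)"
    and conv: "\<And>p. p \<in> S \<Longrightarrow> \<exists>l. (\<lambda>n. V (r n) (fst p) (snd p)) \<longlonglongrightarrow> l"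
    by (rule function_convergent_subsequence[where f="\<lambda>n p. V n (fst p) (snd p)" and M="sqrt M",
          OF cS bounded_path.norm_le[OF bp]]) blast
  have lip: "cmod (V n t k - V n t' k) \<le> \<bar>real_of_int k\<bar> * M * \<bar>t - t'\<bar>" if "t \<in> {0..T}" "t' \<in> {0..T}" for n t t' k
  proof (cases "t' \<le> t")
    case True
    then show ?thesis using strong_solution_Lipschitz_in_time[OF sol, of t' t n k] that by simp
  next
    case False
    then show ?thesis using strong_solution_Lipschitz_in_time[OF sol, of t t' n k] that
      by (simp add: norm_minus_commute)
  qed
  have cv: "convergent (\<lambda>n. V (r n) t k)" if t: "t \<in> {0..T}" for t k
  proof (rule Cauchy_from_dense[where f="\<lambda>n t. V (r n) t k", OF T _ lip _ t])
    show "0 \<le> \<bar>real_of_int k\<bar> * M" using M(2) by simp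
    show "convergent (\<lambda>n. V (r n) q k)" if "q \<in> {0..T}" "q \<in> \<rat>" for q
      using conv[of "(q, k)"] that by (simp add: S_def convergent_def)
  qed
  define x where "x t k = lim (\<lambda>n. V (r n) t k)" for t k
  have lim: "(\<lambda>n. V (r n) t k) \<longlonglongrightarrow> x t k" if "t \<in> {0..T}" for t k
    using cv[OF that] unfolding x_def by (simp only: convergent_LIMSEQ_iff)
  have x_lip: "cmod (x t k - x t' k) \<le> \<bar>real_of_int k\<bar> * M * \<bar>t - t'\<bar>" if "t \<in> {0..T}" "t' \<in> {0..T}" for t t' k
    by (rule Lim_bounded[where M=0, OF tendsto_norm[OF tendsto_diff[OF lim lim]]]) (use that lip in auto)
  have contx: "continuous_on {0..T} (\<lambda>t. x t k)" for k
  proof (rule lipschitz_on_continuous_on)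
    show "(\<bar>real_of_int k\<bar> * M)-lipschitz_on {0..T} (\<lambda>t. x t k)"
      by (rule lipschitz_onI) (use x_lip M(2) in \<open>auto simp: dist_norm\<close>)
  qed
  have x0: "x t 0 = 0" if "t \<in> {0..T}" for t
    using lim[OF that, of 0] bounded_path.zero[OF bp] by (simp add: LIMSEQ_const_iff)
  have xc: "x t (- k) = cnj (x t k)" if "t \<in> {0..T}" for t k
    using LIMSEQ_unique[OF lim[OF that, of "- k"]] tendsto_cnj[OF lim[OF that, of k]] by (simp add: Vc)
  have xsq: "sqsum (\<lambda>k. enorm (x t k)) \<le> ennreal M" if t: "t \<in> {0..T}" for t
  proof -
    have "hsq 0 (x t) \<le> ennreal M"
    proof (rule hsq_lower_semicontinuous[OF lim[OF t]])
      show "hsq 0 (V (r n) t) \<le> ennreal M" for n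
        using bounded_path.sq_bound[OF bp] bounded_path.zero[OF bp] by (simp add: hsq_zero_exponent)
    qed
    then show ?thesis using x0[OF t] by (simp add: hsq_zero_exponent)
  qed
  have xB: "hsq \<sigma> (x t) \<le> ennreal B" if t: "t \<in> {0..T}" for t
    by (rule hsq_lower_semicontinuous[OF lim[OF t] VB[OF t]])
  define v where "v = clamp_path T x"
  have vx: "v t = x t" if "t \<in> {0..T}" for t using that by (simp add: v_def)
  have bv: "bounded_path v M"
    unfolding v_def using T by (intro clamp_path_bounded contx x0 xsq M(2)) auto
  have "strong_solution T (\<lambda>_. 1) M v"
  proof (rule strong_solution_limit[where V="\<lambda>n. V (r n)" and \<theta>="\<lambda>n. \<theta> (r n)", OF sol bv])
    fix k
    show "\<forall>\<^sub>F n in sequentially. \<theta> (r n) k = 1"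
      using eventually_ge_at_top[of "nat \<bar>k\<bar>"]
    proof eventually_elim
      case (elim n)
      have "n \<le> r n" by (rule seq_suble[OF r])
      then show ?case using elim by (simp add: \<theta>_def)
    qed
  next
    fix t k assume t: "t \<in> {0..T}"
    show "(\<lambda>n. V (r n) t k) \<longlonglongrightarrow> v t k" unfolding vx[OF t] by (rule lim[OF t])
  next
    fix t assume t: "t \<in> {0..T}"
    \<comment> \<open>Here \<sigma> > 0 enters: the uniform bound in H^\<sigma> upgrades convergence
      of the modes to convergence in l2.\<close>
    have "(\<lambda>n. hsq 0 (\<lambda>k. V (r n) t k - x t k)) \<longlonglongrightarrow> 0"
    proof (rule hsq_tendsto_0[OF \<sigma>(1)])
      show "(\<lambda>n. V (r n) t k - x t k) \<longlonglongrightarrow> 0" for k by (rule LIM_zero[OF lim[OF t]])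
      have "hsq \<sigma> (\<lambda>k. V (r n) t k - x t k) \<le> ennreal (2 * (B + B))" for n
      proof -
        have "hsq \<sigma> (\<lambda>k. V (r n) t k - x t k) \<le> 2 * (hsq \<sigma> (V (r n) t) + hsq \<sigma> (x t))"
          by (rule hsq_diff_le)
        also have "\<dots> \<le> 2 * (ennreal B + ennreal B)"
          by (intro mult_left_mono add_mono VB xB t) simp
        also have "\<dots> = ennreal (2 * (B + B))" using B0 by (simp only: ennreal_real_ops)
        finally show ?thesis .
      qed
      then show "\<forall>\<^sub>F n in sequentially. hsq \<sigma> (\<lambda>k. V (r n) t k - x t k) \<le> ennreal (2 * (B + B))"
        by (intro always_eventually allI)
      show "0 \<le> 2 * (B + B)" using B0 by simp
    qed
    then show "(\<lambda>n. sqsum (\<lambda>k. enorm (V (r n) t k - v t k))) \<longlonglongrightarrow> 0"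
      using x0[OF t] bounded_path.zero[OF bp] by (simp add: hsq_zero_exponent vx[OF t])
  qed
  moreover have "v 0 = v0"
  proof
    fix k
    have z: "0 \<in> {0..T}" using T by auto
    have "\<forall>\<^sub>F n in sequentially. V (r n) 0 k = v0 k"
      using eventually_ge_at_top[of "nat \<bar>k\<bar>"]
    proof eventually_elim
      case (elim n)
      have "n \<le> r n" by (rule seq_suble[OF r])
      then show ?case using elim by (simp add: V0 truncation_def)
    qed
    then have "(\<lambda>n. V (r n) 0 k) \<longlonglongrightarrow> v0 k" by (rule tendsto_eventually)
    then have "x 0 k = v0 k" by (rule LIMSEQ_unique[OF lim[OF z]])
    then show "v 0 k = v0 k" by (simp add: vx[OF z])
  qed
  moreover have "v t (- k) = cnj (v t k)" for t k
    unfolding v_def clamp_path_def using T by (intro xc) auto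
  moreover have "hsq \<sigma> (v t) \<le> ennreal (growth_const M T) * hsq \<sigma> v0" if "t \<in> {0..T}" for t
    unfolding B vx[OF that] by (rule xB[OF that])
  ultimately show ?thesis by (rule that)
qed

section \<open>Uniqueness, continuity in time and the well-posedness theorem\<close>

lemma kdv_solution_eq_strong:
  assumes T: "0 < T" and w: "kdv_solution T v0 w"
    and v: "strong_solution T (\<lambda>_. 1) M v" "v 0 = v0" and t: "t \<in> {0..T}"
  shows "w t = v t"
proof -
  have "v0 0 = 0" using bounded_path.zero[OF strong_solutionD(1)[OF v(1)], of 0] v(2) by simp
  then obtain M' where w': "strong_solution T (\<lambda>_. 1) M' (clamp_path T w)" "w 0 = v0"
    by (rule kdv_solution_strong[OF T w])
  have "clamp_path T w 0 = v 0" using w'(2) v(2) T by simp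
  then have "clamp_path T w t = v t" by (rule strong_solution_unique[OF w'(1) v(1) _ t])
  then show ?thesis using t by simp
qed

text \<open>A solution y bounded in H^1 is continuous in H^s, because its modes are continuous and s
  < 1 makes the embedding compact. Truncated data give such y, and they approach v uniformly in time
  since the Lipschitz constant is the same for all truncations.\<close>

lemma strong_solution_continuous_Hdot:
  assumes T: "0 < T" and s: "0 < s" "s < 1" and v0: "v0 \<in> Hdot s" and M: "hsq 0 v0 \<le> ennreal M" "0 \<le> M"
    and v: "strong_solution T (\<lambda>_. 1) M v" "v 0 = v0"
      "\<And>t. t \<in> {0..T} \<Longrightarrow> hsq s (v t) \<le> ennreal (growth_const M T) * hsq s v0"
    and t0: "t0 \<in> {0..T}"
  shows "((\<lambda>t. hsq s (\<lambda>k. v t k - v t0 k)) \<longlongrightarrow> 0) (at t0 within {0..T})"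
proof (rule order_tendstoI)
  fix e :: ennreal assume e: "0 < e"
  have v00: "v0 0 = 0" and vc: "\<And>k. v0 (- k) = cnj (v0 k)" and vfin: "hsq s v0 < top"
    using v0 by (auto simp: Hdot_iff)
  define B where "B = max M (growth_const M T * enn2real (hsq s v0))"
  define C where "C = growth_const (4 * B) T"
  have C0: "0 \<le> C" by (simp add: C_def growth_const_nonneg)
  have growB: "ennreal (growth_const M T) * hsq s v0 \<le> ennreal B"
  proof -
    have "ennreal (growth_const M T) * hsq s v0 = ennreal (growth_const M T * enn2real (hsq s v0))"
      using vfin growth_const_nonneg by (simp add: ennreal_mult)
    also have "\<dots> \<le> ennreal B" by (intro ennreal_leI) (simp add: B_def)
    finally show ?thesis .
  qed
  \<comment> \<open>v and y are compared at t and at t0; two uses of \<open>hsq_diff_le\<close> turn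
    these two distances into 8 C times the distance of the data.\<close>
  have "(\<lambda>m. ennreal (8 * C) * hsq s (\<lambda>k. v0 k - truncation m v0 k)) \<longlonglongrightarrow> ennreal (8 * C) * 0"
    by (rule ennreal_tendsto_cmult[OF _ truncation_tendsto[OF vfin]]) simp
  then have "\<forall>\<^sub>F m in sequentially. ennreal (8 * C) * hsq s (\<lambda>k. v0 k - truncation m v0 k) < e"
    using e by (intro order_tendstoD) auto
  then obtain m where m: "ennreal (8 * C) * hsq s (\<lambda>k. v0 k - truncation m v0 k) < e"
    by (auto simp: eventually_sequentially)
  define a where "a = truncation m v0"
  define e' where "e' = e - ennreal (8 * C) * hsq s (\<lambda>k. v0 k - a k)"
  have e': "0 < e'" using m by (simp add: e'_def a_def diff_gr0_ennreal)
  have a0: "a 0 = 0" by (simp add: a_def truncation_def v00)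
  have aM: "hsq 0 a \<le> ennreal M" unfolding a_def by (rule order_trans[OF hsq_truncation_le M(1)])
  have a1: "hsq 1 a < top"
  proof -
    have "hsq 1 a \<le> ennreal ((real m)\<^sup>2) * hsq 0 a"
      by (rule hsq_finite_support) (auto simp: a_def truncation_def v00)
    also have "\<dots> \<le> ennreal ((real m)\<^sup>2) * ennreal M" by (intro mult_left_mono aM) simp
    also have "\<dots> < top" by (simp add: ennreal_mult_less_top)
    finally show ?thesis .
  qed
  have aH: "a \<in> Hdot 1" using a0 a1 vc by (auto simp: Hdot_iff a_def truncation_def)
  obtain y where y: "strong_solution T (\<lambda>_. 1) M y" "y 0 = a"
    "\<And>t. t \<in> {0..T} \<Longrightarrow> hsq 1 (y t) \<le> ennreal (growth_const M T) * hsq 1 a"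
    by (rule kdv_existence[OF T zero_less_one order_refl aH aM M(2)]) blast
  interpret y: bounded_path y M by (rule strong_solutionD[OF y(1)])
  define D where "D = growth_const M T * enn2real (hsq 1 a)"
  have D0: "0 \<le> D" by (simp add: D_def growth_const_nonneg)
  have yD: "hsq 1 (y t) \<le> ennreal D" if "t \<in> {0..T}" for t
    using y(3)[OF that] a1 growth_const_nonneg by (simp add: D_def ennreal_mult)
  \<comment> \<open>The bound D in H^1 depends on m. It is used as mere finiteness, and
    \<open>a_priori_bound\<close> then yields a bound B independent of m.\<close>
  have ys: "hsq s (y t) \<le> ennreal B" if t: "t \<in> {0..T}" for t
  proof -
    have "hsq s (y t) \<le> ennreal (growth_const M T) * hsq s (y 0)"
    proof (rule a_priori_bound[OF y(1) _ _ D0 _ t])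
      show "hsq s (y t) \<le> ennreal D" if "t \<in> {0..T}" for t
        using s by (intro order_trans[OF hsq_mono yD[OF that]]) simp
    qed (use s in auto)
    also have "\<dots> \<le> ennreal (growth_const M T) * hsq s v0"
      unfolding y(2) a_def by (intro mult_left_mono hsq_truncation_le) simp
    also note growB
    finally show ?thesis .
  qed
  have close: "hsq s (\<lambda>k. v t k - y t k) \<le> ennreal C * hsq s (\<lambda>k. v0 k - a k)" if t: "t \<in> {0..T}" for t
    unfolding C_def v(2)[symmetric] y(2)[symmetric]
  proof (rule lipschitz_bound[OF v(1) y(1) _ _ _ _ ys t])
    show "hsq s (v t) \<le> ennreal B" if "t \<in> {0..T}" for t
      by (rule order_trans[OF v(3)[OF that] growB])
  qed (use s in \<open>auto simp: B_def\<close>)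
  have "((\<lambda>t. hsq s (\<lambda>k. y t k - y t0 k)) \<longlongrightarrow> 0) (at t0 within {0..T})"
  proof (rule hsq_tendsto_0[OF s(2)])
    show "((\<lambda>t. y t k - y t0 k) \<longlongrightarrow> 0) (at t0 within {0..T})" for k
    proof (rule LIM_zero)
      have "continuous_on {0..T} (\<lambda>t. y t k)" by (rule continuous_on_subset[OF y.cont]) simp
      then show "((\<lambda>t. y t k) \<longlongrightarrow> y t0 k) (at t0 within {0..T})"
        using t0 by (simp add: continuous_on_def)
    qed
    show "\<forall>\<^sub>F t in at t0 within {0..T}. hsq 1 (\<lambda>k. y t k - y t0 k) \<le> ennreal (2 * (D + D))"
    proof -
      have "hsq 1 (\<lambda>k. y t k - y t0 k) \<le> ennreal (2 * (D + D))" if t: "t \<in> {0..T}" for t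
      proof -
        have "hsq 1 (\<lambda>k. y t k - y t0 k) \<le> 2 * (hsq 1 (y t) + hsq 1 (y t0))" by (rule hsq_diff_le)
        also have "\<dots> \<le> 2 * (ennreal D + ennreal D)" by (intro mult_left_mono add_mono yD t t0) simp
        also have "\<dots> = ennreal (2 * (D + D))" using D0 by (simp only: ennreal_real_ops)
        finally show ?thesis .
      qed
      then show ?thesis by (auto simp: eventually_at_filter)
    qed
    show "0 \<le> 2 * (D + D)" using D0 by simp
  qed
  then have "((\<lambda>t. 4 * hsq s (\<lambda>k. y t k - y t0 k)) \<longlongrightarrow> 4 * 0) (at t0 within {0..T})"
    by (rule ennreal_tendsto_cmult[rotated]) simp
  then have "\<forall>\<^sub>F t in at t0 within {0..T}. 4 * hsq s (\<lambda>k. y t k - y t0 k) < e'"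
    using e' by (intro order_tendstoD) auto
  moreover have "\<forall>\<^sub>F t in at t0 within {0..T}. t \<in> {0..T}"
    by (auto simp: eventually_at_filter)
  ultimately show "\<forall>\<^sub>F t in at t0 within {0..T}. hsq s (\<lambda>k. v t k - v t0 k) < e"
  proof eventually_elim
    case (elim t)
    let ?c = "ennreal C * hsq s (\<lambda>k. v0 k - a k)"
    define p where "p k = v t k - y t k" for k
    define q where "q k = y t k - y t0 k" for k
    define h where "h k = v t0 k - y t0 k" for k
    have "(\<lambda>k. v t k - v t0 k) = (\<lambda>k. q k - (h k - p k))"
      by (simp add: fun_eq_iff p_def q_def h_def)
    then have "hsq s (\<lambda>k. v t k - v t0 k) \<le> 2 * (hsq s q + hsq s (\<lambda>k. h k - p k))"
      by (simp only: hsq_diff_le)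
    also have "\<dots> \<le> 2 * (hsq s q + 2 * (hsq s h + hsq s p))"
      by (intro mult_left_mono add_left_mono hsq_diff_le) simp
    also have "\<dots> \<le> 2 * (hsq s q + 2 * (?c + ?c))"
      unfolding h_def p_def by (intro mult_left_mono add_left_mono add_mono close t0 elim(2)) auto
    also have "\<dots> \<le> 4 * hsq s q + 8 * ?c"
    proof -
      have "2 * (A + 2 * (c + c)) = 2 * A + 8 * c" for A c :: ennreal
        by (simp add: distrib_left mult_2[symmetric] mult.assoc[symmetric])
      then have "2 * (hsq s q + 2 * (?c + ?c)) = 2 * hsq s q + 8 * ?c" .
      also have "\<dots> \<le> 4 * hsq s q + 8 * ?c" by (intro add_right_mono mult_right_mono) auto
      finally show ?thesis .
    qed
    also have "8 * ?c = ennreal (8 * C) * hsq s (\<lambda>k. v0 k - a k)"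
      using C0 by (simp only: mult.assoc[symmetric] ennreal_real_ops)
    also have "4 * hsq s q + ennreal (8 * C) * hsq s (\<lambda>k. v0 k - a k) < ennreal (8 * C) * hsq s (\<lambda>k. v0 k - a k) + e'"
      using elim(1) m unfolding q_def[abs_def] a_def[symmetric]
      by (subst add.commute) (auto simp: ennreal_add_left_cancel_less)
    also have "\<dots> = e"
      unfolding e'_def using m by (intro add_diff_inverse_ennreal) (simp add: a_def less_imp_le)
    finally show ?case .
  qed
qed auto

lemma hs_norm_sq_le: "v \<in> Hdot s \<Longrightarrow> hs_norm s v \<le> R \<Longrightarrow> hsq s v \<le> ennreal (R\<^sup>2)"
proof -
  assume v: "v \<in> Hdot s" and R: "hs_norm s v \<le> R"
  have "hsq s v = ennreal ((hs_norm s v)\<^sup>2)" using v by (intro hsq_hs_norm) (simp add: Hdot_iff)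
  also have "\<dots> \<le> ennreal (R\<^sup>2)" by (intro ennreal_leI power_mono R hs_norm_nonneg)
  finally show ?thesis .
qed

theorem theorem6p5:
  fixes s T :: real and v0 :: "int \<Rightarrow> complex"
  assumes "0 < s" "s \<le> 1/2" "0 < T" "v0 \<in> Hdot s"
  shows "\<exists>v. kdv_solution T v0 v
          \<and> (\<forall>w. kdv_solution T v0 w \<longrightarrow> (\<forall>t\<in>{0..T}. w t = v t))
          \<and> (\<forall>t\<in>{0..T}. v t \<in> Hdot s)
          \<and> (\<forall>t0\<in>{0..T}. ((\<lambda>t. hs_norm s (\<lambda>k. v t k - v t0 k)) \<longlongrightarrow> 0) (at t0 within {0..T}))
          \<and> (\<forall>R>0. \<exists>C. \<forall>a0 b0 a b.
               a0 \<in> Hdot s \<longrightarrow> b0 \<in> Hdot s \<longrightarrow> hs_norm s a0 \<le> R \<longrightarrow> hs_norm s b0 \<le> R \<longrightarrow>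
               kdv_solution T a0 a \<longrightarrow> kdv_solution T b0 b \<longrightarrow>
               (\<forall>t\<in>{0..T}. hs_norm s (\<lambda>k. a t k - b t k) \<le> C * hs_norm s (\<lambda>k. a0 k - b0 k)))"
proof -
  have s: "0 < s" "0 \<le> s" "s < 1" "s \<le> 1" and T: "0 < T" and v0: "v0 \<in> Hdot s"
    using assms by auto
  define M where "M = (hs_norm s v0)\<^sup>2"
  have M: "hsq 0 v0 \<le> ennreal M" "0 \<le> M"
    using order_trans[OF hsq_mono[OF s(2)] hs_norm_sq_le[OF v0 order_refl]] by (simp_all add: M_def)
  obtain v where v: "strong_solution T (\<lambda>_. 1) M v" "v 0 = v0" "\<And>t k. v t (- k) = cnj (v t k)"
    "\<And>t. t \<in> {0..T} \<Longrightarrow> hsq s (v t) \<le> ennreal (growth_const M T) * hsq s v0"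
    by (rule kdv_existence[OF T s(1) s(4) v0 M]) blast
  interpret v: bounded_path v M by (rule strong_solutionD[OF v(1)])
  have fin: "hsq s (v t) < top" if "t \<in> {0..T}" for t
  proof -
    have "ennreal (growth_const M T) * hsq s v0 < top"
      using v0 by (simp add: Hdot_iff ennreal_mult_less_top)
    with v(4)[OF that] show ?thesis by (rule le_less_trans)
  qed
  have sol: "kdv_solution T v0 v"
    using strong_solution_kdv[OF v(1,3)] unfolding v(2) .
  have unique: "\<forall>w. kdv_solution T v0 w \<longrightarrow> (\<forall>t\<in>{0..T}. w t = v t)"
    by (intro allI impI ballI) (rule kdv_solution_eq_strong[OF T _ v(1,2)])
  have in_Hdot: "\<forall>t\<in>{0..T}. v t \<in> Hdot s"
    using v.zero v(3) fin by (simp add: Hdot_iff)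
  have cont: "((\<lambda>t. hs_norm s (\<lambda>k. v t k - v t0 k)) \<longlongrightarrow> 0) (at t0 within {0..T})" if t0: "t0 \<in> {0..T}" for t0
  proof -
    have "((\<lambda>t. hsq s (\<lambda>k. v t k - v t0 k)) \<longlongrightarrow> 0) (at t0 within {0..T})"
      by (rule strong_solution_continuous_Hdot[OF T s(1,3) v0 M v(1,2,4) t0])
    then have "((\<lambda>t. enn2real (hsq s (\<lambda>k. v t k - v t0 k))) \<longlongrightarrow> enn2real 0) (at t0 within {0..T})"
      by (intro tendsto_enn2real) simp_all
    then have "((\<lambda>t. sqrt (enn2real (hsq s (\<lambda>k. v t k - v t0 k)))) \<longlongrightarrow> sqrt (enn2real 0)) (at t0 within {0..T})"
      by (rule tendsto_real_sqrt)
    then show ?thesis by (simp add: hs_norm_hsq)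
  qed
  have lipschitz: "\<exists>C. \<forall>a0 b0 a b.
       a0 \<in> Hdot s \<longrightarrow> b0 \<in> Hdot s \<longrightarrow> hs_norm s a0 \<le> R \<longrightarrow> hs_norm s b0 \<le> R \<longrightarrow>
       kdv_solution T a0 a \<longrightarrow> kdv_solution T b0 b \<longrightarrow>
       (\<forall>t\<in>{0..T}. hs_norm s (\<lambda>k. a t k - b t k) \<le> C * hs_norm s (\<lambda>k. a0 k - b0 k))" for R
  proof -
    \<comment> \<open>\<open>lipschitz_bound\<close> wants one constant above both the squared H^0
      bound \<open>R\<^sup>2\<close> and the a priori bound in H^s.\<close>
    define B where "B = max (R\<^sup>2) (growth_const (R\<^sup>2) T * R\<^sup>2)"
    define C where "C = growth_const (4 * B) T"
    have C0: "0 \<le> C" by (simp add: C_def growth_const_nonneg)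
    \<comment> \<open>An arbitrary solution is a priori bounded in H^0 only. Uniqueness identifies
      it with the constructed one, which carries the bound in H^s.\<close>
    have strong: "\<exists>y. strong_solution T (\<lambda>_. 1) (R\<^sup>2) y \<and> y 0 = y0 \<and> (\<forall>t\<in>{0..T}. x t = y t)
        \<and> (\<forall>t\<in>{0..T}. hsq s (y t) \<le> ennreal B)"
      if y0: "y0 \<in> Hdot s" "hs_norm s y0 \<le> R" and x: "kdv_solution T y0 x" for y0 x
    proof -
      have h: "hsq s y0 \<le> ennreal (R\<^sup>2)" by (rule hs_norm_sq_le[OF y0])
      have h0: "hsq 0 y0 \<le> ennreal (R\<^sup>2)" by (rule order_trans[OF hsq_mono[OF s(2)] h])
      obtain y where y: "strong_solution T (\<lambda>_. 1) (R\<^sup>2) y" "y 0 = y0"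
        "\<And>t. t \<in> {0..T} \<Longrightarrow> hsq s (y t) \<le> ennreal (growth_const (R\<^sup>2) T) * hsq s y0"
        by (rule kdv_existence[OF T s(1) s(4) y0(1) h0]) (simp, blast)
      have "hsq s (y t) \<le> ennreal B" if "t \<in> {0..T}" for t
      proof -
        have "hsq s (y t) \<le> ennreal (growth_const (R\<^sup>2) T) * ennreal (R\<^sup>2)"
          by (rule order_trans[OF y(3)[OF that] mult_left_mono[OF h]]) simp
        also have "\<dots> = ennreal (growth_const (R\<^sup>2) T * R\<^sup>2)"
          using growth_const_nonneg by (simp add: ennreal_mult)
        also have "\<dots> \<le> ennreal B" by (intro ennreal_leI) (simp add: B_def)
        finally show ?thesis .
      qed
      then show ?thesis
        using y(1,2) kdv_solution_eq_strong[OF T x y(1,2)] by (intro exI[of _ y] conjI ballI)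
    qed
    \<comment> \<open>\<open>lipschitz_bound\<close> compares squared norms, whence the square root
      of C.\<close>
    have "hs_norm s (\<lambda>k. a t k - b t k) \<le> sqrt C * hs_norm s (\<lambda>k. a0 k - b0 k)"
      if a0: "a0 \<in> Hdot s" "hs_norm s a0 \<le> R" and b0: "b0 \<in> Hdot s" "hs_norm s b0 \<le> R"
        and a: "kdv_solution T a0 a" and b: "kdv_solution T b0 b" and t: "t \<in> {0..T}" for a0 b0 a b t
    proof -
      from strong[OF a0 a] obtain x where x: "strong_solution T (\<lambda>_. 1) (R\<^sup>2) x \<and> x 0 = a0 \<and> (\<forall>t\<in>{0..T}. a t = x t)
        \<and> (\<forall>t\<in>{0..T}. hsq s (x t) \<le> ennreal B)" by (rule exE)
      from strong[OF b0 b] obtain y where y: "strong_solution T (\<lambda>_. 1) (R\<^sup>2) y \<and> y 0 = b0 \<and> (\<forall>t\<in>{0..T}. b t = y t)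
        \<and> (\<forall>t\<in>{0..T}. hsq s (y t) \<le> ennreal B)" by (rule exE)
      have "hsq s (\<lambda>k. x t k - y t k) \<le> ennreal C * hsq s (\<lambda>k. x 0 k - y 0 k)"
        unfolding C_def using x y s by (intro lipschitz_bound[where M="R\<^sup>2" and \<theta>="\<lambda>_. 1"] t) (auto simp: B_def)
      then have le: "hsq s (\<lambda>k. a t k - b t k) \<le> ennreal C * hsq s (\<lambda>k. a0 k - b0 k)"
        using x y t by simp
      \<comment> \<open>Finiteness matters: \<open>hs_norm\<close> is 0 on a divergent sum and would
        then not bound \<open>hsq\<close>.\<close>
      have "hsq s (\<lambda>k. a0 k - b0 k) < top"
      proof -
        have "hsq s (\<lambda>k. a0 k - b0 k) \<le> 2 * (hsq s a0 + hsq s b0)" by (rule hsq_diff_le)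
        also have "\<dots> < top" using a0 b0 by (simp add: Hdot_iff ennreal_mult_less_top)
        finally show ?thesis .
      qed
      then have "hsq s (\<lambda>k. a0 k - b0 k) = ennreal ((hs_norm s (\<lambda>k. a0 k - b0 k))\<^sup>2)" by (rule hsq_hs_norm)
      with le have "hsq s (\<lambda>k. a t k - b t k) \<le> ennreal (C * (hs_norm s (\<lambda>k. a0 k - b0 k))\<^sup>2)"
        using C0 by (simp add: ennreal_mult)
      also have "C * (hs_norm s (\<lambda>k. a0 k - b0 k))\<^sup>2 = (sqrt C * hs_norm s (\<lambda>k. a0 k - b0 k))\<^sup>2"
        using C0 by (simp add: power_mult_distrib)
      finally show ?thesis
        by (rule hs_norm_leI) (simp add: C0 hs_norm_nonneg)
    qed
    then show ?thesis by blast
  qed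
  show ?thesis
    by (intro exI[of _ v] conjI sol unique in_Hdot ballI cont allI impI lipschitz)
qed

end
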